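(* For each $H\in\{\mathbb Z/2\mathbb Z\times\mathbb Z/18\mathbb Z,\ \mathbb Z/3\mathbb Z\times\mathbb Z/9\mathbb Z,\ \mathbb Z/3\mathbb Z\times\mathbb Z/12\mathbb Z,\ \mathbb Z/6\mathbb Z\times\mathbb Z/6\mathbb Z\}$ there are infinitely many pairwise non-isomorphic (over $\overline{\mathbb Q}$) elliptic curves $E/\mathbb Q$ such that for each of them there is a number field $K$ of degree $6$ with $E(K)_{\mathrm{tors}}\cong H$. *)

theory Defs
  imports "HOL-Algebra.Elementary_Groups" "HOL-Algebra.Algebraic_Closure_Type"
begin

text \<open>
  Elliptic curves are given by general Weierstrass equations
  \<open>y\<^sup>2 + a\<^sub>1 x y + a\<^sub>3 y = x\<^sup>3 + a\<^sub>2 x\<^sup>2 + a\<^sub>4 x + a\<^sub>6\<close>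
  with nonvanishing discriminant.  The algebraic closure of the rationals is the
  type \<open>rat alg_closure\<close>; number fields are its subfields of finite degree.
\<close>

datatype 'a weierstrass =
  Weierstrass (coeff_a1: 'a) (coeff_a2: 'a) (coeff_a3: 'a) (coeff_a4: 'a) (coeff_a6: 'a)

text \<open>Left-hand side minus right-hand side of the equation, evaluated at \<open>(x, y)\<close>.\<close>

definition weierstrass_eval :: "'a::field weierstrass \<Rightarrow> 'a \<Rightarrow> 'a \<Rightarrow> 'a" where
  "weierstrass_eval E x y =
     y^2 + coeff_a1 E * x * y + coeff_a3 E * y
       - (x^3 + coeff_a2 E * x^2 + coeff_a4 E * x + coeff_a6 E)"

definition discriminant :: "'a::field weierstrass \<Rightarrow> 'a" where
  "discriminant E =
     (let a1 = coeff_a1 E; a2 = coeff_a2 E; a3 = coeff_a3 E; a4 = coeff_a4 E; a6 = coeff_a6 E;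
          b2 = a1^2 + 4 * a2;
          b4 = 2 * a4 + a1 * a3;
          b6 = a3^2 + 4 * a6;
          b8 = a1^2 * a6 + 4 * a2 * a6 - a1 * a3 * a4 + a2 * a3^2 - a4^2
      in - (b2^2 * b8) - 8 * b4^3 - 27 * b6^2 + 9 * b2 * b4 * b6)"

definition elliptic_curve :: "'a::field weierstrass \<Rightarrow> bool" where
  "elliptic_curve E \<longleftrightarrow> discriminant E \<noteq> 0"


text \<open>
  The chord-tangent addition.  The first test for affine points is \<open>P\<^sub>2 = - P\<^sub>1\<close>; on the
  curve, if it fails and \<open>x\<^sub>1 = x\<^sub>2\<close>, then \<open>P\<^sub>1 = P\<^sub>2\<close> and \<open>l\<close> is the slope of the tangent.
\<close>

datatype 'a point = Infinity | Affine 'a 'a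

fun point_add :: "'a::field weierstrass \<Rightarrow> 'a point \<Rightarrow> 'a point \<Rightarrow> 'a point" where
  "point_add E Infinity Q = Q"
| "point_add E P Infinity = P"
| "point_add E (Affine x1 y1) (Affine x2 y2) =
     (if x1 = x2 \<and> y2 = - y1 - coeff_a1 E * x1 - coeff_a3 E then Infinity
      else
        let l = (if x1 = x2
                 then (3 * x1^2 + 2 * coeff_a2 E * x1 + coeff_a4 E - coeff_a1 E * y1)
                        / (2 * y1 + coeff_a1 E * x1 + coeff_a3 E)
                 else (y2 - y1) / (x2 - x1));
            x3 = l^2 + coeff_a1 E * l - coeff_a2 E - x1 - x2;
            y3 = - (l * (x3 - x1) + y1) - coeff_a1 E * x3 - coeff_a3 E
        in Affine x3 y3)"

definition points_over :: "'a::field weierstrass \<Rightarrow> 'a set \<Rightarrow> 'a point set" where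
  "points_over E K =
     insert Infinity {Affine x y | x y. x \<in> K \<and> y \<in> K \<and> weierstrass_eval E x y = 0}"

definition point_group :: "'a::field weierstrass \<Rightarrow> 'a set \<Rightarrow> 'a point monoid" where
  "point_group E K =
     \<lparr>carrier = points_over E K, monoid.mult = point_add E, one = Infinity\<rparr>"

definition torsion_subgroup :: "('a, 'b) monoid_scheme \<Rightarrow> ('a, 'b) monoid_scheme" where
  "torsion_subgroup G =
     G \<lparr>carrier := {x \<in> carrier G. \<exists>n::nat. n > 0 \<and> x [^]\<^bsub>G\<^esub> n = \<one>\<^bsub>G\<^esub>}\<rparr>"

definition base_change :: "rat weierstrass \<Rightarrow> rat alg_closure weierstrass" where
  "base_change E = map_weierstrass to_ac E"


text \<open>
  Isomorphism over the (algebraically closed, hence infinite) field \<open>'a\<close>: an admissible change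
  of variables \<open>x = u\<^sup>2 x' + r\<close>, \<open>y = u\<^sup>3 y' + s u\<^sup>2 x' + t\<close> carries the equation of
  \<open>E\<close> to that of \<open>E'\<close>, up to the factor \<open>u\<^sup>6\<close> that restores leading coefficient 1.
\<close>

definition isomorphic_curves ::
    "'a::alg_closed_field weierstrass \<Rightarrow> 'a weierstrass \<Rightarrow> bool" where
  "isomorphic_curves E E' \<longleftrightarrow>
     (\<exists>u r s t. u \<noteq> 0 \<and>
       (\<forall>x y. weierstrass_eval E (u^2 * x + r) (u^3 * y + s * u^2 * x + t)
              = u^6 * weierstrass_eval E' x y))"


definition number_field_of_degree :: "nat \<Rightarrow> rat alg_closure set \<Rightarrow> bool" where
  "number_field_of_degree n K \<longleftrightarrow>
     subfield K ring_of_type_algebra \<and>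
     ring.dimension ring_of_type_algebra n (range to_ac) K"

end

theory Submission
  imports Defs
begin

text \<open>
  Each group \<open>H\<close> is realised in a family of curves \<open>y\<^sup>2 = f(x)\<close> with an integral parameter \<open>t\<close>, over a
  field \<open>K = \<rat>(\<alpha>, \<surd>D)\<close> with \<open>\<alpha>\<close> cubic: over the splitting field of \<open>f\<close> for the universal curve over
  \<open>X\<^sub>1(9)\<close>, and over \<open>\<rat>(\<surd>-3, \<delta>)\<close> with a pure cubic \<open>\<delta>\<close>, which contains the 3-torsion, in the other three
  cases.  To see that the torsion is not larger, \<open>t\<close> is confined to a residue class modulo a prime \<open>p\<close>
  for which \<open>K\<close> embeds into \<open>\<rat>\<^sub>p\<close> and the reduced curve has exactly \<open>|H|\<close> points.  On the kernel
  of reduction the parameter \<open>z = x / y\<close> is additive up to terms of third order, so this kernel is torsion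
  free and the torsion of \<open>E(K)\<close> injects into the reduced curve.  Congruences modulo two more primes ensure
  that \<open>K\<close> has degree 6.  The field \<open>\<rat>\<^sub>p\<close> is replaced by the \<open>p\<close>-adic limits of rationals inside the algebraic
  closure of \<open>\<rat>\<close>, for a valuation ring obtained from Zorn's lemma.
\<close>

subsection \<open>The group law\<close>

text \<open>For each H the bound \<open>card T <= |H|\<close> from point counting meets a pair of
  explicit independent points, and together they force T to be H; no theory of torsion growth
  enters. That K lies in \<open>Qp\<close> serves twice: the residue field is the prime field, so a
  count modulo \<open>p\<close> is a bound over K, and \<open>p\<close> remains a uniformizer, so
  that even \<open>p\<close>-torsion is excluded from the kernel of reduction. Staying inside the
  algebraic closure makes K a plain subset and avoids completions and embeddings; the price is that
  there is no valuation function, and all estimates are divisibilities in a ring V. Full 3-torsion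
  forces a square root of -3 by the Weil pairing, whence the quadratic subfield and the choice of 31
  and 37, which are 1 modulo 3. As -3 is no square modulo 5, whatever the parameter, only 7 and
  \<open>p\<close> enter the moduli 217 = 7 * 31 and 259 = 7 * 37. For Z/2 x Z/18 the quadratic
  subfield depends on the parameter, and 13 joins: 2639 = 7 * 13 * 29.\<close>

lemmas ring_expand = algebra_simps power2_eq_square power3_eq_cube

locale wcurve =
  fixes A B C :: "'a::field_char_0"
  assumes smooth: "x^3 + A*x^2 + B*x + C = 0 \<Longrightarrow> 3*x^2 + 2*A*x + B \<noteq> 0"
begin

abbreviation E :: "'a weierstrass" where "E \<equiv> Weierstrass 0 A 0 B C"
abbreviation add :: "'a point \<Rightarrow> 'a point \<Rightarrow> 'a point" where "add \<equiv> point_add E"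

fun neg :: "'a point \<Rightarrow> 'a point" where
  "neg Infinity = Infinity"
| "neg (Affine x y) = Affine x (- y)"

fun on_curve :: "'a point \<Rightarrow> bool" where
  "on_curve Infinity \<longleftrightarrow> True"
| "on_curve (Affine x y) \<longleftrightarrow> y^2 = x^3 + A*x^2 + B*x + C"

text \<open>The line \<open>y = l x + n\<close> meets the curve exactly in the points with
  abscissae \<open>x\<^sub>1, x\<^sub>2, x\<^sub>3\<close>, counted with multiplicity.\<close>

definition meets :: "'a \<Rightarrow> 'a \<Rightarrow> 'a \<Rightarrow> 'a \<Rightarrow> 'a \<Rightarrow> bool" where
  "meets l n x1 x2 x3 \<longleftrightarrow>
     x1 + x2 + x3 = l^2 - A \<and> x1*x2 + x1*x3 + x2*x3 = B - 2*l*n \<and> x1*x2*x3 = n^2 - C"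

lemma meetsD:
  assumes "meets l n x1 x2 x3"
  shows "A = l^2 - (x1 + x2 + x3)" "B = x1*x2 + x1*x3 + x2*x3 + 2*l*n" "C = n^2 - x1*x2*x3"
  using assms unfolding meets_def by auto

lemma meets_cubic:
  assumes "meets l n x1 x2 x3"
  shows "x^3 + A*x^2 + B*x + C - (l*x + n)^2 = (x - x1)*(x - x2)*(x - x3)"
  unfolding meetsD[OF assms] by (simp add: ring_expand)

lemma meets_perm: "meets l n x1 x2 x3 \<Longrightarrow> meets l n x2 x1 x3" "meets l n x1 x2 x3 \<Longrightarrow> meets l n x3 x1 x2"
   "meets l n x1 x2 x3 \<Longrightarrow> meets l n x1 x3 x2"
  unfolding meets_def by (auto simp: algebra_simps)

lemma meets_neg: "meets l n x1 x2 x3 \<Longrightarrow> meets (- l) (- n) x1 x2 x3"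
  unfolding meets_def by auto

lemma meets_on_curve: "meets l n x1 x2 x3 \<Longrightarrow> on_curve (Affine x1 (l*x1 + n))"
  by (drule meets_cubic[of _ _ _ _ _ x1]) simp

text \<open>The Vieta description absorbs both the chord and the tangent: for \<open>x1 = x2\<close>
  it says that \<open>x1\<close> is a double root. There \<open>y\<close> cannot vanish, as
  \<open>x1\<close> would be a common zero of the cubic and its derivative, so the tangent slope is
  \<open>l\<close>.\<close>

lemma add_meets:
  assumes "meets l n x1 x2 x3"
  shows "add (Affine x1 (l*x1 + n)) (Affine x2 (l*x2 + n)) = Affine x3 (- (l*x3 + n))"
proof (cases "x1 = x2")
  case False
  have l: "((l*x2 + n) - (l*x1 + n)) / (x2 - x1) = l"
    using False by (simp add: field_simps)
  have x3: "x3 = l^2 - A - x1 - x2"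
    using assms unfolding meets_def by (simp add: algebra_simps)
  show ?thesis
    using False by (simp add: Let_def l[simplified] x3 algebra_simps)
next
  case True
  define y where "y = l*x1 + n"
  have m: "meets l n x1 x1 x3" using assms True by simp
  have tang: "3*x1^2 + 2*A*x1 + B = 2*l*y"
    unfolding meetsD[OF m] y_def by (simp add: algebra_simps power2_eq_square)
  have "y^2 = x1^3 + A*x1^2 + B*x1 + C"
    using meets_cubic[OF m, of x1] y_def by simp
  then have "y \<noteq> 0"
    using tang smooth[of x1] by auto
  then have "y \<noteq> - y" by simp
  moreover have "(3*x1^2 + 2*A*x1 + B) / (2*y) = l"
    using tang \<open>y \<noteq> 0\<close> by simp
  moreover have "x3 = l^2 - A - x1 - x1" "l*x3 + n = l*(x3 - x1) + y"
    using m unfolding meets_def y_def by (simp_all add: algebra_simps)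
  ultimately show ?thesis
    unfolding True[symmetric] y_def[symmetric] by (simp add: Let_def)
qed

lemma meets_exists:
  assumes "on_curve (Affine x1 y1)" "on_curve (Affine x2 y2)" "\<not> (x1 = x2 \<and> y2 = - y1)"
  obtains l n x3 where "meets l n x1 x2 x3" "y1 = l*x1 + n" "y2 = l*x2 + n"
proof (cases "x1 = x2")
  case False
  define l where "l = (y2 - y1) / (x2 - x1)"
  define n where "n = y1 - l*x1"
  have "l * (x2 - x1) = y2 - y1" using False unfolding l_def by simp
  then have y2: "y2 = l*x2 + n" unfolding n_def by (simp add: algebra_simps)
  have y1: "y1 = l*x1 + n" unfolding n_def by simp
  define x3 where "x3 = l^2 - A - x1 - x2"
  \<comment> \<open>\<open>u x + v\<close> is what remains of the cubic minus
    \<open>(l x + n)^2\<close> minus \<open>(x - x1)(x - x2)(x - x3)\<close>; it vanishes at both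
    \<open>x1\<close> and \<open>x2\<close>.\<close>
  define u where "u = B - 2*l*n - (x1*x2 + x1*x3 + x2*x3)"
  define v where "v = C - n^2 + x1*x2*x3"
  have "u*x1 + v = x1^3 + A*x1^2 + B*x1 + C - (l*x1 + n)^2"
    unfolding u_def v_def x3_def by (simp add: ring_expand)
  then have e1: "u*x1 + v = 0" using assms(1) y1 by simp
  have "u*x2 + v = x2^3 + A*x2^2 + B*x2 + C - (l*x2 + n)^2"
    unfolding u_def v_def x3_def by (simp add: ring_expand)
  then have e2: "u*x2 + v = 0" using assms(2) y2 by simp
  have "u * (x1 - x2) = 0" using e1 e2 by Groebner_Basis.algebra
  then have "u = 0" using False by simp
  moreover then have "v = 0" using e1 by simp
  ultimately have "meets l n x1 x2 x3"
    unfolding meets_def u_def v_def x3_def by (auto simp: algebra_simps)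
  then show ?thesis using y1 y2 that by blast
next
  case True
  have "(y2 - y1) * (y2 + y1) = 0"
    using assms True by (auto simp: algebra_simps power2_eq_square)
  then have y2: "y2 = y1" "y1 \<noteq> 0" using assms(3) True
    by (auto simp: add_eq_0_iff)
  define l where "l = (3*x1^2 + 2*A*x1 + B) / (2*y1)"
  define n where "n = y1 - l*x1"
  have y1: "y1 = l*x1 + n" unfolding n_def by simp
  have l: "2*l*y1 = 3*x1^2 + 2*A*x1 + B" unfolding l_def using y2 by simp
  define x3 where "x3 = l^2 - A - x1 - x1"
  have n: "n = y1 - l*x1" and c: "y1^2 = x1^3 + A*x1^2 + B*x1 + C"
    using assms(1) unfolding n_def by simp_all
  have "B - 2*l*n = (x1*x1 + x1*x3 + x1*x3)" "n^2 - C = x1*x1*x3"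
    unfolding x3_def n using l c by Groebner_Basis.algebra+
  then have "meets l n x1 x2 x3"
    using True unfolding meets_def x3_def by (auto simp: algebra_simps)
  then show ?thesis using y1 y2 True that by blast
qed

lemma add_commute: "on_curve P \<Longrightarrow> on_curve Q \<Longrightarrow> add P Q = add Q P"
proof (cases P; cases Q)
  fix x1 y1 x2 y2 assume on: "on_curve P" "on_curve Q" and [simp]: "P = Affine x1 y1" "Q = Affine x2 y2"
  show ?thesis
  proof (cases "x1 = x2 \<and> y2 = - y1")
    case False
    from meets_exists[OF on[simplified \<open>P = _\<close> \<open>Q = _\<close>] False]
    obtain l n x3 where m: "meets l n x1 x2 x3" "y1 = l*x1 + n" "y2 = l*x2 + n" .
    show ?thesis using add_meets[OF m(1)] add_meets[OF meets_perm(1)[OF m(1)]] m(2,3) by simp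
  qed simp
qed auto

lemma add_neg [simp]: "add P (neg P) = Infinity"
  by (cases P) auto

lemma neg_neg [simp]: "neg (neg P) = P" by (cases P) auto
lemma add_neg' [simp]: "add (neg P) P = Infinity"
  using add_neg[of "neg P"] by simp
lemma on_neg [simp]: "on_curve (neg P) = on_curve P" by (cases P) auto
lemma add_inf [simp]: "add P Infinity = P" by (cases P) auto

lemma neg_add [simp]: "neg (add P Q) = add (neg P) (neg Q)"
proof (cases P; cases Q)
  fix x1 y1 x2 y2 assume [simp]: "P = Affine x1 y1" "Q = Affine x2 y2"
  have [simp]: "(y1 - y2)/(x2 - x1) = - ((y2 - y1)/(x2 - x1))"
    by (simp add: minus_divide_left)
  show ?thesis
    by (auto simp: Let_def power_divide algebra_simps) 
qed auto

lemma add_cases: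
  assumes "on_curve P" "on_curve Q"
  obtains "P = Infinity" | "Q = Infinity" | "Q = neg P"
    | l n x1 x2 x3 where "meets l n x1 x2 x3" "P = Affine x1 (l*x1 + n)" "Q = Affine x2 (l*x2 + n)"
      "add P Q = Affine x3 (- (l*x3 + n))"
proof (cases P)
  case P: (Affine x1 y1)
  show ?thesis
  proof (cases Q)
    case Q: (Affine x2 y2)
    show ?thesis
    proof (cases "x1 = x2 \<and> y2 = - y1")
      case True
      then show ?thesis using that P Q by auto
    next
      case False
      from meets_exists[OF assms[simplified P Q] False]
      obtain l n x3 where m: "meets l n x1 x2 x3" "y1 = l*x1 + n" "y2 = l*x2 + n" .
      show ?thesis using add_meets[OF m(1)] m P Q that(4) by auto
    qed
  qed (use that in auto)
qed (use that in auto)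

lemma on_add:
  assumes "on_curve P" "on_curve Q" shows "on_curve (add P Q)"
  using assms
proof (cases rule: add_cases)
  case (4 l n x1 x2 x3)
  have "on_curve (neg (Affine x3 (l*x3+n)))"
    using meets_on_curve[OF meets_perm(2)[OF 4(1)]] by (simp only: on_neg)
  then show ?thesis using 4 by simp
qed (use assms in auto)

lemma neg_add_cancel:
  assumes "on_curve P" "on_curve R" shows "add P (add (neg P) R) = R"
proof -
  have "on_curve (neg P)" using assms by simp
  from this assms(2) show ?thesis
  proof (cases rule: add_cases)
    case (4 l n x1 x2 x3)
    have P: "P = Affine x1 (-l*x1 - n)"
      using 4(2) neg_neg[of P] by (metis minus_add_distrib minus_mult_left neg.simps(2) uminus_add_conv_diff diff_conv_add_uminus)
    have "meets (-l) (-n) x1 x3 x2" using meets_neg meets_perm 4(1) by blast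
    from add_meets[OF this] show ?thesis using P 4 by simp
  next
    case 1
    then have "P = Infinity" by (cases P) auto
    then show ?thesis by simp
  qed (use assms in auto)
qed

lemma meets_diff:
  assumes "meets l n q p a" "meets m k q r b"
  shows "m^2 - l^2 = r + b - p - a"
  using assms unfolding meets_def by Groebner_Basis.algebra

text \<open>Here \<open>(a, -(l a + n))\<close> is P + Q and \<open>(r, m r + k)\<close> is R. The
  conclusion says that \<open>s + l = (r - p) / (m - l)\<close>, and exchanging P with R and
  \<open>l\<close> with \<open>m\<close> leaves this quotient unchanged: that symmetry yields
  associativity.\<close>

lemma slope_transform:
  assumes 1: "meets l n q p a" and 2: "meets m k q r b" and q: "l*q + n = m*q + k"
    and lm: "l \<noteq> m" and ne: "\<not> (a = r \<and> m*r + k = l*a + n)"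
    and 3: "meets s d a r w" "s*a + d = - (l*a + n)" "s*r + d = m*r + k"
  shows "s * (m - l) = (r - p) - l*(m - l)"
proof (cases "a = r")
  case False
  have m: "q + p + a = l^2 - A" "q*p + q*a + p*a = B - 2*l*n"
      "q + r + b = m^2 - A" "q*r + q*b + r*b = B - 2*m*k"
    using 1 2 unfolding meets_def by auto
  define y where "y = l*q + n"
  have n: "n = y - l*q" "k = y - m*q" using q y_def by (auto simp: algebra_simps)
  have b: "b = m^2 - l^2 + p + a - r" using meets_diff[OF 1 2] by Groebner_Basis.algebra
  \<comment> \<open>Both lines pass through Q, so the derivative of the cubic at \<open>q\<close>
    equals \<open>2 l y + (q - p)(q - a)\<close> and also
    \<open>2 m y + (q - r)(q - b)\<close>.\<close>
  have "(m - l)*(2*y) = (p - q)*(a - q) - (r - q)*(b - q)"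
    using m n by Groebner_Basis.algebra
  moreover have "s * (r - a) = m*r + k + l*a + n" using 3(2,3) by Groebner_Basis.algebra
  ultimately have "(r - a) * (s * (m - l)) = (r - a) * ((r - p) - l*(m - l))"
    using n b by Groebner_Basis.algebra
  then show ?thesis using False by simp
next
  case True
  define y where "y = m*r + k"
  have y: "y \<noteq> 0" using ne True 3 y_def by auto
  \<comment> \<open>For \<open>a = r\<close> the final chord is the tangent at R, and
    \<open>y = - (l r + n)\<close>. The lines with slopes \<open>m\<close> and \<open>l\<close> meet
    at \<open>q\<close>, which gives the difference of their ordinates at \<open>r\<close>.\<close>
  have yy: "2*y = (m - l)*(r - q)" 
    using q 3(2,3) True y_def by Groebner_Basis.algebra
  then have rq: "r - q \<noteq> 0" using y by auto
  have A: "A = m^2 - q - r - b" "B = q*r + q*b + r*b + 2*m*k"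
    using 2 unfolding meets_def by Groebner_Basis.algebra+
  have d: "d = y - s*r" "k = y - m*r" using 3(3) y_def by (auto simp: algebra_simps)
  have w: "w = s^2 - A - 2*r" "r*r + r*w + r*w = B - 2*s*d"
    using 3(1) True unfolding meets_def by (auto simp: algebra_simps)
  have "2*s*y = 3*r^2 + 2*A*r + B" using w d by Groebner_Basis.algebra
  also have "\<dots> = 2*m*y + (r - q)*(r - b)" unfolding A d by Groebner_Basis.algebra
  finally have "(r - q) * (s * (m - l)) = (r - q) * (m*(m - l) + (r - b))"
    using yy by Groebner_Basis.algebra
  then have "s * (m - l) = m*(m - l) + (r - b)" using rq by simp
  then show ?thesis using meets_diff[OF 1 2] True by Groebner_Basis.algebra
qed

lemma add_eq_neg_swap:
  assumes "meets l n q p a" 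
  shows "add (add (Affine p (l*p+n)) (Affine q (l*q+n))) (Affine a (l*a+n)) = Infinity"
    "add (Affine q (l*q+n)) (Affine a (l*a+n)) = neg (Affine p (l*p+n))"
proof -
  have "meets l n p q a" "meets l n q a p" using meets_perm assms by blast+
  from this[THEN add_meets]
  show "add (add (Affine p (l*p+n)) (Affine q (l*q+n))) (Affine a (l*a+n)) = Infinity"
    "add (Affine q (l*q+n)) (Affine a (l*a+n)) = neg (Affine p (l*p+n))" by auto
qed

text \<open>The generic case of associativity, where \<open>P + Q\<close> and \<open>Q + R\<close> are the negatives of the
  third intersection points \<open>a\<close>, \<open>b\<close> of the lines through \<open>Q\<close> with slopes \<open>l\<close>, \<open>m\<close>: by
  \<open>slope_transform\<close> both final chords have slopes determined by \<open>(r - p) / (m - l)\<close>.\<close>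

lemma add_assoc_generic:
  assumes 1: "meets l n q p a" and 2: "meets m k q r b" and qq: "l*q + n = m*q + k"
    and lm: "l \<noteq> m" and ne: "\<not> (a = r \<and> m*r + k = l*a + n)" "\<not> (b = p \<and> l*p + n = m*b + k)"
  shows "add (Affine a (- (l*a + n))) (Affine r (m*r + k)) = add (Affine p (l*p + n)) (Affine b (- (m*b + k)))"
proof -
  have on: "on_curve (Affine a (- (l*a + n)))" "on_curve (Affine r (m*r + k))"
     "on_curve (Affine p (l*p + n))" "on_curve (Affine b (- (m*b + k)))"
    using meets_on_curve[OF meets_perm(2)[OF 1]] meets_on_curve[OF meets_perm(1)[OF 2]]
      meets_on_curve[OF meets_perm(1)[OF 1]] meets_on_curve[OF meets_perm(2)[OF 2]]
    by (simp_all add: power2_minus del: minus_add_distrib)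
  obtain s d w where s: "meets s d a r w" "- (l*a + n) = s*a + d" "m*r + k = s*r + d"
    by (rule meets_exists[OF on(1,2)]) (use ne in auto)
  obtain s' d' w' where s': "meets s' d' b p w'" "- (m*b + k) = s'*b + d'" "l*p + n = s'*p + d'"
    by (rule meets_exists[OF on(4,3)]) (use ne in auto)
  have e1: "s * (m - l) = (r - p) - l*(m - l)"
    using slope_transform[OF 1 2 qq lm ne(1) s(1)] s by simp
  have e2: "s' * (l - m) = (p - r) - m*(l - m)"
    using slope_transform[OF 2 1 qq[symmetric] _ ne(2) s'(1)] s' lm by simp
  have w: "w = s^2 - A - a - r" "w' = s'^2 - A - b - p"
    using s(1) s'(1) unfolding meets_def by (auto simp: algebra_simps)
  have mm: "m^2 - l^2 = r + b - p - a" by (rule meets_diff[OF 1 2])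
  have A: "A = l^2 - q - p - a" using 1 unfolding meets_def by (simp add: algebra_simps)
  have "(m - l) * (s - s' - (m - l)) = 0" using e1 e2 by Groebner_Basis.algebra
  then have ss: "s - s' = m - l" using lm by simp
  have "(s - s')*(s + s') = 2*(r - p) - (l + m)*(m - l)" unfolding ss using e1 e2 by Groebner_Basis.algebra
  then have "w = w'" using mm unfolding w by Groebner_Basis.algebra
  moreover have "s*w + d = s'*w' + d'"
  proof -
    define v where "v = s + l"
    have v: "v * (m - l) = r - p" "s = v - l" "s' = v - m"
      subgoal using e1 unfolding v_def by (simp add: algebra_simps)
      subgoal unfolding v_def by simp
      subgoal using ss unfolding v_def by (simp add: algebra_simps)
      done
    have d: "d = m*r + k - s*r" "d' = l*p + n - s'*p" using s s' by simp_all
    have w0: "w = v^2 - 2*v*l + p - r + q" unfolding w A v by (simp add: power2_eq_square algebra_simps)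
    have n: "n = (m - l)*q + k" "r = p + v*(m - l)" using qq v by Groebner_Basis.algebra+
    show ?thesis
      unfolding \<open>w = w'\<close>[symmetric] d v(2,3) n(1) w0 unfolding n(2)
      by (simp add: ring_expand)
  qed
  moreover have "add (Affine p (l*p + n)) (Affine b (- (m*b + k))) = add (Affine b (- (m*b + k))) (Affine p (l*p + n))"
    using on by (rule_tac add_commute) auto
  ultimately show ?thesis
    by (simp only: s(2,3) s'(2,3) add_meets[OF s(1)] add_meets[OF s'(1)])
qed

theorem add_assoc:
  assumes P: "on_curve P" and Q: "on_curve Q" and R: "on_curve R"
  shows "add (add P Q) R = add P (add Q R)"
  \<comment> \<open>Both sums are split with Q first, so that the two lines are written through the
    common point \<open>q\<close>.\<close>
  using Q P
proof (cases rule: add_cases)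
  case 3
  then show ?thesis using neg_add_cancel[of "neg Q" R] neg_add_cancel[of P R] assms by (cases Q) auto
next
  case PQ: (4 l n q p a)
  from Q R show ?thesis
  proof (cases rule: add_cases)
    case 3
    have "add (neg Q) (add Q P) = P" using neg_add_cancel[of "neg Q" P] P Q by simp
    then show ?thesis using 3 PQ(4) add_commute[OF P Q] add_commute[of "neg Q" "add Q P"]
        on_add[OF Q P] Q by simp
  next
    case QR: (4 m k q' r b)
    have q[simp]: "q' = q" and qq: "l*q + n = m*q + k" using PQ QR by auto
    show ?thesis
    proof (cases "R = Affine a (l*a + n)")
      case True
      then show ?thesis using add_eq_neg_swap[OF PQ(1)] PQ by simp
    next
      case F1: False
      show ?thesis
      proof (cases "P = Affine b (m*b + k)")
        case True
        have "add Q P = neg R" using add_eq_neg_swap(2)[of m k q' r b] QR True by simp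
        then show ?thesis using True QR add_commute[OF P Q] add_commute[of "neg R" R] R by simp
      next
        case F2: False
        show ?thesis
        proof (cases "l = m")
          case True
          then have "n = k" using qq by simp
          \<comment> \<open>The two lines coincide, so \<open>r\<close> is \<open>p\<close> or
            \<open>a\<close>. The second would mean P + Q = -R, excluded by F1; R = P leaves only
            commutativity.\<close>
          have "(r - p) * (r - a) = 0" 
            using PQ(1) QR(1) True \<open>n = k\<close> unfolding meets_def q by Groebner_Basis.algebra
          then have "r = p" using F1 QR(3) True \<open>n = k\<close> by auto
          then have "R = P" using QR PQ True \<open>n = k\<close> by simp
          then show ?thesis using add_commute[OF P Q] add_commute[OF P on_add[OF P Q]] by simp
        next
          case False
          have "add (add P Q) R = add (Affine a (- (l*a + n))) (Affine r (m*r + k))"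
            using PQ QR add_commute[OF P Q] by simp
          also have "\<dots> = add (Affine p (l*p + n)) (Affine b (- (m*b + k)))"
            using F1 F2 PQ QR by (intro add_assoc_generic[OF PQ(1) QR(1)[unfolded q] qq False]) auto
          also have "\<dots> = add P (add Q R)" using PQ QR by simp
          finally show ?thesis .
        qed
      qed
    qed
  qed (auto simp: PQ)
qed auto

end

subsection \<open>Torsion subgroups\<close>

text \<open>Independence makes the homomorphism from the product injective; an upper bound on the
  order then suffices for surjectivity, and such a bound is all that reduction modulo a prime
  provides.\<close>

lemma (in comm_group) iso_integer_mod_group_prod:
  assumes ab: "a \<in> carrier G" "b \<in> carrier G" and mn: "m > 0" "n > 0"
    and pow: "a [^] m = \<one>" "b [^] n = \<one>"
    and indep: "\<And>i j::nat. i < m \<Longrightarrow> j < n \<Longrightarrow> a [^] i \<otimes> b [^] j = \<one> \<Longrightarrow> i = 0 \<and> j = 0"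
    and fin: "finite (carrier G)" and card: "card (carrier G) \<le> m * n"
  shows "G \<cong> integer_mod_group m \<times>\<times> integer_mod_group n"
proof -
  let ?H = "integer_mod_group m \<times>\<times> integer_mod_group n"
  have cH: "carrier ?H = {0..<int m} \<times> {0..<int n}"
    using mn by (auto simp: carrier_integer_mod_group)
  have am: "a [^] (x mod int m) = a [^] x" for x :: int
  proof -
    have "a [^] x = a [^] (int m * (x div int m) + x mod int m)" by simp
    also have "\<dots> = (a [^] int m) [^] (x div int m) \<otimes> a [^] (x mod int m)"
      using ab by (simp only: int_pow_mult int_pow_pow)
    finally show ?thesis using pow ab by (simp add: int_pow_int)
  qed
  have bm: "b [^] (x mod int n) = b [^] x" for x :: int
  proof -
    have "b [^] x = b [^] (int n * (x div int n) + x mod int n)" by simp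
    also have "\<dots> = (b [^] int n) [^] (x div int n) \<otimes> b [^] (x mod int n)"
      using ab by (simp only: int_pow_mult int_pow_pow)
    finally show ?thesis using pow ab by (simp add: int_pow_int)
  qed
  define h where "h = (\<lambda>(i::int, j::int). a [^] i \<otimes> b [^] j)"
  have hom: "h \<in> hom ?H G"
    using ab by (auto simp: hom_def h_def am bm int_pow_mult m_ac)
  have inj: "inj_on h (carrier ?H)"
  proof (rule inj_onI)
    fix x y assume xy: "x \<in> carrier ?H" "y \<in> carrier ?H" "h x = h y"
    obtain i j i' j' where ij: "x = (i, j)" "y = (i', j')" by (cases x, cases y)
    have r: "0 \<le> i" "i < int m" "0 \<le> j" "j < int n" "0 \<le> i'" "i' < int m" "0 \<le> j'" "j' < int n"
      and eq: "a [^] i \<otimes> b [^] j = a [^] i' \<otimes> b [^] j'"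
      using xy unfolding cH ij h_def by auto
    have "a [^] (i - i') \<otimes> b [^] (j - j') = (a [^] i \<otimes> b [^] j) \<otimes> inv (a [^] i' \<otimes> b [^] j')"
      using ab by (simp add: int_pow_diff inv_mult m_ac)
    also have "\<dots> = \<one>" using eq ab by simp
    finally have "a [^] ((i - i') mod int m) \<otimes> b [^] ((j - j') mod int n) = \<one>"
      using am bm by simp
    then have "a [^] nat ((i - i') mod int m) \<otimes> b [^] nat ((j - j') mod int n) = \<one>"
      using mn by (simp flip: int_pow_int)
    then have "nat ((i - i') mod int m) = 0 \<and> nat ((j - j') mod int n) = 0"
      using mn by (intro indep) (auto simp: nat_less_iff)
    then have "(i - i') mod int m = 0" "(j - j') mod int n = 0"
      using mn pos_mod_sign[of "int m" "i - i'"] pos_mod_sign[of "int n" "j - j'"] by linarith+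
    then have "i mod int m = i' mod int m" "j mod int n = j' mod int n"
      by (simp_all add: mod_eq_dvd_iff dvd_eq_mod_eq_0)
    then show "x = y" using r ij by simp
  qed
  have "h ` carrier ?H = carrier G"
  proof (rule card_seteq[OF fin])
    show "h ` carrier ?H \<subseteq> carrier G" using hom unfolding hom_def by blast
    show "card (carrier G) \<le> card (h ` carrier ?H)"
      using card card_image[OF inj] unfolding cH by (simp add: card_cartesian_product)
  qed
  then have "h \<in> iso ?H G" using hom inj by (auto simp: iso_def bij_betw_def)
  then have "?H \<cong> G" by (auto simp: is_iso_def)
  moreover have "group ?H" by (simp add: DirProd_group)
  ultimately show ?thesis by (rule group.iso_sym[rotated])
qed

lemma (in comm_group) comm_group_torsion_subgroup: "comm_group (torsion_subgroup G)"
proof -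
  let ?T = "{x \<in> carrier G. \<exists>n::nat. n > 0 \<and> x [^] n = \<one>}"
  have "subgroup ?T G"
  proof
    show "\<one> \<in> ?T" by (auto intro!: exI[of _ 1])
    fix x assume "x \<in> ?T"
    then obtain n :: nat where n: "x \<in> carrier G" "n > 0" "x [^] n = \<one>" by auto
    show "inv x \<in> ?T" using n by (auto simp: nat_pow_inv intro!: exI[of _ n])
    fix y assume "y \<in> ?T"
    then obtain k :: nat where k: "y \<in> carrier G" "k > 0" "y [^] k = \<one>" by auto
    have "(x \<otimes> y) [^] (n * k) = (x [^] n) [^] k \<otimes> (y [^] k) [^] n"
      using n(1) k(1) by (simp only: nat_pow_distrib nat_pow_pow mult.commute[of k n])
    also have "\<dots> = \<one>" using n k by simp
    finally show "x \<otimes> y \<in> ?T" using n k by (auto intro!: exI[of _ "n * k"])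
  qed auto
  then have "group (G\<lparr>carrier := ?T\<rparr>)" by (rule subgroup_imp_group)
  then show ?thesis
    unfolding torsion_subgroup_def by (rule group.group_comm_groupI) (auto simp: m_comm)
qed

lemma carrier_torsion_subgroup:
  "carrier (torsion_subgroup G) = {x \<in> carrier G. \<exists>n::nat. n > 0 \<and> x [^]\<^bsub>G\<^esub> n = \<one>\<^bsub>G\<^esub>}"
  and mult_torsion_subgroup: "monoid.mult (torsion_subgroup G) = monoid.mult G"
  by (simp_all add: torsion_subgroup_def)

lemma pow_torsion_subgroup: "x [^]\<^bsub>torsion_subgroup G\<^esub> (n::nat) = x [^]\<^bsub>G\<^esub> n"
  by (induction n) (simp_all add: nat_pow_def torsion_subgroup_def)

text \<open>Closure under the operations of the ambient field type, so that its arithmetic applies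
  directly; the notion is turned into \<open>subfield\<close> only where degrees are
  computed.\<close>

definition field_closed :: "'a::field set \<Rightarrow> bool" where
  "field_closed K \<longleftrightarrow> 1 \<in> K \<and> (\<forall>x\<in>K. \<forall>y\<in>K. x - y \<in> K \<and> x * y \<in> K) \<and> (\<forall>x\<in>K. inverse x \<in> K)"

lemma field_closedD:
  assumes "field_closed K"
  shows "1 \<in> K" "0 \<in> K" "x \<in> K \<Longrightarrow> y \<in> K \<Longrightarrow> x - y \<in> K" "x \<in> K \<Longrightarrow> - x \<in> K"
    "x \<in> K \<Longrightarrow> y \<in> K \<Longrightarrow> x + y \<in> K" "x \<in> K \<Longrightarrow> y \<in> K \<Longrightarrow> x * y \<in> K"
    "x \<in> K \<Longrightarrow> inverse x \<in> K" "x \<in> K \<Longrightarrow> y \<in> K \<Longrightarrow> x / y \<in> K" "x \<in> K \<Longrightarrow> x ^ k \<in> K"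
    "of_nat k \<in> K" "of_int i \<in> K" "numeral w \<in> K"
proof -
  note d = assms[unfolded field_closed_def]
  show 1: "1 \<in> K" using d by auto
  then have "1 - 1 \<in> K" using d by blast
  then show 0: "0 \<in> K" by simp
  show diff: "x - y \<in> K" if "x \<in> K" "y \<in> K" for x y using d that by auto
  show neg: "- x \<in> K" if "x \<in> K" for x using diff[OF 0 that] by simp
  show add: "x + y \<in> K" if "x \<in> K" "y \<in> K" for x y using diff[OF that(1) neg[OF that(2)]] by simp
  show mult: "x * y \<in> K" if "x \<in> K" "y \<in> K" for x y using d that by auto
  show inv: "inverse x \<in> K" if "x \<in> K" for x using d that by auto
  show "x / y \<in> K" if "x \<in> K" "y \<in> K" using mult[OF that(1) inv[OF that(2)]] by (simp add: divide_inverse)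
  show "x ^ k \<in> K" if "x \<in> K" by (induction k) (auto simp: 1 mult that)
  show nat: "of_nat k \<in> K" for k by (induction k) (auto simp: 0 1 add)
  show "of_int i \<in> K" by (cases i) (auto simp: nat neg simp del: of_nat_Suc)
  show "numeral w \<in> K" using nat[of "numeral w"] by simp
qed

context wcurve
begin

lemma points_over_iff:
  "P \<in> points_over E K \<longleftrightarrow> on_curve P \<and> (\<forall>x y. P = Affine x y \<longrightarrow> x \<in> K \<and> y \<in> K)"
  by (cases P) (auto simp: points_over_def weierstrass_eval_def)

lemma add_in_points_over:
  assumes K: "field_closed K" "A \<in> K" "B \<in> K" and "P \<in> points_over E K" "Q \<in> points_over E K"
  shows "add P Q \<in> points_over E K"
  using assms(4,5) on_add[of P Q] unfolding points_over_iff
  by (cases P; cases Q) (auto simp: Let_def intro!: field_closedD[OF K(1)] K(2,3))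

lemma neg_in_points_over:
  "field_closed K \<Longrightarrow> P \<in> points_over E K \<Longrightarrow> neg P \<in> points_over E K"
  unfolding points_over_iff by (cases P) (auto intro!: field_closedD)

lemma comm_group_point_group:
  assumes K: "field_closed K" "A \<in> K" "B \<in> K"
  shows "comm_group (point_group E K)"
proof (rule comm_groupI)
  fix P Q R assume PQ: "P \<in> carrier (point_group E K)" "Q \<in> carrier (point_group E K)"
  then show "P \<otimes>\<^bsub>point_group E K\<^esub> Q \<in> carrier (point_group E K)"
    using add_in_points_over K by (simp add: point_group_def)
  show "P \<otimes>\<^bsub>point_group E K\<^esub> Q = Q \<otimes>\<^bsub>point_group E K\<^esub> P"
    using PQ add_commute by (simp add: point_group_def points_over_iff)
  assume "R \<in> carrier (point_group E K)"
  then show "P \<otimes>\<^bsub>point_group E K\<^esub> Q \<otimes>\<^bsub>point_group E K\<^esub> R = P \<otimes>\<^bsub>point_group E K\<^esub> (Q \<otimes>\<^bsub>point_group E K\<^esub> R)"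
    using PQ add_assoc by (simp add: point_group_def points_over_iff)
next
  fix P assume P: "P \<in> carrier (point_group E K)"
  then have "neg P \<in> carrier (point_group E K)"
    using K neg_in_points_over by (simp add: point_group_def)
  then show "\<exists>Q\<in>carrier (point_group E K). Q \<otimes>\<^bsub>point_group E K\<^esub> P = \<one>\<^bsub>point_group E K\<^esub>"
    by (auto simp: point_group_def intro!: bexI[of _ "neg P"])
qed (auto simp: point_group_def points_over_def)

lemma inv_point_group:
  assumes K: "field_closed K" "A \<in> K" "B \<in> K" and P: "P \<in> points_over E K"
  shows "inv\<^bsub>point_group E K\<^esub> P = neg P"
proof -
  interpret comm_group "point_group E K" by (rule comm_group_point_group[OF K])
  show ?thesis
    by (rule inv_equality) (use P neg_in_points_over[OF K(1) P] in \<open>auto simp: point_group_def\<close>)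
qed

end

subsection \<open>Valuation rings and p-adic limits\<close>

locale subring_set =
  fixes V :: "'a::field_char_0 set"
  assumes one_V [simp]: "1 \<in> V"
    and diff_V: "x \<in> V \<Longrightarrow> y \<in> V \<Longrightarrow> x - y \<in> V"
    and mult_V: "x \<in> V \<Longrightarrow> y \<in> V \<Longrightarrow> x * y \<in> V"
begin

lemma zero_V [simp]: "0 \<in> V" using diff_V[of 1 1] by simp
lemma uminus_V: "x \<in> V \<Longrightarrow> - x \<in> V" using diff_V[of 0 x] by simp
lemma add_V: "x \<in> V \<Longrightarrow> y \<in> V \<Longrightarrow> x + y \<in> V" using diff_V[of x "- y"] uminus_V by simp
lemma power_V: "x \<in> V \<Longrightarrow> x ^ n \<in> V" by (induction n) (auto intro: mult_V)
lemma of_nat_V [simp]: "of_nat n \<in> V" by (induction n) (auto intro: add_V)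
lemma of_int_V [simp]: "of_int n \<in> V" by (cases n) (auto intro: uminus_V simp del: of_nat_Suc)
lemma numeral_V [simp]: "numeral n \<in> V" using of_nat_V[of "numeral n"] by simp
lemma sum_V: "(\<And>i. i \<in> A \<Longrightarrow> f i \<in> V) \<Longrightarrow> sum f A \<in> V"
  by (induction A rule: infinite_finite_induct) (auto intro: add_V)
lemma poly_V: "(\<And>i. coeff f i \<in> V) \<Longrightarrow> x \<in> V \<Longrightarrow> poly f x \<in> V"
  unfolding poly_altdef by (auto intro!: sum_V mult_V power_V)
lemmas V_intros = diff_V mult_V uminus_V add_V power_V

end

text \<open>A valuation ring of the whole field in which \<open>p\<close> is not a unit. By
  \<open>arch\<close> the powers of \<open>p\<close> are cofinal among the values, so that
  approximation modulo powers of \<open>p\<close> controls every nonzero element.\<close>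

locale p_valuation = subring_set +
  fixes p :: nat
  assumes total_V: "x \<notin> V \<Longrightarrow> inverse x \<in> V"
    and prime_p: "prime p"
    and inverse_p: "inverse (of_nat p) \<notin> V"
    and arch: "x \<noteq> 0 \<Longrightarrow> \<exists>n. of_nat p ^ n / x \<in> V"
begin

text \<open>The maximal ideal, i.e. the non-units. The clause \<open>x = 0\<close> is there because
  \<open>inverse 0 = 0\<close> lies in V.\<close>

definition M :: "'a set" where "M = {x \<in> V. x = 0 \<or> inverse x \<notin> V}"

lemma M_V: "x \<in> M \<Longrightarrow> x \<in> V" by (simp add: M_def)
lemma zero_M [simp]: "0 \<in> M" by (simp add: M_def)

lemma unit: "x \<in> V \<Longrightarrow> x \<notin> M \<Longrightarrow> inverse x \<in> V" by (auto simp: M_def)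

lemma inverse_notin_V: "x \<in> M \<Longrightarrow> x \<noteq> 0 \<Longrightarrow> inverse x \<notin> V" by (auto simp: M_def)

lemma notin_V_inverse: "x \<notin> V \<Longrightarrow> inverse x \<in> M"
  using total_V by (auto simp: M_def)

lemma mult_M: assumes "x \<in> M" "y \<in> V" shows "x * y \<in> M" 
proof (rule ccontr)
  assume n: "x * y \<notin> M"
  moreover have "x * y \<in> V" using assms M_V mult_V by blast
  ultimately have "x * y \<noteq> 0" "inverse (x * y) \<in> V" by (auto simp: M_def)
  then have "y * inverse (x * y) \<in> V" using assms(2) mult_V by blast
  moreover have "y * inverse (x * y) = inverse x" using \<open>x * y \<noteq> 0\<close> by (simp add: field_simps)
  ultimately have "inverse x \<in> V" by metis
  then show False using assms(1) \<open>x * y \<noteq> 0\<close> by (auto simp: M_def)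
qed

lemma mult_M': "x \<in> V \<Longrightarrow> y \<in> M \<Longrightarrow> x * y \<in> M"
  using mult_M[of y x] by (simp add: mult.commute)

lemma one_M [simp]: "1 \<notin> M" by (simp add: M_def)

lemma uminus_M: "x \<in> M \<Longrightarrow> - x \<in> M" using mult_M[of x "-1"] uminus_V[of 1] by simp

lemma add_M: assumes "x \<in> M" "y \<in> M" shows "x + y \<in> M"
proof -
  have *: "x + y \<in> M" if "x \<in> M" "y \<in> M" "x / y \<in> V" "y \<noteq> 0" for x y
  proof -
    have "y * (x / y + 1) \<in> M" using that by (intro mult_M add_V) auto
    then show ?thesis using that by (simp add: distrib_left)
  qed
  show ?thesis
  proof (cases "x = 0 \<or> y = 0")
    case False
    then show ?thesis using *[of x y] *[of y x] total_V[of "x / y"] assms by (auto simp: add.commute)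
  qed (use assms in auto)
qed

lemma diff_M: "x \<in> M \<Longrightarrow> y \<in> M \<Longrightarrow> x - y \<in> M" using add_M[of x "- y"] uminus_M by simp
lemma diff_M_commute: "x - y \<in> M \<longleftrightarrow> y - x \<in> M" using uminus_M[of "x - y"] uminus_M[of "y - x"] by auto
lemma power_M: "x \<in> M \<Longrightarrow> n > 0 \<Longrightarrow> x ^ n \<in> M" by (cases n) (auto intro: mult_M power_V M_V)
lemmas M_intros = mult_M mult_M' uminus_M add_M diff_M power_M

lemma prime_M: "x \<in> V \<Longrightarrow> y \<in> V \<Longrightarrow> x * y \<in> M \<Longrightarrow> x \<in> M \<or> y \<in> M"
proof (rule ccontr)
  assume a: "x \<in> V" "y \<in> V" "x * y \<in> M" "\<not> (x \<in> M \<or> y \<in> M)"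
  then have "inverse x * inverse y \<in> V" "x * y \<noteq> 0" using unit mult_V by (auto simp: M_def)
  then show False using inverse_notin_V[OF a(3)] by simp
qed

lemma one_plus_M: "x \<in> M \<Longrightarrow> 1 + x \<notin> M"
  using diff_M[of "1 + x" x] by auto

text \<open>A valuation ring is integrally closed; this instance makes \<open>y\<close> integral as
  soon as \<open>x\<close> is, on a curve with integral coefficients.\<close>

lemma power2_V_iff: "x ^ 2 \<in> V \<longleftrightarrow> x \<in> V"
proof
  assume x2: "x^2 \<in> V"
  show "x \<in> V"
  proof (rule ccontr)
    assume "x \<notin> V"
    then have "x^2 * inverse x \<in> M" using notin_V_inverse x2 mult_M' by blast
    moreover have "x^2 * inverse x = x" by (cases "x = 0") (simp_all add: power2_eq_square)
    ultimately show False using \<open>x \<notin> V\<close> M_V by simp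
  qed
qed (rule power_V)

lemma power2_M_iff: "x ^ 2 \<in> M \<longleftrightarrow> x \<in> M"
  using power_M[of x 2] prime_M[of x x] M_V[of "x^2"] power2_V_iff[of x] by (auto simp: power2_eq_square)

lemma p_M: "of_nat p \<in> M" using inverse_p by (simp add: M_def)
lemma p_neq_0 [simp]: "p \<noteq> 0" using prime_p by auto
lemma prime_int_p: "prime (int p)" using prime_p by simp

lemma of_int_M_iff: "of_int k \<in> M \<longleftrightarrow> int p dvd k"
proof
  assume "int p dvd k"
  then obtain c where "k = int p * c" by blast
  then show "of_int k \<in> M" using p_M by (auto intro: mult_M)
next
  assume k: "of_int k \<in> M"
  show "int p dvd k"
  proof (rule ccontr)
    assume "\<not> int p dvd k"
    then have "coprime (int p) k" using prime_int_p prime_imp_coprime by blast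
    then obtain u v where "u * int p + v * k = 1" using coprime_iff_gcd_eq_1 bezout_int by metis
    then have "of_int (u * int p + v * k) = (1 :: 'a)" by simp
    then have "of_int u * of_nat p + of_int v * of_int k = (1 :: 'a)" by simp
    moreover have "of_int u * of_nat p + of_int v * of_int k \<in> M" using k p_M by (intro M_intros) auto
    ultimately show False by simp
  qed
qed

lemma of_nat_M_iff: "of_nat k \<in> M \<longleftrightarrow> p dvd k"
  using of_int_M_iff[of "int k"] by simp

lemma Rats_quotient:
  fixes x :: 'a assumes "x \<in> \<rat>" "x \<in> V"
  obtains a b :: int where "\<not> int p dvd b" "x = of_int a / of_int b"
proof -
  obtain q where q: "x = of_rat q" using assms(1) by (auto elim: Rats_cases)
  obtain a b where ab: "quotient_of q = (a, b)" by (cases "quotient_of q")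
  have b: "b > 0" "coprime a b" using quotient_of_denom_pos[OF ab] quotient_of_coprime[OF ab] by auto
  have x: "x = of_int a / of_int b" using quotient_of_div[OF ab] by (simp add: q of_rat_divide)
  have "\<not> int p dvd b"
  proof
    assume pb: "int p dvd b"
    then have "of_int b \<in> M" using of_int_M_iff by simp
    then have "x * of_int b \<in> M" using assms by (intro mult_M')
    then have "int p dvd a" using b of_int_M_iff[of a] by (simp add: x)
    then have "int p dvd 1" using pb b(2) by (metis coprime_common_divisor)
    then show False using prime_p by simp
  qed
  then show ?thesis using x that by blast
qed

text \<open>On the rationals the valuation is discrete with uniformizer \<open>p\<close>. The limits
  in \<open>Qp\<close> inherit this, whereas a ramified extension would lose it.\<close>

lemma Rats_M_divide_p:
  assumes "x \<in> \<rat>" "x \<in> M" shows "x / of_nat p \<in> V"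
proof -
  obtain a b where ab: "\<not> int p dvd b" "x = of_int a / of_int b"
    using Rats_quotient assms M_V by blast
  have b: "inverse (of_int b) \<in> V" "of_int b \<noteq> (0::'a)" using ab(1) unit[of "of_int b"] of_int_M_iff[of b] by auto
  have "x * of_int b \<in> M" using assms by (intro mult_M) auto
  then have "int p dvd a" using b ab of_int_M_iff[of a] by auto
  then obtain c where c: "a = int p * c" by blast
  have "x / of_nat p = of_int c * inverse (of_int b)" using ab c by (simp add: divide_inverse)
  then show ?thesis using b mult_V by auto
qed

text \<open>The elements of the completion of \<open>\<rat>\<close>, i.e. of \<open>\<rat>\<^sub>p\<close>.\<close>

definition Qp :: "'a set" where
  "Qp = {x. \<forall>n. \<exists>q\<in>\<rat>. (x - q) / of_nat p ^ n \<in> V}"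

lemma Rats_Qp: "x \<in> \<rat> \<Longrightarrow> x \<in> Qp"
  unfolding Qp_def by (auto intro!: bexI[of _ x])

lemma arch': "\<exists>n. of_nat p ^ n * x \<in> V"
  using arch[of "inverse x"] by (cases "x = 0") (auto simp: divide_inverse)

lemma Qp_approx:
  assumes "x \<in> Qp" "x \<noteq> 0"
  obtains q where "q \<in> \<rat>" "q \<noteq> 0" "(x - q) / of_nat p ^ k \<in> V" "q / x - 1 \<in> M"
proof -
  obtain n where n: "of_nat p ^ n / x \<in> V" using arch assms by blast
  \<comment> \<open>In the exponent \<open>n\<close> absorbs the division by \<open>x\<close>, 1
    brings the relative error into M, and \<open>k\<close> is the requested absolute
    precision.\<close>
  obtain q where q: "q \<in> \<rat>" "(x - q) / of_nat p ^ (n + 1 + k) \<in> V"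
    using assms unfolding Qp_def by blast
  have "of_nat p * (of_nat p ^ n / x) * (of_nat p ^ k * ((x - q) / of_nat p ^ (n + 1 + k))) \<in> M"
    using n q p_M by (intro M_intros V_intros) auto
  moreover have "of_nat p * (of_nat p ^ n / x) * (of_nat p ^ k * ((x - q) / of_nat p ^ (n + 1 + k))) = (x - q) / x"
    by (simp add: power_add)
  moreover have "(x - q) / x = 1 - q / x" using assms(2) by (simp add: diff_divide_distrib)
  ultimately have *: "1 - q / x \<in> M" by simp
  then have "q \<noteq> 0" by auto
  have "q / x - 1 \<in> M" using * diff_M_commute by blast
  have "(x - q) / of_nat p ^ k = of_nat p ^ (n + 1) * ((x - q) / of_nat p ^ (n + 1 + k))"
    by (simp add: power_add)
  moreover have "\<dots> \<in> V" using q by (intro V_intros) auto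
  ultimately have "(x - q) / of_nat p ^ k \<in> V" by metis
  then show ?thesis using q(1) \<open>q \<noteq> 0\<close> \<open>q / x - 1 \<in> M\<close> that by blast
qed

lemma Qp_M_divide_p:
  assumes "x \<in> Qp" "x \<in> M" shows "x / of_nat p \<in> V"
proof (cases "x = 0")
  case False
  from Qp_approx[OF assms(1) this, of 1] obtain q where
    q: "q \<in> \<rat>" "q \<noteq> 0" "(x - q) / of_nat p ^ 1 \<in> V" .
  have "x - (x - q) / of_nat p ^ 1 * of_nat p \<in> M" using assms q p_M by (intro M_intros)
  then have "q \<in> M" by simp
  then have "q / of_nat p + (x - q) / of_nat p \<in> V" using q Rats_M_divide_p by (intro V_intros) auto
  then show ?thesis by (simp add: diff_divide_distrib)
qed auto

lemma Qp_residue: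
  assumes "x \<in> Qp" "x \<in> V"
  obtains c where "0 \<le> c" "c < int p" "x - of_int c \<in> M"
proof -
  obtain q where q: "q \<in> \<rat>" "(x - q) / of_nat p ^ 1 \<in> V"
    using assms unfolding Qp_def by blast
  have "(x - q) / of_nat p ^ 1 * of_nat p \<in> M" using q p_M by (intro M_intros)
  then have xq: "x - q \<in> M" by simp
  then have "q \<in> V" using diff_V[OF assms(2) M_V[OF xq]] by simp
  with q obtain a b where ab: "\<not> int p dvd b" "q = of_int a / of_int b"
    using Rats_quotient by blast
  have b: "inverse (of_int b) \<in> V" "of_int b \<noteq> (0::'a)" using ab(1) unit[of "of_int b"] of_int_M_iff[of b] by auto
  have "coprime (int p) b" using ab prime_int_p prime_imp_coprime by blast
  then obtain u v where uv: "u * int p + v * b = 1" using coprime_iff_gcd_eq_1 bezout_int by metis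
  define c where "c = (a * v) mod int p"
  have "int p dvd a - b * c"
  proof -
    have "a - b * c = a * (u * int p + v * b) - b * ((a * v) mod int p)" using uv c_def by simp
    also have "\<dots> = int p * (a * u) + b * (a * v - (a * v) mod int p)" by (simp add: algebra_simps)
    finally show ?thesis by (simp add: dvd_minus_mod)
  qed
  then have "of_int (a - b * c) * inverse (of_int b) \<in> M" using of_int_M_iff b by (intro mult_M) blast+
  moreover have "of_int (a - b * c) * inverse (of_int b) = q - of_int c" using ab b by (simp add: field_simps)
  ultimately have "q - of_int c \<in> M" by metis
  then have "x - q + (q - of_int c) \<in> M" using xq by (rule add_M[rotated])
  then show ?thesis using that[of c] c_def prime_p by (auto simp: prime_gt_0_nat)
qed

lemma field_closed_Qp: "field_closed Qp"
  unfolding field_closed_def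
proof (intro conjI ballI)
  show "1 \<in> Qp" by (rule Rats_Qp) simp
next
  fix x y assume xy: "x \<in> Qp" "y \<in> Qp"
  show "x - y \<in> Qp"
    unfolding Qp_def
  proof (safe)
    fix n
    obtain q r where "q \<in> \<rat>" "(x - q) / of_nat p ^ n \<in> V" "r \<in> \<rat>" "(y - r) / of_nat p ^ n \<in> V"
      using xy unfolding Qp_def by blast
    then show "\<exists>q\<in>\<rat>. (x - y - q) / of_nat p ^ n \<in> V"
      using diff_V[of "(x - q) / of_nat p ^ n" "(y - r) / of_nat p ^ n"]
      by (intro bexI[of _ "q - r"]) (auto simp: algebra_simps simp flip: diff_divide_distrib)
  qed
  obtain k l where k: "of_nat p ^ k * x \<in> V" and l: "of_nat p ^ l * y \<in> V" using arch' by blast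
  show "x * y \<in> Qp"
    unfolding Qp_def
  proof (safe)
    fix n
    \<comment> \<open>From \<open>x y - q r = x (y - r) + r (x - q)\<close>: the extra
      \<open>k\<close> pays for the denominator of \<open>x\<close>, the extra \<open>l\<close> for
      that of \<open>r\<close>, which is bounded because \<open>r\<close> is close to
      \<open>y\<close>.\<close>
    obtain q r where qr: "q \<in> \<rat>" "(x - q) / of_nat p ^ (n + l) \<in> V" "r \<in> \<rat>" "(y - r) / of_nat p ^ (n + k + l) \<in> V"
      using xy unfolding Qp_def by blast
    have *: "s * of_nat p ^ l * u + (t - of_nat p ^ (n + k + l + l) * u) * v \<in> V"
      if "s \<in> V" "t \<in> V" "u \<in> V" "v \<in> V" for s t u v
      using that by (intro V_intros) auto
    have "(of_nat p ^ k * x) * of_nat p ^ l * ((y - r) / of_nat p ^ (n + k + l)) 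
       + (of_nat p ^ l * y - of_nat p ^ (n + k + l + l) * ((y - r) / of_nat p ^ (n + k + l))) * ((x - q) / of_nat p ^ (n + l)) \<in> V"
      by (rule *[OF k l qr(4,2)])
    also have "(of_nat p ^ k * x) * of_nat p ^ l * ((y - r) / of_nat p ^ (n + k + l)) 
       = x * (y - r) / of_nat p ^ n" by (simp add: power_add)
    also have "of_nat p ^ (n + k + l + l) * ((y - r) / of_nat p ^ (n + k + l)) = of_nat p ^ l * (y - r)"
      by (simp add: power_add)
    also have "(of_nat p ^ l * y - of_nat p ^ l * (y - r)) * ((x - q) / of_nat p ^ (n + l)) = r * (x - q) / of_nat p ^ n"
      by (simp add: power_add flip: right_diff_distrib)
    also have "x * (y - r) / of_nat p ^ n + r * (x - q) / of_nat p ^ n = (x * y - q * r) / of_nat p ^ n"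
      by (simp add: algebra_simps add_divide_distrib diff_divide_distrib)
    finally show "\<exists>q\<in>\<rat>. (x * y - q) / of_nat p ^ n \<in> V"
      using qr by (intro bexI[of _ "q * r"]) auto
  qed
next
  fix x assume x: "x \<in> Qp"
  show "inverse x \<in> Qp"
  proof (cases "x = 0")
    case False
    obtain k where k: "of_nat p ^ k / x \<in> V" using arch False by blast
    show ?thesis
      unfolding Qp_def
    proof (safe)
      fix n
      \<comment> \<open>\<open>1 / x - 1 / q\<close> is \<open>- (x - q) / x^2\<close> times the
        unit \<open>x / q\<close>; the two factors \<open>1 / x\<close> cost \<open>k\<close>
        each.\<close>
      obtain q where q: "q \<in> \<rat>" "q \<noteq> 0" "(x - q) / of_nat p ^ (n + k + k) \<in> V" "q / x - 1 \<in> M"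
        using Qp_approx[OF x False] by blast
      have "q / x \<in> V" "q / x \<notin> M" using one_plus_M[OF q(4)] add_V[OF M_V[OF q(4)] one_V] by auto
      then have u: "x / q \<in> V" using unit[of "q / x"] by simp
      have "- (((x - q) / of_nat p ^ (n + k + k)) * (of_nat p ^ k / x) * (of_nat p ^ k / x) * (x / q)) \<in> V"
        using q k u by (intro V_intros)
      also have "- (((x - q) / of_nat p ^ (n + k + k)) * (of_nat p ^ k / x) * (of_nat p ^ k / x) * (x / q))
         = (inverse x - inverse q) / of_nat p ^ n"
        using False q(2) by (simp add: field_simps power_add)
      finally show "\<exists>q\<in>\<rat>. (inverse x - q) / of_nat p ^ n \<in> V"
        using q by (intro bexI[of _ "inverse q"]) auto
    qed
  qed (auto intro: Rats_Qp)
qed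

text \<open>Newton's iteration \<open>q \<mapsto> q - F q / k\<close> with fixed derivative; \<open>F q = (q - x) h q\<close>.\<close>

lemma hensel_Qp:
  fixes F h :: "'a \<Rightarrow> 'a"
  assumes r: "r \<in> \<rat>" "r \<in> V" "x - r \<in> M"
    and F: "\<And>q. q \<in> \<rat> \<Longrightarrow> F q \<in> \<rat>" "\<And>q. F q = (q - x) * h q"
    and h: "\<And>q. q \<in> V \<Longrightarrow> q - x \<in> M \<Longrightarrow> h q - k \<in> M" and k: "k \<in> \<rat>" "k \<in> V" "k \<notin> M"
  shows "x \<in> Qp"
proof -
  have ex: "\<exists>q\<in>\<rat>. q \<in> V \<and> (x - q) / of_nat p ^ n \<in> M" for n
  proof (induction n)
    case 0
    then show ?case using r by auto
  next
    case (Suc n)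
    then obtain q where q: "q \<in> \<rat>" "q \<in> V" "(x - q) / of_nat p ^ n \<in> M" by auto
    have "(x - q) / of_nat p ^ n * of_nat p ^ n \<in> M" using q by (intro M_intros V_intros) auto
    then have xq: "x - q \<in> M" by simp
    then have qx: "q - x \<in> M" using diff_M_commute by blast
    note hq = h[OF q(2) qx]
    have "h q = (h q - k) + k" by simp
    then have hV: "h q \<in> V" using k hq M_V add_V by metis
    have "k = h q - (h q - k)" by simp
    then have hM: "h q \<notin> M" using k(3) diff_M hq by metis
    have k0: "k \<noteq> 0" "h q \<noteq> 0" using k(3) hM by auto
    have "(x - q) / of_nat p ^ n * (- h q) \<in> M" using q hV by (intro M_intros V_intros)
    moreover have "(x - q) / of_nat p ^ n * (- h q) = F q / of_nat p ^ n"
      unfolding F(2)[of q] by (metis minus_diff_eq minus_mult_commute times_divide_eq_left)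
    ultimately have "F q / of_nat p ^ n \<in> M" by metis
    \<comment> \<open>Rationality of the iterates enters here: membership in M improves to
      divisibility by \<open>p\<close>. The new error is this value times
      \<open>(h q - k) / (k * h q)\<close>, and \<open>h q - k\<close> in M keeps the bound strict
      for the next step.\<close>
    moreover have "F q / of_nat p ^ n \<in> \<rat>" using F(1) q by simp
    ultimately have Fp: "F q / of_nat p ^ n / of_nat p \<in> V" using Rats_M_divide_p by blast
    have "F q / of_nat p ^ n / of_nat p * inverse (h q) * inverse k * (h q - k) \<in> M"
      using Fp unit hV hM k by (intro mult_M'[OF _ hq] V_intros) auto
    also have "F q / of_nat p ^ n / of_nat p * inverse (h q) * inverse k * (h q - k) = (x - (q - F q / k)) / of_nat p ^ Suc n"
    proof -
      have diff_eq: "x = q - b \<Longrightarrow> x - (q - a) = a - b" for a b by simp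
      have "x = q - F q / h q" using k0 F(2)[of q] by simp
      then have "x - (q - F q / k) = F q / k - F q / h q" 
        using diff_eq by blast
      also have "\<dots> = F q * inverse (h q) * inverse k * (h q - k)"
        using k0 by (simp add: field_simps)
      finally show ?thesis by simp
    qed
    finally have 1: "(x - (q - F q / k)) / of_nat p ^ Suc n \<in> M" .
    have "F q / of_nat p ^ n / of_nat p * of_nat p ^ n * of_nat p * inverse k \<in> V"
      using Fp unit k by (intro V_intros) auto
    then have "F q / k \<in> V" by (simp add: field_simps)
    then have "q - F q / k \<in> V" using q V_intros by blast
    then show ?case using 1 q F(1) k by (intro bexI[of _ "q - F q / k"]) auto
  qed
  show ?thesis unfolding Qp_def using ex M_V by blast
qed

end

subsection \<open>Reduction modulo p\<close>

locale good_reduction = p_valuation +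
  fixes a2 a4 a6 :: int
  assumes p_odd: "p \<noteq> 2"
    and disc: "\<not> int p dvd 9 * (a2^2*a4^2 - 4*a4^3 - 4*a2^3*a6 - 27*a6^2 + 18*a2*a4*a6)"
begin

abbreviation A :: 'a where "A \<equiv> of_int a2"
abbreviation B :: 'a where "B \<equiv> of_int a4"
abbreviation C :: 'a where "C \<equiv> of_int a6"

text \<open>The Euclidean algorithm for the cubic \<open>f\<close> and its derivative:
  \<open>9 f - f' (3 x + A)\<close> is the linear polynomial
  \<open>(6 B - 2 A^2) x + (9 C - A B)\<close>, and dividing \<open>f'\<close> by it leaves the
  discriminant. Clearing denominators produces the factor 9, so good reduction is here understood
  with \<open>p\<close> different from 3.\<close>

lemma disc_combination:
  fixes x :: 'a
  shows "of_int (9 * (a2^2*a4^2 - 4*a4^3 - 4*a2^3*a6 - 27*a6^2 + 18*a2*a4*a6)) =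
     (9*(x^3 + A*x^2 + B*x + C) - (3*x^2 + 2*A*x + B)*(3*x + A))
       * (3*(6*B - 2*A^2)*x - 3*(9*C - A*B) + 2*A*(6*B - 2*A^2))
     - (6*B - 2*A^2)^2 * (3*x^2 + 2*A*x + B)"
  by (simp add: ring_expand)

sublocale wcurve A B C
proof
  fix x :: 'a assume "x^3 + A*x^2 + B*x + C = 0"
  moreover have "of_int (9 * (a2^2*a4^2 - 4*a4^3 - 4*a2^3*a6 - 27*a6^2 + 18*a2*a4*a6)) \<noteq> (0 :: 'a)"
    using disc by (metis of_int_eq_0_iff dvd_0_right)
  ultimately show "3*x^2 + 2*A*x + B \<noteq> 0"
    using disc_combination[of x] by auto
qed

lemma smooth_mod_p:
  assumes "x \<in> V" "x^3 + A*x^2 + B*x + C \<in> M" shows "3*x^2 + 2*A*x + B \<notin> M"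
proof
  assume g: "3*x^2 + 2*A*x + B \<in> M"
  have *: "(9*f - g*(3*x + A)) * h - k * g \<in> M" if "f \<in> M" "g \<in> M" "h \<in> V" "k \<in> V" for f g h k
    using that assms(1) M_V by (intro diff_M mult_M mult_M' add_V mult_V) auto
  have "of_int (9 * (a2^2*a4^2 - 4*a4^3 - 4*a2^3*a6 - 27*a6^2 + 18*a2*a4*a6)) \<in> M"
    unfolding disc_combination[of x] by (rule *[OF assms(2) g]) (use assms(1) in \<open>auto intro!: V_intros\<close>)
  then show False using disc of_int_M_iff by blast
qed

section \<open>The kernel of reduction and its parameter at infinity\<close>

fun in_kernel :: "'a point \<Rightarrow> bool" where
  "in_kernel Infinity \<longleftrightarrow> True"
| "in_kernel (Affine x y) \<longleftrightarrow> x \<notin> V"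

fun zpar :: "'a point \<Rightarrow> 'a" where
  "zpar Infinity = 0"
| "zpar (Affine x y) = x / y"

text \<open>For \<open>x\<close> outside V the leading term dominates:
  \<open>y^2 = x^3 (1 + e)\<close> with \<open>e\<close> in M, so \<open>(x / y)^2\<close> is
  \<open>1 / x\<close> up to a unit and \<open>1 / y\<close> is \<open>(x / y)^3\<close> up to a
  unit.\<close>

lemma kernel_coords:
  assumes on: "on_curve (Affine x y)" and x: "x \<notin> V"
  shows "y \<noteq> 0" "x / y \<in> M" "x / y \<noteq> 0" "\<exists>u\<in>V. 1 / y = (x / y)^3 * u"
proof -
  have x0: "x \<noteq> 0" using x by auto
  define t where "t = inverse x"
  have t: "t \<in> M" "t \<noteq> 0" using notin_V_inverse[OF x] x0 unfolding t_def by auto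
  define e where "e = t * (A + B*t + C*t^2)"
  have e: "e \<in> M" unfolding e_def using t M_V by (intro mult_M V_intros) auto
  have "x^3 * (1 + e) = x^3 + A*x^2 + B*x + C"
    unfolding e_def t_def using x0 by (simp add: field_simps power2_eq_square power3_eq_cube)
  then have y2: "y^2 = x^3 * (1 + e)" using on by simp
  have e1: "1 + e \<noteq> 0" "1 + e \<in> V" "inverse (1 + e) \<in> V"
    using one_plus_M[OF e] e M_V add_V[OF one_V] unit by auto
  then show y: "y \<noteq> 0" using y2 x0 by auto
  have "x^2 / x^3 = inverse x" using x0 by (simp add: field_simps power2_eq_square power3_eq_cube)
  then have "(x / y)^2 = t * inverse (1 + e)"
    unfolding power_divide y2 t_def by (metis divide_inverse inverse_mult_distrib mult.assoc)
  then show "x / y \<in> M" using power2_M_iff mult_M t e1 by metis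
  show "x / y \<noteq> 0" using x0 y by simp
  have "(x / y)^3 * (1 + e) = (x^3 * (1 + e)) / y^3" by (simp add: power_divide)
  also have "\<dots> = 1 / y" unfolding y2[symmetric] using y by (simp add: power2_eq_square power3_eq_cube)
  finally show "\<exists>u\<in>V. 1 / y = (x / y)^3 * u" using e1 by metis
qed

text \<open>In the coordinates \<open>z = x / y\<close>, \<open>w = 1 / y\<close> at infinity the
  line is \<open>w = s z + v\<close>. Substitution into the curve gives a cubic in \<open>z\<close>
  with leading coefficient \<open>c3 = 1 + A s + B s^2 + C s^3\<close> and next coefficient
  \<open>v (A + 2 B s + 3 C s^2)\<close>. As \<open>s\<close> is of order \<open>t^2\<close> and
  \<open>v\<close> of order \<open>t^3\<close>, the sum of the three roots is of order
  \<open>t^3\<close>; "order" means divisibility by a power of the common factor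
  \<open>t\<close>.\<close>

lemma kernel_add:
  assumes m: "meets l n x1 x2 x3" and k: "x1 \<notin> V" "x2 \<notin> V"
    and t: "t \<in> M" and z1: "x1 / (l*x1 + n) = t * u1" "u1 \<in> V" and z2: "x2 / (l*x2 + n) = t * u2" "u2 \<in> V"
  shows "x3 \<notin> V" "\<exists>c\<in>V. x1 / (l*x1 + n) + x2 / (l*x2 + n) + x3 / (l*x3 + n) = t^3 * c"
proof -
  define y1 y2 y3 where y: "y1 = l*x1 + n" "y2 = l*x2 + n" "y3 = l*x3 + n"
  define z1 z2 w1 w2 where zw: "z1 = x1 / y1" "z2 = x2 / y2" "w1 = 1 / y1" "w2 = 1 / y2"
  have on: "on_curve (Affine x1 y1)" "on_curve (Affine x2 y2)"
    using meets_on_curve[OF m] meets_on_curve[OF meets_perm(1)[OF m]] unfolding y by auto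
  note c1 = kernel_coords[OF on(1) k(1)] and c2 = kernel_coords[OF on(2) k(2)]
  obtain v1 v2 where v: "w1 = z1^3 * v1" "v1 \<in> V" "w2 = z2^3 * v2" "v2 \<in> V"
    using c1(4) c2(4) unfolding zw by blast
  have zt: "z1 = t * u1" "z2 = t * u2" using z1 z2 unfolding zw y by auto
  have zM: "z1 \<in> M" "z2 \<in> M" using c1 c2 unfolding zw by auto
  have wM: "w1 \<in> M" "w2 \<in> M" using v zM by (auto intro!: mult_M power_M)
  note VV = zM[THEN M_V] wM[THEN M_V]
  have y0: "y1 \<noteq> 0" "y2 \<noteq> 0" using c1 c2 by auto
  have xy: "x1 = z1 / w1" "y1 = 1 / w1" "x2 = z2 / w2" "y2 = 1 / w2" and w0: "w1 \<noteq> 0" "w2 \<noteq> 0"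
    using y0 unfolding zw by auto
  have eq: "w = z^3 + A*z^2*w + B*z*w^2 + C*w^3"
    if "on_curve (Affine x y)" "y \<noteq> 0" "z = x / y" "w = 1 / y" for x y z w
  proof -
    have zy: "z*y = x" "w*y = 1" using that by auto
    have "w * y^3 = (w*y) * y^2" by (simp add: power2_eq_square power3_eq_cube)
    also have "\<dots> = (z*y)^3 + A*(z*y)^2*(w*y) + B*(z*y)*(w*y)^2 + C*(w*y)^3"
      using that(1) unfolding zy by simp
    also have "\<dots> = (z^3 + A*z^2*w + B*z*w^2 + C*w^3) * y^3" by (simp add: ring_expand)
    finally show ?thesis using that(2) by simp
  qed
  have q1: "w1 = z1^3 + A*z1^2*w1 + B*z1*w1^2 + C*w1^3" by (rule eq[OF on(1) y0(1)]) (simp_all add: zw)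
  have q2: "w2 = z2^3 + A*z2^2*w2 + B*z2*w2^2 + C*w2^3" by (rule eq[OF on(2) y0(2)]) (simp_all add: zw)
  \<comment> \<open>Subtracting the two curve equations gives
    \<open>(w1 - w2) D = (z1 - z2) N\<close> with \<open>D\<close> a unit, so \<open>N / D\<close>
    is the slope, and it makes sense for coinciding points too.\<close>
  define N where "N = z1^2 + z1*z2 + z2^2 + A*(z1 + z2)*w1 + B*w1^2"
  define D where "D = 1 - (A*z2^2 + B*z2*(w1 + w2) + C*(w1^2 + w1*w2 + w2^2))"
  have "1 - D \<in> M" unfolding D_def using zM wM VV by (auto intro!: add_M mult_M' power_M mult_V)
  then have D: "D \<notin> M" using diff_M[of "1 - D" "- D"] uminus_M[of D] by auto
  have "D \<in> V" using \<open>1 - D \<in> M\<close> M_V diff_V[OF one_V, of "1 - D"] by simp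
  then have DV: "inverse D \<in> V" "D \<noteq> 0" using D unit by auto
  have slope: "(w1 - w2) * D = (z1 - z2) * N"
  proof -
    have "(z1 - z2) * N - (w1 - w2) * D = 
       (z1^3 + A*z1^2*w1 + B*z1*w1^2 + C*w1^3) - (z2^3 + A*z2^2*w2 + B*z2*w2^2 + C*w2^3) - (w1 - w2)"
      unfolding N_def D_def by (simp add: ring_expand)
    then show ?thesis using q1 q2 by simp
  qed
  define s where "s = N / D"
  have line: "1 = l*z1 + n*w1" "1 = l*z2 + n*w2"
  proof -
    have "l*x1 + n = y1" "l*x2 + n = y2" by (simp_all add: y)
    then have "(l*x1 + n) / y1 = 1" "(l*x2 + n) / y2 = 1" using y0 by simp_all
    then show "1 = l*z1 + n*w1" "1 = l*z2 + n*w2" unfolding zw by (simp_all add: add_divide_distrib)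
  qed
  \<comment> \<open>The line \<open>1 = l z + n w\<close> has slope \<open>- l / n\<close>, which
    has to be matched with \<open>N / D\<close>; for coinciding points \<open>N / D\<close> is the
    slope of the tangent.\<close>
  have key: "l + n*s = 0"
  proof (cases "z1 = z2")
    case False
    have "(z1 - z2) * (l*D + n*N) = l*(z1 - z2)*D + n*((w1 - w2) * D)" unfolding slope by (simp add: algebra_simps)
    also have "\<dots> = D * ((l*z1 + n*w1) - (l*z2 + n*w2))" by (simp add: algebra_simps)
    also have "\<dots> = 0" using line by simp
    finally have "l*D + n*N = 0" using False by simp
    then show ?thesis unfolding s_def using DV by (simp add: field_simps)
  next
    case True
    then have w: "w1 = w2" using slope DV by simp
    then have x: "x1 = x2" using True xy by simp
    have m': "meets l n x1 x1 x3" using m x by simp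
    have y1: "y1 = l*x1 + n" by (rule y)
    have "y1^3 * (l*D + n*N) = 0"
    proof -
      have N: "y1^2 * N = 3*x1^2 + 2*A*x1 + B"
        unfolding N_def True[symmetric] w[symmetric] zw using y0 by (simp add: field_simps power2_eq_square)
      have D: "y1^2 * D = y1^2 - (A*x1^2 + 2*B*x1 + 3*C)"
        unfolding D_def True[symmetric] w[symmetric] zw using y0 by (simp add: field_simps power2_eq_square)
      have "y1^2 * (l*D + n*N) = l*(y1^2*D) + n*(y1^2*N)" by (simp add: algebra_simps)
      also have "\<dots> = 0" unfolding N D unfolding y1 unfolding meetsD[OF m'] by (simp add: ring_expand)
      finally show ?thesis using y0 by simp
    qed
    then have "l*D + n*N = 0" using y0 by simp
    then show ?thesis unfolding s_def using DV by (simp add: field_simps)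
  qed
  then have l: "l = - n*s" by (simp add: add_eq_0_iff)
  have n0: "n \<noteq> 0" using line l by auto
  define v where "v = 1 / n"
  have "v = w1 - s*z1" using line(1) n0 unfolding l v_def by (simp add: field_simps)
  obtain s' where s': "s = t^2 * s'" "s' \<in> V"
  proof
    show "s = t^2 * ((u1^2 + u1*u2 + u2^2 + A*(u1 + u2)*(t^2*u1^3*v1) + B*(t^2*u1^3*v1)^2) / D)"
      unfolding s_def N_def v(1) zt by (simp add: ring_expand)
    show "(u1^2 + u1*u2 + u2^2 + A*(u1 + u2)*(t^2*u1^3*v1) + B*(t^2*u1^3*v1)^2) / D \<in> V"
      unfolding divide_inverse using DV z1 z2 t M_V v by (intro V_intros) auto
  qed
  have sM: "s \<in> M" unfolding s' using s' t by (intro M_intros) auto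
  have vt: "v = t^3 * (u1^3*v1 - s'*u1)"
    unfolding \<open>v = w1 - s*z1\<close> v(1) s' zt by (simp add: ring_expand)
  have vM: "v \<in> M" unfolding vt using t s' v z1 by (intro mult_M V_intros power_M) auto
  define c3 where "c3 = 1 + (A*s + B*s^2 + C*s^3)"
  have eM: "A*s + B*s^2 + C*s^3 \<in> M" 
    by (intro add_M mult_M'[OF of_int_V] power_M sM) auto
  have "c3 \<notin> M" unfolding c3_def by (rule one_plus_M[OF eM])
  moreover have "c3 \<in> V" unfolding c3_def by (rule add_V[OF one_V M_V[OF eM]])
  ultimately have c3: "c3 \<noteq> 0" "inverse c3 \<in> V" using unit by auto
  have prod: "y1*y2*y3 = n^3 * c3"
    unfolding y c3_def l unfolding meetsD[OF m, unfolded l] by (simp add: ring_expand)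
  have y3: "y3 \<noteq> 0" using prod n0 c3 by auto
  have sum: "x1*y2*y3 + x2*y1*y3 + x3*y1*y2 = - (n^2) * (A + 2*B*s + 3*C*s^2)"
    unfolding y l unfolding meetsD[OF m, unfolded l] by (simp add: ring_expand)
  have "x1/y1 + x2/y2 + x3/y3 = (x1*y2*y3 + x2*y1*y3 + x3*y1*y2) / (y1*y2*y3)"
    using y0 y3 by (simp add: field_simps)
  also have "\<dots> = - v * (A + 2*B*s + 3*C*s^2) * inverse c3"
    unfolding sum prod v_def using n0 c3 by (simp add: field_simps power2_eq_square power3_eq_cube)
  also have "\<dots> = t^3 * (- ((u1^3*v1 - s'*u1) * (A + 2*B*s + 3*C*s^2) * inverse c3))"
    unfolding vt by (simp add: algebra_simps)
  finally have S: "x1/y1 + x2/y2 + x3/y3 = t^3 * (- ((u1^3*v1 - s'*u1) * (A + 2*B*s + 3*C*s^2) * inverse c3))" .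
  have cV: "- ((u1^3*v1 - s'*u1) * (A + 2*B*s + 3*C*s^2) * inverse c3) \<in> V"
    using z1 z2 v s' c3 sM[THEN M_V] by (intro V_intros) auto
  show "\<exists>c\<in>V. x1 / (l*x1 + n) + x2 / (l*x2 + n) + x3 / (l*x3 + n) = t^3 * c"
    using S cV unfolding y by blast
  \<comment> \<open>If \<open>x3\<close> were integral, \<open>y3\<close> would be integral too, but
    \<open>1 / y3 = s z3 + v\<close> lies in M.\<close>
  show "x3 \<notin> V"
  proof
    assume x3: "x3 \<in> V"
    have "on_curve (Affine x3 y3)" using meets_on_curve[OF meets_perm(2)[OF m]] y by simp
    then have "y3^2 \<in> V" using x3 by (auto intro!: V_intros)
    then have y3V: "y3 \<in> V" using power2_V_iff by blast
    have "x3/y3 = t^3 * (- ((u1^3*v1 - s'*u1) * (A + 2*B*s + 3*C*s^2) * inverse c3)) - z1 - z2"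
      using S unfolding zw by (simp add: algebra_simps)
    moreover have "\<dots> \<in> M" using t cV zM by (intro diff_M mult_M power_M) auto
    ultimately have z3: "x3/y3 \<in> M" by metis
    have "1 / y3 = s * (x3/y3) + v"
    proof -
      have "s * (x3/y3) + v = (n*(s*x3) + y3) / (n*y3)"
        unfolding v_def using y3 n0 by (simp add: add_divide_distrib)
      moreover have "n*(s*x3) + y3 = n" using y(3) unfolding l by simp
      ultimately show ?thesis using n0 by simp
    qed
    also have "\<dots> \<in> M" using z3 sM vM M_V by (intro M_intros) auto
    finally have "1 / y3 * y3 \<in> M" using y3V mult_M by blast
    then show False using y3 by simp
  qed
qed

end

section \<open>Torsion injects under reduction\<close>

context good_reduction
begin

abbreviation multiple :: "'a set \<Rightarrow> 'a point \<Rightarrow> nat \<Rightarrow> 'a point" where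
  "multiple K P n \<equiv> P [^]\<^bsub>point_group E K\<^esub> n"

lemma zpar_neg: "zpar (neg P) = - zpar P" by (cases P) auto

lemma kernel_add_points:
  assumes on: "on_curve P" "on_curve Q" and k: "in_kernel P" "in_kernel Q"
    and t: "t \<in> M" and z: "zpar P = t * u" "u \<in> V" "zpar Q = t * v" "v \<in> V"
  shows "in_kernel (add P Q)" "\<exists>c\<in>V. zpar (add P Q) = zpar P + zpar Q + t^3 * c"
proof -
  have "in_kernel (add P Q) \<and> (\<exists>c\<in>V. zpar (add P Q) = zpar P + zpar Q + t^3 * c)"
    using on
  proof (cases rule: add_cases)
    case (4 l n x1 x2 x3)
    have "x3 \<notin> V" "\<exists>c\<in>V. x1 / (l*x1 + n) + x2 / (l*x2 + n) + x3 / (l*x3 + n) = t^3 * c"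
      using kernel_add[OF 4(1) _ _ t, of u v] k z 4 by auto
    then obtain c where c: "c \<in> V" "x1 / (l*x1 + n) + x2 / (l*x2 + n) + x3 / (l*x3 + n) = t^3 * c" by blast
    have "x3 / (- (l*x3 + n)) = x1 / (l*x1 + n) + x2 / (l*x2 + n) + t^3 * (- c)"
      using c(2) by (simp add: algebra_simps del: minus_add_distrib)
    moreover have "zpar P = x1 / (l*x1 + n)" by (subst 4(2)) (rule zpar.simps)
    moreover have "zpar Q = x2 / (l*x2 + n)" by (subst 4(3)) (rule zpar.simps)
    moreover have "zpar (add P Q) = x3 / (- (l*x3 + n))" by (subst 4(4)) (rule zpar.simps)
    ultimately have "zpar (add P Q) = zpar P + zpar Q + t^3 * (- c)" by (simp only:)
    then show ?thesis using 4 \<open>x3 \<notin> V\<close> uminus_V[OF c(1)] by (auto simp del: mult_minus_right)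
  qed (use k zpar_neg in \<open>auto intro!: bexI[of _ 0]\<close>)
  then show "in_kernel (add P Q)" "\<exists>c\<in>V. zpar (add P Q) = zpar P + zpar Q + t^3 * c" by auto
qed

lemma pow_Suc_point_group:
  "multiple K P 0 = Infinity"
  "multiple K P (Suc k) = add (multiple K P k) P"
  by (simp_all add: nat_pow_def point_group_def)

lemma kernel_zpar:
  assumes "on_curve P" "in_kernel P"
  shows "zpar P \<in> M" "zpar P = 0 \<longleftrightarrow> P = Infinity"
  using assms kernel_coords by (cases P; auto)+

lemma kernel_multiples:
  assumes "on_curve P" "in_kernel P"
  shows "on_curve (multiple K P k) \<and> in_kernel (multiple K P k) \<and>
    (\<exists>c\<in>V. zpar (multiple K P k) = of_nat k * zpar P + zpar P ^ 3 * c)"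
proof (induction k)
  case 0
  then show ?case unfolding pow_Suc_point_group by (auto intro!: bexI[of _ 0])
next
  case (Suc k)
  define t where "t = zpar P"
  have t: "t \<in> M" using kernel_zpar assms t_def by blast
  obtain c where c: "on_curve (multiple K P k)" "in_kernel (multiple K P k)" "c \<in> V"
     "zpar (multiple K P k) = of_nat k * t + t ^ 3 * c" using Suc t_def by auto
  have z: "zpar (multiple K P k) = t * (of_nat k + t^2 * c)" "zpar P = t * 1"
    using c(4) t_def by (simp_all add: ring_expand)
  have V: "of_nat k + t^2 * c \<in> V" using t M_V c by (intro V_intros) auto
  from kernel_add_points[OF c(1) assms(1) c(2) assms(2) t z(1) V z(2) one_V]
  obtain d where d: "in_kernel (multiple K P (Suc k))" "d \<in> V"
    "zpar (multiple K P (Suc k)) = t * (of_nat k + t^2 * c) + t + t^3 * d"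
    unfolding pow_Suc_point_group z by auto
  have "zpar (multiple K P (Suc k)) = of_nat (Suc k) * t + t^3 * (c + d)"
    unfolding d by (simp add: ring_expand)
  moreover have "c + d \<in> V" using c d by (intro V_intros)
  ultimately show ?case using d(1) on_add[OF c(1) assms(1)] t_def pow_Suc_point_group(2)[where P = P and K = K and k = k] by auto
qed

text \<open>With \<open>t = zpar P\<close> the relation \<open>l t + c t^3 = 0\<close> gives
  \<open>l = - c t^2\<close>. Since \<open>t\<close> lies in \<open>Qp\<close> it is divisible by
  \<open>p\<close>, so \<open>l\<close> would be divisible by \<open>p^2\<close>, impossible for a
  prime even if \<open>l = p\<close>. An error term of second order would give only one factor
  \<open>p\<close> and leave that case open.\<close>

lemma kernel_no_prime_torsion:
  assumes P: "on_curve P" "in_kernel P" "zpar P \<in> Qp"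
    and l: "prime (l::nat)" "multiple K P l = Infinity"
  shows "P = Infinity"
proof (rule ccontr)
  assume "P \<noteq> Infinity"
  define t where "t = zpar P"
  have t: "t \<in> M" "t \<noteq> 0" using kernel_zpar P \<open>P \<noteq> Infinity\<close> t_def by auto
  obtain c where c: "c \<in> V" "0 = of_nat l * t + t ^ 3 * c"
    using kernel_multiples[OF P(1,2), where K = K and k = l] l t_def by auto
  define s where "s = t / of_nat p"
  have s: "s \<in> V" "t = of_nat p * s" using Qp_M_divide_p t P t_def unfolding s_def by auto
  have "t * (of_nat l + t^2 * c) = 0" using c(2) by (simp add: ring_expand)
  then have "of_nat l = - (t^2 * c)" using t by (simp add: add_eq_0_iff2)
  then have lp: "of_nat l = of_nat p * (of_nat p * (- (s^2 * c)))" unfolding s by (simp add: power2_eq_square)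
  have "of_nat p * (of_nat p * (- (s^2 * c))) \<in> M" using p_M s c by (intro mult_M V_intros) auto
  then have "p dvd l" using lp of_nat_M_iff by metis
  then have "p = l" using l prime_p primes_dvd_imp_eq by blast
  then have "of_nat p * 1 = of_nat p * (of_nat p * (- (s^2 * c)))" using lp by simp
  then have "1 = of_nat p * (- (s^2 * c))" unfolding mult_cancel_left by simp
  also have "\<dots> \<in> M" using p_M s c by (intro mult_M V_intros)
  finally show False by simp
qed

lemma kernel_torsion_free:
  assumes K: "field_closed K" "K \<subseteq> Qp"
  shows "P \<in> points_over E K \<Longrightarrow> in_kernel P \<Longrightarrow> k > 0 \<Longrightarrow> multiple K P k = Infinity
    \<Longrightarrow> P = Infinity"
proof (induction k rule: less_induct)
  case (less k)
  interpret G: comm_group "point_group E K"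
    using comm_group_point_group[OF K(1)] field_closedD(11)[OF K(1)] by blast
  have car: "carrier (point_group E K) = points_over E K" by (simp add: point_group_def)
  show ?case
  proof (cases "k = 1")
    case True
    then have "multiple K P (Suc 0) = Infinity" using less.prems(4) by simp
    then show ?thesis unfolding pow_Suc_point_group by simp
  next
    case False
    then obtain l j where l: "prime l" "k = j * l" using prime_factor_nat[of k] by (auto elim!: dvdE simp: mult.commute)
    then have j: "j > 0" "j < k" using less.prems(3) prime_gt_1_nat[of l] by auto
    define Q where "Q = multiple K P j"
    have Q: "Q \<in> points_over E K" using G.nat_pow_closed[of P j] less.prems(1) unfolding car Q_def by blast
    have onP: "on_curve P" using less.prems(1) points_over_iff by blast
    have onQ: "on_curve Q" "in_kernel Q" using kernel_multiples[OF onP less.prems(2)] unfolding Q_def by auto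
    have "Q [^]\<^bsub>point_group E K\<^esub> l = Infinity"
      using G.nat_pow_pow[of P j l] less.prems unfolding car Q_def l by simp
    moreover have "zpar Q \<in> K"
      using Q unfolding points_over_iff by (cases Q) (auto intro: field_closedD[OF K(1)])
    ultimately have "Q = Infinity" using kernel_no_prime_torsion[OF onQ _ l(1)] K by blast
    then show ?thesis using less.IH[OF j(2) less.prems(1,2) j(1)] Q_def by simp
  qed
qed

text \<open>Were the slope \<open>l\<close> of the chord through P and -Q in V, the congruences
  would put \<open>2 y1\<close> and the derivative of the cubic at \<open>x1\<close> into M, so the
  reduction would be singular at P; here \<open>p\<close> must be odd. Hence \<open>l\<close> is
  outside V, and \<open>l^2 = x3 + A + x1 + x2\<close> forces \<open>x3\<close> outside V.\<close>

lemma congruent_diff_in_kernel: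
  assumes on: "on_curve (Affine x1 y1)" "on_curve (Affine x2 y2)" and V: "x1 \<in> V" "x2 \<in> V" "y1 \<in> V"
    and cong: "x1 - x2 \<in> M" "y1 - y2 \<in> M"
  shows "in_kernel (add (Affine x1 y1) (neg (Affine x2 y2)))"
proof (cases "x1 = x2 \<and> y1 = y2")
  case False
  have on': "on_curve (Affine x2 (- y2))" using on by simp
  obtain l n x3 where m: "meets l n x1 x2 x3" "y1 = l*x1 + n" "- y2 = l*x2 + n"
    by (rule meets_exists[OF on(1) on']) (use False in auto)
  have y2: "y2 = - (l*x2 + n)" using m(3) by (metis minus_minus)
  have x3: "l^2 = x3 + (A + x1 + x2)" using m(1) unfolding meets_def by (simp add: algebra_simps)
  have "l \<notin> V"
  proof
    assume l: "l \<in> V"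
    have "l * (x1 - x2) + (y1 - y2) \<in> M" by (rule add_M[OF mult_M'[OF l cong(1)] cong(2)])
    also have "l * (x1 - x2) + (y1 - y2) = 2 * y1" using m y2 by (simp add: algebra_simps)
    finally have "2 * y1 \<in> M" .
    moreover have "2 \<notin> M" using of_nat_M_iff[of 2] p_odd prime_p primes_dvd_imp_eq[of p 2] by auto
    ultimately have "y1 \<in> M" using prime_M[of 2 y1] V by auto
    then have "y1^2 \<in> M" by (intro power_M) auto
    then have f: "x1^3 + A*x1^2 + B*x1 + C \<in> M" using on by simp
    have "l * (y1 - y2) - (x1 - x2) * (- (2*x1 + x2 + A)) \<in> M"
      by (rule diff_M[OF mult_M'[OF l cong(2)] mult_M[OF cong(1)]]) (use V in \<open>auto intro!: V_intros\<close>)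
    also have "l * (y1 - y2) - (x1 - x2) * (- (2*x1 + x2 + A)) = 3*x1^2 + 2*A*x1 + B"
      unfolding m(2) y2 unfolding meetsD[OF m(1)] by (simp add: algebra_simps power2_eq_square)
    finally show False using smooth_mod_p[OF V(1) f] by simp
  qed
  then have "x3 \<notin> V" using x3 V power2_V_iff[of l] add_V[of x3 "A + x1 + x2"] by (auto intro!: V_intros)
  moreover have "add (Affine x1 y1) (neg (Affine x2 y2)) = Affine x3 (- (l*x3 + n))"
    using add_meets[OF m(1)] m(2,3) by simp
  ultimately show ?thesis by simp
qed simp

text \<open>Reduction sends a point to its residues and the kernel to \<open>None\<close>, the point
  at infinity, whence the successor. Its compatibility with addition is replaced by
  \<open>congruent_diff_in_kernel\<close>: torsion points with equal residues differ by a torsion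
  point of the kernel, which is trivial.\<close>

theorem card_torsion_le:
  assumes K: "field_closed K" "K \<subseteq> Qp"
  defines "T \<equiv> carrier (torsion_subgroup (point_group E K))"
  defines "S \<equiv> {(a, b). a \<in> {0..<int p} \<and> b \<in> {0..<int p} \<and> int p dvd b^2 - (a^3 + a2*a^2 + a4*a + a6)}"
  shows "finite T" "card T \<le> Suc (card S)"
proof -
  interpret G: comm_group "point_group E K"
    using comm_group_point_group[OF K(1)] field_closedD(11)[OF K(1)] by blast
  interpret T: comm_group "torsion_subgroup (point_group E K)"
    by (rule G.comm_group_torsion_subgroup)
  have T: "P \<in> T \<longleftrightarrow> P \<in> points_over E K \<and> (\<exists>n::nat. n > 0 \<and> multiple K P n = Infinity)" for P
    unfolding T_def carrier_torsion_subgroup by (simp add: point_group_def)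
  have ex: "\<exists>r. (in_kernel P \<and> r = None) \<or> (\<exists>x y a b. P = Affine x y \<and> x \<in> V \<and> y \<in> V \<and> r = Some (a, b) 
      \<and> (a, b) \<in> S \<and> x - of_int a \<in> M \<and> y - of_int b \<in> M)" if "P \<in> T" for P
  proof (cases "in_kernel P")
    case False
    then obtain x y where P: "P = Affine x y" "x \<in> V" by (cases P) auto
    have xy: "x \<in> Qp" "y \<in> Qp" and on: "on_curve (Affine x y)" using that P K T points_over_iff by blast+
    then have "y^2 \<in> V" using P by (auto intro!: V_intros)
    then have y: "y \<in> V" using power2_V_iff by blast
    obtain a where a: "0 \<le> a" "a < int p" "x - of_int a \<in> M" using Qp_residue xy P by blast
    obtain b where b: "0 \<le> b" "b < int p" "y - of_int b \<in> M" using Qp_residue xy y by blast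
    have "(x - of_int a) * (x^2 + x*of_int a + of_int a^2 + A*(x + of_int a) + B)
          - (y - of_int b) * (y + of_int b) \<in> M"
      by (rule diff_M[OF mult_M[OF a(3)] mult_M[OF b(3)]]) (use P(2) y in \<open>auto intro!: V_intros\<close>)
    also have "(x - of_int a) * (x^2 + x*of_int a + of_int a^2 + A*(x + of_int a) + B)
          - (y - of_int b) * (y + of_int b) = 
          (x^3 + A*x^2 + B*x + C - y^2) + of_int (b^2 - (a^3 + a2*a^2 + a4*a + a6))"
      by (simp add: ring_expand)
    also have "x^3 + A*x^2 + B*x + C - y^2 = 0" using on by simp
    finally have "of_int (b^2 - (a^3 + a2*a^2 + a4*a + a6)) \<in> M" unfolding add_0_left .
    then have "int p dvd b^2 - (a^3 + a2*a^2 + a4*a + a6)" by (rule of_int_M_iff[THEN iffD1])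
    then have "(a, b) \<in> S" using a b unfolding S_def by auto
    then show ?thesis using P y a b by blast
  qed auto
  then obtain r where r: "\<And>P. P \<in> T \<Longrightarrow> (in_kernel P \<and> r P = None) \<or> 
      (\<exists>x y a b. P = Affine x y \<and> x \<in> V \<and> y \<in> V \<and> r P = Some (a, b) 
      \<and> (a, b) \<in> S \<and> x - of_int a \<in> M \<and> y - of_int b \<in> M)" by metis
  have ker: "P = Infinity" if "P \<in> T" "in_kernel P" for P
    using kernel_torsion_free[OF K] that T by blast
  have "inj_on r T"
  proof (rule inj_onI)
    fix P Q assume PQ: "P \<in> T" "Q \<in> T" "r P = r Q"
    show "P = Q"
    proof (cases "in_kernel P")
      case True
      then have "in_kernel Q" using r[OF PQ(1)] r[OF PQ(2)] PQ(3) by auto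
      then show ?thesis using ker True PQ by auto
    next
      case False
      then obtain x y a b where P: "P = Affine x y" "x \<in> V" "y \<in> V" "r P = Some (a, b)"
         "x - of_int a \<in> M" "y - of_int b \<in> M" using r[OF PQ(1)] by auto
      then obtain x' y' where Q: "Q = Affine x' y'" "x' \<in> V" "y' \<in> V"
         "x' - of_int a \<in> M" "y' - of_int b \<in> M" using r[OF PQ(2)] PQ(3) by auto
      have on: "on_curve (Affine x y)" "on_curve (Affine x' y')" using PQ T points_over_iff P Q by metis+
      have "x - x' \<in> M" "y - y' \<in> M" using diff_M[OF P(5) Q(4)] diff_M[OF P(6) Q(5)] by auto
      then have kk: "in_kernel (add P (neg Q))" using congruent_diff_in_kernel[OF on] P Q by blast
      have pts: "P \<in> points_over E K" "Q \<in> points_over E K" using PQ T by auto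
      have inv: "inv\<^bsub>point_group E K\<^esub> Q = neg Q"
        using inv_point_group[OF K(1) _ _ pts(2)] field_closedD(11)[OF K(1)] by blast
      have "neg Q \<in> T"
      proof -
        obtain n :: nat where n: "n > 0" "Q [^]\<^bsub>point_group E K\<^esub> n = \<one>\<^bsub>point_group E K\<^esub>"
          using PQ T by (auto simp: point_group_def)
        have "inv\<^bsub>point_group E K\<^esub> Q [^]\<^bsub>point_group E K\<^esub> n = \<one>\<^bsub>point_group E K\<^esub>"
          using n pts G.nat_pow_inv[of Q n] by (simp add: point_group_def[of _ K] del: G.nat_pow_inv) (metis G.inv_one point_group_def monoid.simps(2))
        then show ?thesis using T neg_in_points_over[OF K(1) pts(2)] n inv by (auto simp: point_group_def)
      qed
      then have "add P (neg Q) \<in> T"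
        using T.m_closed[of P "neg Q"] PQ unfolding T_def mult_torsion_subgroup by (simp add: point_group_def)
      then have "add P (neg Q) = Infinity" using ker kk by blast
      then have "P \<otimes>\<^bsub>point_group E K\<^esub> inv\<^bsub>point_group E K\<^esub> Q = \<one>\<^bsub>point_group E K\<^esub>"
        unfolding inv by (simp add: point_group_def)
      moreover have "P \<in> carrier (point_group E K)" "Q \<in> carrier (point_group E K)"
        using pts by (auto simp: point_group_def)
      ultimately show ?thesis using G.inv_equality[of P "inv\<^bsub>point_group E K\<^esub> Q"] by (metis G.inv_closed G.inv_inv)
    qed
  qed
  moreover have "r ` T \<subseteq> insert None (Some ` S)" using r by fastforce
  moreover have "finite S"
    by (rule finite_subset[of _ "{0..<int p} \<times> {0..<int p}"]) (auto simp: S_def)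
  then have "finite (insert None (Some ` S))" "card (insert None (Some ` S)) = Suc (card S)"
    by (auto simp: card_insert_if card_image)
  ultimately show "finite T" "card T \<le> Suc (card S)"
    using inj_on_finite[of r T] card_inj_on_le[of r T] by metis+
qed

end

subsection \<open>Existence of valuations\<close>

definition subring_avoiding :: "'a::field_char_0 \<Rightarrow> 'a set \<Rightarrow> bool" where
  "subring_avoiding a R \<longleftrightarrow> 1 \<in> R \<and> (\<forall>x\<in>R. \<forall>y\<in>R. x - y \<in> R \<and> x * y \<in> R) \<and> a \<notin> R"

definition adjoin :: "'a::field_char_0 set \<Rightarrow> 'a \<Rightarrow> 'a set" where
  "adjoin R x = {poly f x | f. \<forall>i. coeff f i \<in> R}"

text \<open>A subring that is maximal among those not containing \<open>1/p\<close> is a valuation ring.\<close>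

locale maximal_avoiding =
  fixes V :: "'a::field_char_0 set" and p :: nat
  assumes V: "subring_avoiding (inverse (of_nat p)) V"
    and maximal: "subring_avoiding (inverse (of_nat p)) R \<Longrightarrow> V \<subseteq> R \<Longrightarrow> R = V"
    and prime_p: "prime p"
begin

sublocale subring_set V
  by unfold_locales (use V in \<open>auto simp: subring_avoiding_def\<close>)

lemma inverse_p: "inverse (of_nat p) \<notin> V"
  using V unfolding subring_avoiding_def by auto

lemma inverse_p_in_adjoin:
  assumes "x \<notin> V"
  obtains f where "\<And>i. coeff f i \<in> V" "poly f x = inverse (of_nat p)"
proof -
  have "\<not> subring_avoiding (inverse (of_nat p)) (adjoin V x)"
  proof
    assume "subring_avoiding (inverse (of_nat p)) (adjoin V x)"
    moreover have "V \<subseteq> adjoin V x"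
    proof
      fix v assume "v \<in> V"
      then show "v \<in> adjoin V x" unfolding adjoin_def
        by (auto intro!: exI[of _ "[:v:]"] simp: coeff_pCons split: nat.splits)
    qed
    ultimately have "adjoin V x = V" using maximal by blast
    moreover have "x \<in> adjoin V x" unfolding adjoin_def
      by (auto intro!: exI[of _ "[:0, 1:]"] simp: coeff_pCons split: nat.splits)
    ultimately show False using assms by simp
  qed
  moreover have "1 \<in> adjoin V x" unfolding adjoin_def
    by (auto intro!: exI[of _ "1"])
  moreover have "a - b \<in> adjoin V x \<and> a * b \<in> adjoin V x" if ab: "a \<in> adjoin V x" "b \<in> adjoin V x" for a b
  proof -
    obtain f g where fg: "a = poly f x" "b = poly g x" "\<forall>i. coeff f i \<in> V" "\<forall>i. coeff g i \<in> V"
      using ab unfolding adjoin_def by blast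
    have "\<forall>i. coeff (f - g) i \<in> V" "\<forall>i. coeff (f * g) i \<in> V"
      using fg(3,4) by (auto simp: coeff_mult intro!: sum_V diff_V mult_V)
    then have "poly (f - g) x \<in> adjoin V x" "poly (f * g) x \<in> adjoin V x"
      unfolding adjoin_def by blast+
    then show ?thesis unfolding fg(1,2) by simp
  qed
  ultimately have "inverse (of_nat p) \<in> adjoin V x" unfolding subring_avoiding_def by blast
  then obtain f where "inverse (of_nat p) = poly f x" "\<forall>i. coeff f i \<in> V" unfolding adjoin_def by blast
  then show ?thesis using that[of f] by simp
qed

lemma power_times_poly_inverse:
  assumes "u \<in> V" "u \<noteq> 0" "\<And>i. coeff f i \<in> V"
  shows "u ^ degree f * poly f (inverse u) \<in> V"
proof -
  have "u ^ degree f * poly f (inverse u) = (\<Sum>i\<le>degree f. coeff f i * u ^ (degree f - i))"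
    unfolding poly_altdef sum_distrib_left
    using assms(2) by (intro sum.cong) (auto simp: power_diff field_simps)
  also have "\<dots> \<in> V" using assms by (auto intro!: sum_V mult_V power_V)
  finally show ?thesis .
qed

text \<open>This puts \<open>p\<close> into the Jacobson radical. If \<open>u = 1 - p g\<close> had
  no inverse in V, then \<open>1 / p\<close> would be a polynomial in \<open>1 / u\<close> over V,
  and some \<open>u^k / p\<close> would lie in V; but \<open>u^k\<close> is 1 modulo
  \<open>p\<close>.\<close>

lemma unit_one_minus_p:
  assumes "g \<in> V" shows "inverse (1 - of_nat p * g) \<in> V" "1 - of_nat p * g \<noteq> 0"
proof -
  define u where "u = 1 - of_nat p * g"
  have p0: "of_nat p \<noteq> (0::'a)" using prime_p by (auto simp: prime_gt_0_nat)
  show u0: "1 - of_nat p * g \<noteq> 0"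
  proof
    assume "1 - of_nat p * g = 0"
    then have "g = inverse (of_nat p)" using p0 by (simp add: field_simps)
    then show False using assms inverse_p by simp
  qed
  have uV: "u \<in> V" unfolding u_def using assms by (intro diff_V mult_V) auto
  have upow: "\<exists>h\<in>V. u ^ k = 1 - of_nat p * h" for k
  proof (induction k)
    case (Suc k)
    then obtain h where h: "h \<in> V" "u ^ k = 1 - of_nat p * h" by auto
    have "u ^ Suc k = u - of_nat p * (u * h)" by (simp add: h(2) algebra_simps)
    then have "u ^ Suc k = 1 - of_nat p * (g + u * h)" by (simp add: u_def algebra_simps)
    then show ?case using uV assms h(1)
      by (intro bexI[of _ "g + u * h"] add_V mult_V) auto
  qed (auto intro!: bexI[of _ 0])
  show "inverse (1 - of_nat p * g) \<in> V"
  proof (rule ccontr)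
    assume "inverse (1 - of_nat p * g) \<notin> V"
    then obtain f where f: "\<And>i. coeff f i \<in> V" "poly f (inverse u) = inverse (of_nat p)"
      using inverse_p_in_adjoin[of "inverse u"] unfolding u_def by auto
    have "u ^ degree f * inverse (of_nat p) \<in> V"
      using power_times_poly_inverse[OF uV _ f(1)] u0 unfolding u_def[symmetric] f(2) by simp
    moreover obtain h where h: "h \<in> V" "u ^ degree f = 1 - of_nat p * h" using upow by blast
    ultimately have "(1 - of_nat p * h) * inverse (of_nat p) + h \<in> V" using add_V by simp
    then show False using inverse_p p0 by (simp add: algebra_simps)
  qed
qed

text \<open>Chevalley's argument: after multiplication by \<open>p x^n\<close> the relation for
  \<open>1 / x\<close> has the unit \<open>u\<close> as coefficient of \<open>x^n\<close>. The
  polynomial \<open>r\<close> thus expresses \<open>x^n\<close> by lower powers and replaces the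
  leading term of \<open>f\<close>; \<open>m <= n\<close> keeps the exponents nonnegative.\<close>

lemma lower_degree:
  assumes x: "x \<noteq> 0" and m: "m \<le> n" "n > 0"
    and f: "\<And>i. coeff f i \<in> V" "degree f \<le> n" "poly f x = inverse (of_nat p)"
    and g: "\<And>i. coeff g i \<in> V" "degree g \<le> m" "poly g (inverse x) = inverse (of_nat p)"
  obtains h where "\<And>i. coeff h i \<in> V" "degree h \<le> n - 1" "poly h x = inverse (of_nat p)"
proof -
  have p0: "of_nat p \<noteq> (0::'a)" using prime_p by (auto simp: prime_gt_0_nat)
  define u where "u = 1 - of_nat p * coeff g 0"
  have u: "inverse u \<in> V" "u \<noteq> 0" using unit_one_minus_p g(1) unfolding u_def by auto
  define r where "r = (\<Sum>i=1..m. monom (of_nat p * inverse u * coeff g i) (n - i))"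
  have rV: "coeff r i \<in> V" for i
    unfolding r_def coeff_sum using g u by (auto intro!: sum_V mult_V)
  have rdeg: "coeff r i = 0" if "i \<ge> n" for i
    unfolding r_def coeff_sum using that m by (intro sum.neutral) auto
  have "poly g (inverse x) = (\<Sum>i\<le>m. coeff g i * inverse x ^ i)"
    unfolding poly_altdef using g(2) by (intro sum.mono_neutral_left) (auto simp: coeff_eq_0)
  also have "{..m} = insert 0 {1..m}" by auto
  also have "(\<Sum>i\<in>insert 0 {1..m}. coeff g i * inverse x ^ i) = coeff g 0 + (\<Sum>i=1..m. coeff g i * inverse x ^ i)"
    by (subst sum.insert) auto
  finally have S: "(\<Sum>i=1..m. coeff g i * inverse x ^ i) = inverse (of_nat p) - coeff g 0" using g(3) by (simp add: algebra_simps)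
  have "poly r x = (\<Sum>i=1..m. of_nat p * inverse u * coeff g i * x ^ (n - i))"
    unfolding r_def poly_sum poly_monom ..
  also have "\<dots> = (\<Sum>i=1..m. of_nat p * inverse u * x ^ n * (coeff g i * inverse x ^ i))"
    using x m by (intro sum.cong) (auto simp: power_diff field_simps)
  also have "\<dots> = of_nat p * inverse u * x ^ n * (inverse (of_nat p) - coeff g 0)"
    unfolding sum_distrib_left[symmetric] S ..
  also have "\<dots> = x ^ n * inverse u * u" unfolding u_def using p0 by (simp add: algebra_simps)
  finally have pr: "poly r x = x ^ n" using u by simp
  define h where "h = f - monom (coeff f n) n + smult (coeff f n) r"
  show ?thesis
  proof
    show "coeff h i \<in> V" for i unfolding h_def using f rV by (auto intro!: add_V diff_V mult_V)
    show "degree h \<le> n - 1"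
    proof (rule degree_le, safe)
      fix i assume i: "n - 1 < i"
      then have "i = n \<or> i > n" using m by auto
      then show "coeff h i = 0" unfolding h_def using rdeg[of i] f(2) by (auto simp: coeff_eq_0)
    qed
    show "poly h x = inverse (of_nat p)" unfolding h_def using f pr by (simp add: poly_monom)
  qed
qed

text \<open>Whichever degree bound is the larger can be lowered, \<open>x\<close> and
  \<open>1 / x\<close> playing symmetric roles, until a constant relation would put
  \<open>1 / p\<close> into V.\<close>

lemma no_two_relations:
  assumes "x \<noteq> 0"
    and "\<And>i. coeff f i \<in> V" "degree f \<le> n" "poly f x = inverse (of_nat p)"
    and "\<And>i. coeff g i \<in> V" "degree g \<le> m" "poly g (inverse x) = inverse (of_nat p)"
  shows False
  using assms
proof (induction "n + m" arbitrary: n m f g rule: less_induct)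
  case less
  have nz: "k > 0" if "\<And>i. coeff h i \<in> V" "degree h \<le> k" "poly h z = inverse (of_nat p)" for h k z
  proof (rule ccontr)
    assume "\<not> k > 0"
    then have "degree h = 0" using that by simp
    then obtain c where "h = [:c:]" by (rule degree_eq_zeroE)
    then show False using that(1)[of 0] that(3) inverse_p by simp
  qed
  have n: "n > 0" and m: "m > 0"
    using nz[OF less.prems(2-4)] nz[OF less.prems(5-7)] by auto
  show False
  proof (cases "m \<le> n")
    case True
    from lower_degree[OF less.prems(1) True n less.prems(2-7)]
    obtain h where h: "\<And>i. coeff h i \<in> V" "degree h \<le> n - 1" "poly h x = inverse (of_nat p)" by blast
    show False by (rule less.hyps[OF _ less.prems(1) h less.prems(5-7)]) (use n in simp)
  next
    case False
    then have nm: "n \<le> m" by simp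
    have x: "inverse x \<noteq> 0" "inverse (inverse x) = x" using less.prems(1) by auto
    have "poly f (inverse (inverse x)) = inverse (of_nat p)" using less.prems(4) by simp
    from lower_degree[OF x(1) nm m less.prems(5-7) less.prems(2,3) this]
    obtain h where h: "\<And>i. coeff h i \<in> V" "degree h \<le> m - 1" "poly h (inverse x) = inverse (of_nat p)"
      by blast
    show False by (rule less.hyps[OF _ less.prems(1) less.prems(2-4) h]) (use m in simp)
  qed
qed

lemma total_V: assumes "x \<notin> V" shows "inverse x \<in> V"
proof (rule ccontr)
  assume n: "inverse x \<notin> V"
  have "x \<noteq> 0" using assms by auto
  obtain f g where fg: "\<And>i. coeff f i \<in> V" "poly f x = inverse (of_nat p)"
    "\<And>i. coeff g i \<in> V" "poly g (inverse x) = inverse (of_nat p)"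
    using inverse_p_in_adjoin[OF assms] inverse_p_in_adjoin[OF n] by metis
  from no_two_relations[OF \<open>x \<noteq> 0\<close> fg(1) order.refl fg(2) fg(3) order.refl fg(4)] show False .
qed

text \<open>For \<open>x\<close> in V the polynomial shows \<open>c / x\<close> to be in V, with
  \<open>c\<close> its constant term. Writing \<open>c = p^k d\<close>, the integer \<open>d\<close>
  is invertible in V by Bezout and \<open>unit_one_minus_p\<close>, so \<open>p^k / x\<close> is in
  V.\<close>

lemma arch_of_int_root:
  assumes x: "x \<noteq> 0" and f: "\<And>i. coeff f i \<in> \<int>" "coeff f 0 \<noteq> 0" "poly f x = 0"
  shows "\<exists>n. of_nat p ^ n / x \<in> V"
proof (cases "x \<in> V")
  case True
  obtain c where c: "coeff f 0 = of_int c" using f(1)[of 0] by (auto elim: Ints_cases)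
  have c0: "c \<noteq> 0" using f c by auto
  define k where "k = multiplicity (int p) c"
  obtain d where d: "c = int p ^ k * d" using multiplicity_dvd[of "int p" c] unfolding k_def by (auto elim: dvdE)
  have "\<not> int p dvd d"
    using multiplicity_decompose'[of c "int p"] c0 prime_p d unfolding k_def
    by (metis mult_cancel_left not_prime_unit power_not_zero prime_nat_int_transfer int_eq_iff_numeral of_nat_eq_0_iff not_prime_0)
  then have "coprime (int p) d" using prime_p prime_imp_coprime[of "int p" d] by simp
  then obtain u v where "u * int p + v * d = 1" using coprime_iff_gcd_eq_1 bezout_int by metis
  then have "of_int (u * int p + v * d) = (1 :: 'a)" by simp
  then have uv: "of_int v * of_int d = 1 - of_nat p * (of_int u :: 'a)" by (simp add: algebra_simps)
  have "of_int v * inverse (1 - of_nat p * (of_int u :: 'a)) \<in> V"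
    using unit_one_minus_p(1)[of "of_int u"] by (intro mult_V) auto
  moreover have "of_int v * inverse (of_int v * of_int d) = inverse (of_int d :: 'a)"
    using unit_one_minus_p(2)[of "of_int u"] unfolding uv[symmetric] by (simp add: field_simps)
  ultimately have dV: "inverse (of_int d) \<in> V" unfolding uv by metis
  obtain a q where q: "f = pCons a q" by (cases f)
  have "coeff q i \<in> V" for i using f(1)[of "Suc i"] unfolding q by (auto elim: Ints_cases)
  then have "- poly q x * inverse (of_int d) \<in> V" using dV True by (intro mult_V uminus_V poly_V)
  also have "- poly q x = of_int c / x" using f(3) c x unfolding q by (simp add: field_simps add_eq_0_iff)
  also have "of_int c / x * inverse (of_int d) = of_nat p ^ k / x" using d c0 by auto
  finally show ?thesis by blast
next
  case False
  then show ?thesis using total_V by (intro exI[of _ 0]) (simp add: divide_inverse)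
qed

end

lemma algebraic_int_poly:
  assumes "algebraic x" "x \<noteq> (0::'a::field_char_0)"
  obtains f where "\<And>i. coeff f i \<in> \<int>" "coeff f 0 \<noteq> 0" "poly f x = 0"
proof -
  have "\<exists>f. (\<forall>i. coeff f i \<in> \<int>) \<and> coeff f 0 \<noteq> 0 \<and> poly f x = 0"
    if "q \<noteq> 0" "\<And>i. coeff q i \<in> \<int>" "poly q x = 0" for q :: "'a poly"
    using that
  proof (induction q)
    case (pCons a q)
    show ?case
    proof (cases "a = 0")
      case True
      then show ?thesis using pCons.IH pCons.prems(3) pCons.prems(2)[of "Suc _"] pCons.hyps assms(2) by auto
    next
      case False
      then show ?thesis using pCons.prems by (intro exI[of _ "pCons a q"]) auto
    qed
  qed auto
  then show ?thesis using assms(1) that by (metis algebraicE)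
qed

theorem p_valuation_exists:
  assumes p: "prime p" and alg: "\<And>x::'a::field_char_0. algebraic x"
  obtains V :: "'a::field_char_0 set" where "p_valuation V p"
proof -
  let ?S = "{R. subring_avoiding (inverse (of_nat p) :: 'a) R}"
  have Z: "\<int> \<in> ?S"
  proof -
    have "inverse (of_nat p) \<notin> (\<int> :: 'a set)"
    proof
      assume "inverse (of_nat p) \<in> (\<int> :: 'a set)"
      then obtain k where "inverse (of_nat p) = (of_int k :: 'a)" by (auto elim: Ints_cases)
      then have "of_int (k * int p) = (1 :: 'a)" using p by (simp flip: \<open>inverse _ = _\<close> add: prime_gt_0_nat)
      then have "k * int p = 1" by (metis of_int_1 of_int_eq_iff)
      then show False using p by (metis dvd_triv_right not_prime_unit prime_nat_int_transfer)
    qed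
    then show ?thesis by (auto simp: subring_avoiding_def)
  qed
  have "\<exists>M\<in>?S. \<forall>R\<in>?S. M \<subseteq> R \<longrightarrow> R = M"
  proof (rule subset_Zorn_nonempty)
    show "?S \<noteq> {}" using Z by blast
    fix C assume C: "C \<noteq> {}" "subset.chain ?S C"
    show "\<Union>C \<in> ?S"
      unfolding mem_Collect_eq subring_avoiding_def
    proof (intro conjI ballI)
      show "1 \<in> \<Union>C" "inverse (of_nat p) \<notin> \<Union>C"
        using C unfolding subset.chain_def subring_avoiding_def by auto
      fix x y assume "x \<in> \<Union>C" "y \<in> \<Union>C"
      then obtain R R' where R: "R \<in> C" "x \<in> R" "R' \<in> C" "y \<in> R'" by auto
      then have "R \<subseteq> R' \<or> R' \<subseteq> R" using C unfolding subset.chain_def by blast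
      then obtain Q where "Q \<in> C" "x \<in> Q" "y \<in> Q" using R by blast
      moreover then have "subring_avoiding (inverse (of_nat p)) Q" using C unfolding subset.chain_def by auto
      ultimately show "x - y \<in> \<Union>C" "x * y \<in> \<Union>C" unfolding subring_avoiding_def by blast+
    qed
  qed
  then obtain V where V: "subring_avoiding (inverse (of_nat p) :: 'a) V"
    "\<And>R. subring_avoiding (inverse (of_nat p)) R \<Longrightarrow> V \<subseteq> R \<Longrightarrow> R = V" by auto
  interpret maximal_avoiding V p by unfold_locales (use V p in auto)
  have "p_valuation V p"
  proof
    fix x :: 'a assume "x \<noteq> 0"
    then show "\<exists>n. of_nat p ^ n / x \<in> V" using algebraic_int_poly[OF alg, of x] arch_of_int_root by metis
  qed (use diff_V mult_V total_V p inverse_p in auto)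
  then show ?thesis using that by blast
qed

lemma to_ac_eq_of_rat: "to_ac q = of_rat q"
proof -
  obtain a b where ab: "quotient_of q = (a, b)" by (cases "quotient_of q")
  show ?thesis using quotient_of_div[OF ab] by (simp add: of_rat_divide)
qed

lemma range_to_ac: "range (to_ac :: rat \<Rightarrow> _) = \<rat>"
  unfolding Rats_def using to_ac_eq_of_rat by auto

lemma algebraic_rat_alg_closure: "algebraic (x :: rat alg_closure)"
proof -
  obtain p :: "rat poly" where "p \<noteq> 0" "poly (map_poly to_ac p) x = 0" by (rule alg_closure_algebraic)
  then show ?thesis unfolding algebraic_altdef
    by (intro exI[of _ "map_poly to_ac p"]) (auto simp: coeff_map_poly to_ac_eq_of_rat map_poly_eq_0_iff)
qed

subsection \<open>Sextic fields\<close>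

text \<open>A rational root of a monic integral polynomial is an integer and so has a residue modulo
  \<open>q\<close>: one congruence without solutions proves irreducibility for a whole residue class
  of parameters.\<close>

lemma Rats_monic_cubic_root_mod:
  fixes x :: "'a::field_char_0" and c0 c1 c2 q :: int
  assumes "x \<in> \<rat>" "x^3 + of_int c2 * x^2 + of_int c1 * x + of_int c0 = 0" "q > 0"
  shows "\<exists>r\<in>{0..<q}. q dvd r^3 + c2*r^2 + c1*r + c0"
proof -
  have "poly [:of_int c0, of_int c1, of_int c2, 1:] x = 0"
    using assms(2) by (simp add: ring_expand)
  then have "algebraic_int x"
    by (intro algebraic_int.intros[of "[:of_int c0, of_int c1, of_int c2, 1:]"])
      (auto simp: coeff_pCons split: nat.splits)
  then obtain k where k: "x = of_int k"
    using rational_algebraic_int_is_int assms(1) by (auto elim: Ints_cases)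
  have "of_int (k^3 + c2*k^2 + c1*k + c0) = (0 :: 'a)" using assms(2) k by simp
  then have k0: "k^3 + c2*k^2 + c1*k + c0 = 0" by (simp only: of_int_eq_0_iff)
  define r where "r = k mod q"
  have "q dvd r - k" unfolding r_def by (simp add: mod_eq_dvd_iff[symmetric])
  moreover have "r^3 + c2*r^2 + c1*r + c0 = (r - k) * (r^2 + r*k + k^2 + c2*(r + k) + c1) + (k^3 + c2*k^2 + c1*k + c0)"
    by (simp add: ring_expand)
  ultimately have "q dvd r^3 + c2*r^2 + c1*r + c0" unfolding k0 by simp
  then show ?thesis using assms(3) by (intro bexI[of _ r]) (auto simp: r_def)
qed

lemma Rats_square_root_mod:
  fixes x :: "'a::field_char_0" and d q :: int
  assumes "x \<in> \<rat>" "x^2 = of_int d" "q > 0"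
  shows "\<exists>r\<in>{0..<q}. q dvd r^2 - d"
proof -
  have "poly [:- of_int d, 0, 1:] x = 0"
    using assms(2) by (simp add: algebra_simps power2_eq_square)
  then have "algebraic_int x"
    by (intro algebraic_int.intros[of "[:- of_int d, 0, 1:]"])
      (auto simp: coeff_pCons split: nat.splits)
  then obtain k where k: "x = of_int k"
    using rational_algebraic_int_is_int assms(1) by (auto elim: Ints_cases)
  have "of_int (k^2 - d) = (0 :: 'a)" using assms(2) k by simp
  then have k0: "k^2 - d = 0" by (simp only: of_int_eq_0_iff)
  define r where "r = k mod q"
  have "q dvd r - k" unfolding r_def by (simp add: mod_eq_dvd_iff[symmetric])
  moreover have "r^2 - d = (r - k) * (r + k) + (k^2 - d)" by (simp add: algebra_simps power2_eq_square)
  ultimately have "q dvd r^2 - d" unfolding k0 by simp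
  then show ?thesis using assms(3) by (intro bexI[of _ r]) (auto simp: r_def)
qed

lemma subfield_ring_of_type_algebra:
  assumes "field_closed (K :: 'a::field set)"
  shows "subfield K ring_of_type_algebra"
proof -
  interpret R: field "ring_of_type_algebra :: 'a ring" by (rule field_from_type_algebra)
  have [simp]: "carrier (ring_of_type_algebra :: 'a ring) = UNIV" "\<one>\<^bsub>ring_of_type_algebra :: 'a ring\<^esub> = 1"
    "\<zero>\<^bsub>ring_of_type_algebra :: 'a ring\<^esub> = 0" "x \<otimes>\<^bsub>ring_of_type_algebra\<^esub> y = x * y"
    "x \<oplus>\<^bsub>ring_of_type_algebra\<^esub> y = x + y" for x y :: 'a
    by (simp_all add: ring_of_type_algebra_def)
  have neg: "\<ominus>\<^bsub>ring_of_type_algebra\<^esub> x = - x" for x :: 'a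
    by (rule R.minus_equality) simp_all
  have inv: "inv\<^bsub>ring_of_type_algebra\<^esub> x = inverse x" if "x \<noteq> 0" for x :: 'a
    by (rule R.inv_unique'[symmetric]) (use that in simp_all)
  show ?thesis
    by (intro R.subfieldI' R.subringI)
      (auto simp: neg inv intro: field_closedD[OF assms])
qed

lemma line_extension_ring_of_type_algebra:
  "ring.line_extension ring_of_type_algebra K a E = {k * a + v | k v. k \<in> K \<and> v \<in> E}"
  for K :: "'a::field set"
proof -
  interpret R: field "ring_of_type_algebra :: 'a ring" by (rule field_from_type_algebra)
  show ?thesis
    by (auto simp: R.line_extension_mem_iff) (auto simp: ring_of_type_algebra_def)
qed

lemma dimension_ring_of_type_algebra_Suc:
  fixes K :: "'a::field set"
  assumes "ring.dimension ring_of_type_algebra n K E" "v \<notin> E" "F = {k * v + w | k w. k \<in> K \<and> w \<in> E}"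
  shows "ring.dimension ring_of_type_algebra (Suc n) K F"
proof -
  interpret R: field "ring_of_type_algebra :: 'a ring" by (rule field_from_type_algebra)
  show ?thesis unfolding assms(3) line_extension_ring_of_type_algebra[symmetric]
    by (rule R.Suc_dim) (use assms in \<open>auto simp: ring_of_type_algebra_def\<close>)
qed

lemma dimension_ring_of_type_algebra_1:
  fixes K :: "'a::field set"
  assumes "field_closed K"
  shows "ring.dimension ring_of_type_algebra 1 K K"
proof -
  interpret R: field "ring_of_type_algebra :: 'a ring" by (rule field_from_type_algebra)
  show ?thesis using R.dimension_one[OF subfield_ring_of_type_algebra[OF assms]] .
qed

text \<open>The inverse is a polynomial in \<open>x\<close> over \<open>F\<close>.\<close>

lemma inverse_of_cubic_root:
  fixes x :: "'a::field"
  assumes "x^3 - s*x^2 + r*x - n = 0" and F: "field_closed F" "s \<in> F" "r \<in> F" "n \<in> F"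
    and R: "F \<subseteq> R" "\<And>a b. a \<in> R \<Longrightarrow> b \<in> R \<Longrightarrow> a - b \<in> R" "\<And>a b. a \<in> R \<Longrightarrow> b \<in> R \<Longrightarrow> a * b \<in> R" "x \<in> R"
  shows "inverse x \<in> R"
proof (cases "x = 0")
  case True
  then show ?thesis using F R field_closedD(2)[OF F(1)] by auto
next
  case x: False
  have sR: "s \<in> R" and rR: "r \<in> R" using F R by auto
  have n0R: "- r \<in> R" using field_closedD(4)[OF F(1,3)] R(1) by blast
  show ?thesis
  proof (cases "n = 0")
    case False
    have "inverse x = ((x - s) * x - (- r)) * inverse n"
      using assms(1) x False by (simp add: field_simps power2_eq_square power3_eq_cube)
    also have "\<dots> \<in> R"
      by (intro R(2-4) sR n0R subsetD[OF R(1) field_closedD(7)[OF F(1,4)]])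
    finally show ?thesis .
  next
    case n: True
    have "x * (x^2 - s*x + r) = 0" using assms(1) n by (simp add: ring_expand)
    then have q: "x^2 - s*x + r = 0" using x by simp
    show ?thesis
    proof (cases "r = 0")
      case False
      have "inverse x = (s - x) * inverse r"
        using q x False by (simp add: field_simps power2_eq_square)
      also have "\<dots> \<in> R"
        by (intro R(2-4) sR subsetD[OF R(1) field_closedD(7)[OF F(1,3)]])
      finally show ?thesis .
    next
      case True
      then have "x * (x - s) = 0" using q by (simp add: algebra_simps power2_eq_square)
      then have "x = s" using x by simp
      then show ?thesis using R(1) field_closedD(7)[OF F(1,2)] by blast
    qed
  qed
qed

text \<open>The characteristic polynomial of multiplication by \<open>x\<close>, with eigenvector
  \<open>(1, a, b)\<close>; combining the rows with the cofactors of the first column avoids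
  division. It gives each element of K a cubic equation over \<open>K2\<close>, from which its
  inverse is read off.\<close>

lemma cayley_hamilton3:
  fixes x :: "'a::comm_ring_1"
  assumes "m11 + m12*a + m13*b = x" "m21 + m22*a + m23*b = x*a" "m31 + m32*a + m33*b = x*b"
  shows "x^3 - (m11 + m22 + m33)*x^2 + (m11*m22 - m12*m21 + (m11*m33 - m13*m31) + (m22*m33 - m23*m32))*x
    - (m11*(m22*m33 - m23*m32) - m12*(m21*m33 - m23*m31) + m13*(m21*m32 - m22*m31)) = 0"
proof -
  have "x^3 - (m11 + m22 + m33)*x^2 + (m11*m22 - m12*m21 + (m11*m33 - m13*m31) + (m22*m33 - m23*m32))*x
    - (m11*(m22*m33 - m23*m32) - m12*(m21*m33 - m23*m31) + m13*(m21*m32 - m22*m31)) =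
    - (((m22 - x)*(m33 - x) - m23*m32) * (m11 + m12*a + m13*b - x)
     - (m12*(m33 - x) - m13*m32) * (m21 + m22*a + m23*b - x*a)
     + (m12*m23 - m13*(m22 - x)) * (m31 + m32*a + m33*b - x*b))"
    by (simp add: ring_expand)
  then show ?thesis using assms by simp
qed

locale sextic_field =
  fixes c2 c1 c0 d :: int and \<alpha> \<beta> :: "rat alg_closure"
  assumes \<alpha>: "\<alpha>^3 + of_int c2 * \<alpha>^2 + of_int c1 * \<alpha> + of_int c0 = 0"
    and \<beta>: "\<beta>^2 = of_int d"
    and no_root: "q \<in> \<rat> \<Longrightarrow> q^3 + of_int c2 * q^2 + of_int c1 * q + of_int c0 \<noteq> (0 :: rat alg_closure)"
    and no_sqrt: "q \<in> \<rat> \<Longrightarrow> q^2 \<noteq> (of_int d :: rat alg_closure)"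
begin

definition K2 :: "rat alg_closure set" where "K2 = {a + b*\<beta> | a b. a \<in> \<rat> \<and> b \<in> \<rat>}"
definition K :: "rat alg_closure set" where "K = {u + v*\<alpha> + w*\<alpha>^2 | u v w. u \<in> K2 \<and> v \<in> K2 \<and> w \<in> K2}"

abbreviation e2 :: "rat alg_closure" where "e2 \<equiv> of_int c2"
abbreviation e1 :: "rat alg_closure" where "e1 \<equiv> of_int c1"
abbreviation e0 :: "rat alg_closure" where "e0 \<equiv> of_int c0"

lemma field_closed_Rats: "field_closed (\<rat> :: 'a::field_char_0 set)"
  by (auto simp: field_closed_def)

lemma \<beta>_irrational: "\<beta> \<notin> \<rat>" using no_sqrt \<beta> by auto

lemma K2_independent:
  assumes "a \<in> \<rat>" "b \<in> \<rat>" "a + b*\<beta> = 0" shows "a = 0" "b = 0"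
proof -
  show "b = 0"
  proof (rule ccontr)
    assume "b \<noteq> 0"
    then have "\<beta> = - a / b" using assms(3) by (simp add: field_simps add_eq_0_iff)
    then show False using assms \<beta>_irrational by auto
  qed
  then show "a = 0" using assms by simp
qed

lemma K2I: "a \<in> \<rat> \<Longrightarrow> b \<in> \<rat> \<Longrightarrow> a + b*\<beta> \<in> K2" unfolding K2_def by blast
lemma Rats_K2: "\<rat> \<subseteq> K2" using K2I[of _ 0] by auto
lemma \<beta>_K2: "\<beta> \<in> K2" using K2I[of 0 1] by auto

lemma field_closed_K2: "field_closed K2"
  unfolding field_closed_def
proof (intro conjI ballI)
  show "1 \<in> K2" using Rats_K2 by auto
  fix x assume "x \<in> K2"
  then obtain a b where x: "x = a + b*\<beta>" "a \<in> \<rat>" "b \<in> \<rat>" unfolding K2_def by auto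
  show "inverse x \<in> K2"
  proof (cases "x = 0")
    case False
    define N where "N = a^2 - b^2 * of_int d"
    have N: "N = x * (a - b*\<beta>)" unfolding N_def x \<beta>[symmetric] by (simp add: algebra_simps power2_eq_square)
    have "a - b*\<beta> \<noteq> 0" using K2_independent[of a "- b"] x False by auto
    then have N0: "N \<noteq> 0" using N False by simp
    have "inverse x = (a - b*\<beta>) / N" using N N0 False by (simp add: field_simps)
    also have "\<dots> = a / N + (- b / N)*\<beta>" by (simp add: diff_divide_distrib)
    also have "\<dots> \<in> K2" using x unfolding N_def by (intro K2I) auto
    finally show ?thesis .
  qed (use Rats_K2 in auto)
  fix y assume "y \<in> K2"
  then obtain a' b' where y: "y = a' + b'*\<beta>" "a' \<in> \<rat>" "b' \<in> \<rat>" unfolding K2_def by auto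
  have "x - y = (a - a') + (b - b')*\<beta>" unfolding x y by (simp add: algebra_simps)
  also have "\<dots> \<in> K2" using x y by (intro K2I) auto
  finally show "x - y \<in> K2" .
  have "x * y = (a*a' + b*b'*of_int d) + (a*b' + b*a')*\<beta>"
    unfolding x y \<beta>[symmetric] by (simp add: algebra_simps power2_eq_square)
  also have "\<dots> \<in> K2" using x y by (intro K2I) auto
  finally show "x * y \<in> K2" .
qed

lemmas K2_simps = field_closedD[OF field_closed_K2]

text \<open>If \<open>a + b\<beta>\<close> were a root of the cubic, so would be its conjugate, and the third root would be
  rational.\<close>

lemma no_root_K2:
  assumes "z \<in> K2" shows "z^3 + e2*z^2 + e1*z + e0 \<noteq> 0"
proof
  assume 0: "z^3 + e2*z^2 + e1*z + e0 = 0"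
  obtain a b where z: "z = a + b*\<beta>" "a \<in> \<rat>" "b \<in> \<rat>" using assms unfolding K2_def by auto
  define D where "D = (of_int d :: rat alg_closure)"
  define U where "U = a^3 + 3*a*b^2*D + e2*(a^2 + b^2*D) + e1*a + e0"
  define W where "W = b*(3*a^2 + b^2*D + 2*e2*a + e1)"
  have "z^3 + e2*z^2 + e1*z + e0 = U + W*\<beta>"
    unfolding U_def W_def z D_def \<beta>[symmetric] by (simp add: ring_expand)
  moreover have "U \<in> \<rat>" "W \<in> \<rat>" unfolding U_def W_def D_def using z by auto
  ultimately have "U = 0" "W = 0" using K2_independent[of U W] 0 by auto
  have "b \<noteq> 0" using no_root[OF z(2)] 0 z by auto
  then have "3*a^2 + b^2*D + 2*e2*a + e1 = 0" using \<open>W = 0\<close> unfolding W_def by simp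
  then have t: "b^2*D = - (3*a^2 + 2*e2*a + e1)" by Groebner_Basis.algebra
  have "U = a^3 + 3*a*(b^2*D) + e2*(a^2 + b^2*D) + e1*a + e0" unfolding U_def by simp
  then have "(- e2 - 2*a)^3 + e2*(- e2 - 2*a)^2 + e1*(- e2 - 2*a) + e0 = U"
    unfolding t by (simp add: ring_expand)
  then show False using no_root[of "- e2 - 2*a"] z \<open>U = 0\<close> by auto
qed

lemma K_independent:
  assumes "u \<in> K2" "v \<in> K2" "w \<in> K2" "u + v*\<alpha> + w*\<alpha>^2 = 0" shows "w = 0" "v = 0" "u = 0"
proof -
  have \<alpha>n: "\<alpha> \<notin> K2" using no_root_K2 \<alpha> by auto
  show w: "w = 0"
  proof (rule ccontr)
    assume "w \<noteq> 0"
    define s where "s = - v / w"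
    define r where "r = - u / w"
    have sr: "s \<in> K2" "r \<in> K2" unfolding s_def r_def using assms by (auto intro!: K2_simps)
    have "w * \<alpha>^2 = w * (s*\<alpha> + r)" using assms(4) \<open>w \<noteq> 0\<close> unfolding s_def r_def by (simp add: field_simps add_eq_0_iff)
    then have a2: "\<alpha>^2 = s*\<alpha> + r" using \<open>w \<noteq> 0\<close> by simp
    have a3: "\<alpha>^3 = (s^2 + r)*\<alpha> + s*r"
    proof -
      have "\<alpha>^3 = \<alpha> * \<alpha>^2" by (simp add: power2_eq_square power3_eq_cube)
      also have "\<dots> = \<alpha> * (s*\<alpha> + r)" by (simp only: a2)
      also have "\<dots> = s*\<alpha>^2 + r*\<alpha>" by (simp add: algebra_simps power2_eq_square)
      also have "\<dots> = s*(s*\<alpha> + r) + r*\<alpha>" by (simp only: a2)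
      finally show ?thesis by (simp add: algebra_simps power2_eq_square)
    qed
    \<comment> \<open>\<open>g x + h\<close> is the remainder of the cubic modulo
      \<open>x^2 - s x - r\<close>, with quotient \<open>x + e2 + s\<close>. Once it vanishes,
      \<open>- (e2 + s)\<close> is a root in \<open>K2\<close>.\<close>
    define g where "g = s^2 + r + e2*s + e1"
    define h where "h = s*r + e2*r + e0"
    have gh: "g \<in> K2" "h \<in> K2" unfolding g_def h_def using sr by (auto intro!: K2_simps)
    have "g*\<alpha> + h = 0" using \<alpha> unfolding a2 a3 g_def h_def by (simp add: algebra_simps)
    have g0: "g = 0"
    proof (rule ccontr)
      assume "g \<noteq> 0"
      then have "\<alpha> = - h / g" using \<open>g*\<alpha> + h = 0\<close> by (simp add: field_simps add_eq_0_iff)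
      then show False using \<alpha>n gh K2_simps by metis
    qed
    then have h0: "h = 0" using \<open>g*\<alpha> + h = 0\<close> by simp
    have "(- (e2 + s))^3 + e2*(- (e2 + s))^2 + e1*(- (e2 + s)) + e0 = h - (e2 + s)*g"
      unfolding g_def h_def by (simp add: ring_expand)
    moreover have "- (e2 + s) \<in> K2" using sr by (auto intro!: K2_simps)
    ultimately show False using no_root_K2[of "- (e2 + s)"] g0 h0 by simp
  qed
  show v: "v = 0"
  proof (rule ccontr)
    assume "v \<noteq> 0"
    then have "\<alpha> = - u / v" using assms(4) w by (simp add: field_simps add_eq_0_iff)
    then show False using \<alpha>n assms K2_simps by metis
  qed
  show "u = 0" using assms(4) v w by simp
qed

lemma KI: "u \<in> K2 \<Longrightarrow> v \<in> K2 \<Longrightarrow> w \<in> K2 \<Longrightarrow> u + v*\<alpha> + w*\<alpha>^2 \<in> K" unfolding K_def by blast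
lemma K2_K: "K2 \<subseteq> K" using KI[of _ 0 0] K2_simps(2) by auto
lemma \<beta>_K: "\<beta> \<in> K" using \<beta>_K2 K2_K by auto
lemma \<alpha>_K: "\<alpha> \<in> K" using KI[of 0 1 0] K2_simps(1,2) by auto

lemma \<alpha>3: "\<alpha>^3 = - e2*\<alpha>^2 - e1*\<alpha> - e0"
  using \<alpha> by Groebner_Basis.algebra

lemma mult_\<alpha>: "(u + v*\<alpha> + w*\<alpha>^2) * \<alpha> = - (w*e0) + (u - w*e1)*\<alpha> + (v - w*e2)*\<alpha>^2"
proof -
  have "(u + v*\<alpha> + w*\<alpha>^2) * \<alpha> = u*\<alpha> + v*\<alpha>^2 + w*\<alpha>^3" by (simp add: ring_expand)
  then show ?thesis unfolding \<alpha>3 by (simp add: algebra_simps)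
qed

lemma mult_\<alpha>_K: "x \<in> K \<Longrightarrow> x * \<alpha> \<in> K"
proof -
  assume "x \<in> K"
  then obtain u v w where x: "x = u + v*\<alpha> + w*\<alpha>^2" "u \<in> K2" "v \<in> K2" "w \<in> K2" unfolding K_def by auto
  show ?thesis unfolding x mult_\<alpha> using x by (intro KI K2_simps) auto
qed

lemma diff_K: "x \<in> K \<Longrightarrow> y \<in> K \<Longrightarrow> x - y \<in> K"
proof -
  assume "x \<in> K" "y \<in> K"
  then obtain u v w u' v' w' where x: "x = u + v*\<alpha> + w*\<alpha>^2" "u \<in> K2" "v \<in> K2" "w \<in> K2"
     "y = u' + v'*\<alpha> + w'*\<alpha>^2" "u' \<in> K2" "v' \<in> K2" "w' \<in> K2" unfolding K_def by auto
  have "x - y = (u - u') + (v - v')*\<alpha> + (w - w')*\<alpha>^2" unfolding x by (simp add: algebra_simps)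
  also have "\<dots> \<in> K" using x by (intro KI K2_simps) auto
  finally show ?thesis .
qed

lemma smult_K: "k \<in> K2 \<Longrightarrow> x \<in> K \<Longrightarrow> k * x \<in> K"
proof -
  assume k: "k \<in> K2" "x \<in> K"
  then obtain u v w where x: "x = u + v*\<alpha> + w*\<alpha>^2" "u \<in> K2" "v \<in> K2" "w \<in> K2" unfolding K_def by auto
  have "k * x = (k*u) + (k*v)*\<alpha> + (k*w)*\<alpha>^2" unfolding x by (simp add: algebra_simps)
  also have "\<dots> \<in> K" using x k by (intro KI K2_simps) auto
  finally show ?thesis .
qed

lemma mult_K: assumes "x \<in> K" "y \<in> K" shows "x * y \<in> K"
proof -
  obtain u v w where x: "x = u + v*\<alpha> + w*\<alpha>^2" "u \<in> K2" "v \<in> K2" "w \<in> K2" using assms unfolding K_def by auto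
  have "x * y = u*y - (- v)*(y*\<alpha>) - (- w)*(y*\<alpha>*\<alpha>)" unfolding x by (simp add: algebra_simps power2_eq_square)
  also have "\<dots> \<in> K" using x assms by (intro diff_K smult_K mult_\<alpha>_K K2_simps) auto
  finally show ?thesis .
qed

lemma field_closed_K: "field_closed K"
  unfolding field_closed_def
proof (intro conjI ballI)
  show "1 \<in> K" using K2_K K2_simps(1) by auto
  fix x assume xK: "x \<in> K"
  then obtain u v w where x: "x = u + v*\<alpha> + w*\<alpha>^2" "u \<in> K2" "v \<in> K2" "w \<in> K2" unfolding K_def by auto
  \<comment> \<open>Coordinates of \<open>x \<alpha>\<close>, then of \<open>x \<alpha>^2\<close>:
    the remaining rows of the matrix of multiplication by \<open>x\<close>.\<close>
  define u1 v1 w1 where 1: "u1 = - (w*e0)" "v1 = u - w*e1" "w1 = v - w*e2"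
  define u2 v2 w2 where 2: "u2 = - (w1*e0)" "v2 = u1 - w1*e1" "w2 = v1 - w1*e2"
  have k1: "u1 \<in> K2" "v1 \<in> K2" "w1 \<in> K2" unfolding 1 using x by (auto intro!: K2_simps)
  have k2: "u2 \<in> K2" "v2 \<in> K2" "w2 \<in> K2" unfolding 2 using k1 by (auto intro!: K2_simps)
  have xa: "u1 + v1*\<alpha> + w1*\<alpha>^2 = x * \<alpha>" using mult_\<alpha>[of u v w] unfolding x 1 by simp
  have "u2 + v2*\<alpha> + w2*\<alpha>^2 = (x * \<alpha>) * \<alpha>" using mult_\<alpha>[of u1 v1 w1] unfolding xa 2 by simp
  then have xaa: "u2 + v2*\<alpha> + w2*\<alpha>^2 = x * \<alpha>^2" by (simp add: power2_eq_square algebra_simps)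
  show "inverse x \<in> K"
    by (rule inverse_of_cubic_root[OF cayley_hamilton3[OF x(1)[symmetric] xa xaa] field_closed_K2 _ _ _ K2_K diff_K mult_K xK])
      (use x k1 k2 in \<open>auto intro!: K2_simps\<close>)
qed (auto intro: diff_K mult_K)

lemma number_field_K: "number_field_of_degree 6 K"
  unfolding number_field_of_degree_def range_to_ac
proof
  show sK: "subfield K ring_of_type_algebra" by (rule subfield_ring_of_type_algebra[OF field_closed_K])
  interpret R: field "ring_of_type_algebra :: rat alg_closure ring" by (rule field_from_type_algebra)
  have d2: "R.dimension 2 \<rat> K2"
    unfolding numeral_2_eq_2
    by (rule dimension_ring_of_type_algebra_Suc[OF dimension_ring_of_type_algebra_1[OF field_closed_Rats, unfolded One_nat_def] \<beta>_irrational])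
      (auto simp: K2_def add.commute)
  have \<alpha>n: "\<alpha> \<notin> K2" using no_root_K2 \<alpha> by auto
  have d3: "R.dimension (Suc (Suc 1)) K2 K"
  proof (rule dimension_ring_of_type_algebra_Suc[OF dimension_ring_of_type_algebra_Suc[OF dimension_ring_of_type_algebra_1[OF field_closed_K2] \<alpha>n refl]])
    show "\<alpha>^2 \<notin> {k * \<alpha> + w |k w. k \<in> K2 \<and> w \<in> K2}"
    proof
      assume "\<alpha>^2 \<in> {k * \<alpha> + w |k w. k \<in> K2 \<and> w \<in> K2}"
      then obtain k w where "\<alpha>^2 = k * \<alpha> + w" "k \<in> K2" "w \<in> K2" by auto
      then show False using K_independent(1)[of "- w" "- k" 1] K2_simps by simp
    qed
    show "K = {k * \<alpha>\<^sup>2 + w |k w. k \<in> K2 \<and> w \<in> {k * \<alpha> + w |k w. k \<in> K2 \<and> w \<in> K2}}"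
      unfolding K_def by (auto simp: add_ac) (metis add.assoc add.commute)+
  qed
  from R.telescopic_base[OF subfield_ring_of_type_algebra[OF field_closed_Rats] subfield_ring_of_type_algebra[OF field_closed_K2] d2 d3]
  show "R.dimension 6 \<rat> K" by (simp add: numeral_eq_Suc)
qed

lemma K_subset: 
  assumes "field_closed F" "\<rat> \<subseteq> F" "\<alpha> \<in> F" "\<beta> \<in> F" shows "K \<subseteq> F"
proof -
  have "K2 \<subseteq> F" unfolding K2_def using assms(2,4) by (auto intro!: field_closedD[OF assms(1)])
  then show ?thesis unfolding K_def using assms(3) by (auto intro!: field_closedD[OF assms(1)])
qed

end

subsection \<open>Isomorphism invariants and families\<close>

definition disc3 :: "'a::comm_ring_1 \<Rightarrow> 'a \<Rightarrow> 'a \<Rightarrow> 'a" where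
  "disc3 a b c = a^2*b^2 - 4*b^3 - 4*a^3*c - 27*c^2 + 18*a*b*c"

lemma discriminant_disc3: "discriminant (Weierstrass 0 a 0 b c) = 16 * disc3 a b c"
  unfolding discriminant_def disc3_def by (simp add: Let_def ring_expand)

text \<open>Equality of the j-invariants \<open>256 (a^2 - 3 b)^3 / disc3 a b c\<close>, cleared of
  denominators: a change of variables scales \<open>a^2 - 3 b\<close> by \<open>u^4\<close> and the
  discriminant by \<open>u^12\<close>.\<close>

lemma isomorphic_curves_invariants:
  assumes "isomorphic_curves (Weierstrass 0 a 0 b c) (Weierstrass 0 a' 0 b' c')"
  shows "(a^2 - 3*b)^3 * disc3 a' b' c' = (a'^2 - 3*b')^3 * disc3 a b (c :: 'a::{alg_closed_field,field_char_0})"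
proof -
  obtain u r s t where u: "u \<noteq> 0" and H: "\<And>x y. (u^3*y + s*u^2*x + t)^2 - ((u^2*x + r)^3 + a*(u^2*x + r)^2 + b*(u^2*x + r) + c)
     = u^6 * (y^2 - (x^3 + a'*x^2 + b'*x + c'))"
    using assms unfolding isomorphic_curves_def weierstrass_eval_def by auto
  \<comment> \<open>\<open>y = 1\<close> and \<open>y = -1\<close> give the same right-hand side, so
    the term linear in \<open>y\<close> on the left vanishes for every \<open>x\<close>.\<close>
  have "4 * (u^3 * (s*u^2*x + t)) = 0" for x
  proof -
    let ?R = "(u^2*x + r)^3 + a*(u^2*x + r)^2 + b*(u^2*x + r) + c"
    have "(u^3*1 + s*u^2*x + t)^2 - ?R = (u^3*(-1) + s*u^2*x + t)^2 - ?R"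
      unfolding H by simp
    then have "(u^3*1 + s*u^2*x + t)^2 = (u^3*(-1) + s*u^2*x + t)^2" by (metis diff_add_cancel)
    then show ?thesis by (simp add: algebra_simps power2_eq_square)
  qed
  then have st: "s*u^2*x + t = 0" for x using u by simp
  then have t: "t = 0" using st[of 0] by simp
  then have s: "s = 0" using st[of 1] u by simp
  have G: "(u^2*x + r)^3 + a*(u^2*x + r)^2 + b*(u^2*x + r) + c = u^6 * (x^3 + a'*x^2 + b'*x + c')" for x
    using H[where y = 0 and x = x] s t by (simp add: algebra_simps)
  have c0: "r^3 + a*r^2 + b*r + c = u^6*c'" using G[of 0] by simp
  have u6: "u^6 = u^4 * u^2" "u^6 = u^2 * u^4" by (simp_all flip: power_add)
  have "2 * (u^4 * (3*r + a)) = 2 * (u^6 * a')"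
    using G[of 1] G[of "-1"] c0 by simp Groebner_Basis.algebra
  then have "u^4 * (3*r + a) = u^6 * a'" by simp
  also have "\<dots> = u^4 * (u^2 * a')" by (simp only: u6(1) mult.assoc)
  finally have "u^4 * (3*r + a) = u^4 * (u^2 * a')" .
  then have a2: "3*r + a = u^2 * a'" by (rule mult_left_cancel[THEN iffD1, rotated]) (use u in simp)
  have "2 * (u^2 * (3*r^2 + 2*a*r + b)) = 2 * (u^6 * b')"
    using G[of 1] G[of "-1"] c0 by simp Groebner_Basis.algebra
  then have "u^2 * (3*r^2 + 2*a*r + b) = u^6 * b'" by simp
  also have "\<dots> = u^2 * (u^4 * b')" by (simp only: u6(2) mult.assoc)
  finally have "u^2 * (3*r^2 + 2*a*r + b) = u^2 * (u^4 * b')" .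
  then have a4: "3*r^2 + 2*a*r + b = u^4 * b'" by (rule mult_left_cancel[THEN iffD1, rotated]) (use u in simp)
  have c4: "a^2 - 3*b = u^4 * (a'^2 - 3*b')"
  proof -
    have "a^2 - 3*b = (3*r + a)^2 - 3*(3*r^2 + 2*a*r + b)" by (simp add: algebra_simps power2_eq_square)
    also have "\<dots> = u^4 * (a'^2 - 3*b')" unfolding a2 a4 by (simp add: algebra_simps power_numeral_reduce)
    finally show ?thesis .
  qed
  have D: "disc3 a b c = u^12 * disc3 a' b' c'"
  proof -
    have "disc3 a b c = disc3 (3*r + a) (3*r^2 + 2*a*r + b) (r^3 + a*r^2 + b*r + c)"
      unfolding disc3_def by (simp add: algebra_simps power_numeral_reduce)
    also have "\<dots> = u^12 * disc3 a' b' c'" unfolding a2 a4 c0 disc3_def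
      by (simp add: algebra_simps power_numeral_reduce)
    finally show ?thesis .
  qed
  have "(u^4 * (a'^2 - 3*b'))^3 = u^12 * (a'^2 - 3*b')^3" by (simp add: power_mult_distrib flip: power_mult)
  then show ?thesis unfolding c4 D by simp
qed

section \<open>Families with polynomial coefficients\<close>

definition polyfun :: "(int \<Rightarrow> int) \<Rightarrow> bool" where
  "polyfun f \<longleftrightarrow> (\<exists>P. \<forall>t. f t = poly P t)"

lemma polyfun_intros:
  "polyfun (\<lambda>t. t)" "polyfun (\<lambda>t. k)" 
  "polyfun f \<Longrightarrow> polyfun g \<Longrightarrow> polyfun (\<lambda>t. f t + g t)"
  "polyfun f \<Longrightarrow> polyfun g \<Longrightarrow> polyfun (\<lambda>t. f t - g t)"
  "polyfun f \<Longrightarrow> polyfun g \<Longrightarrow> polyfun (\<lambda>t. f t * g t)"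
  "polyfun f \<Longrightarrow> polyfun (\<lambda>t. - f t)"
  "polyfun f \<Longrightarrow> polyfun (\<lambda>t. f t ^ n)"
proof -
  show "polyfun (\<lambda>t. t)" unfolding polyfun_def by (intro exI[of _ "[:0, 1:]"]) simp
  show "polyfun (\<lambda>t. k)" unfolding polyfun_def by (intro exI[of _ "[:k:]"]) simp
  show "polyfun f \<Longrightarrow> polyfun g \<Longrightarrow> polyfun (\<lambda>t. f t + g t)" unfolding polyfun_def by (metis poly_add)
  show "polyfun f \<Longrightarrow> polyfun g \<Longrightarrow> polyfun (\<lambda>t. f t - g t)" unfolding polyfun_def by (metis poly_diff)
  show "polyfun f \<Longrightarrow> polyfun g \<Longrightarrow> polyfun (\<lambda>t. f t * g t)" unfolding polyfun_def by (metis poly_mult)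
  show "polyfun f \<Longrightarrow> polyfun (\<lambda>t. - f t)" unfolding polyfun_def by (metis poly_minus)
  show "polyfun f \<Longrightarrow> polyfun (\<lambda>t. f t ^ n)" unfolding polyfun_def by (metis poly_power)
qed

lemma polyfun_finite_zeros:
  assumes "polyfun f" "f t0 \<noteq> 0" shows "finite {t. f t = 0}"
proof -
  obtain P where P: "\<And>t. f t = poly P t" using assms(1) unfolding polyfun_def by auto
  then have "P \<noteq> 0" using assms(2) by auto
  then show ?thesis using poly_roots_finite P by simp
qed

text \<open>The curve degenerates at \<open>\<tau>\<close> to a node, so the \<open>j\<close>-invariant has a pole there and is not constant.\<close>

lemma infinite_nonisomorphic_family:
  fixes a b c :: "int \<Rightarrow> int"
  assumes pf: "polyfun a" "polyfun b" "polyfun c"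
    and cusp: "disc3 (a \<tau>) (b \<tau>) (c \<tau>) = 0" "a \<tau> ^ 2 - 3 * b \<tau> \<noteq> 0"
    and T: "infinite T" "\<And>t. t \<in> T \<Longrightarrow> disc3 (a t) (b t) (c t) \<noteq> 0"
    and Q: "\<And>t. t \<in> T \<Longrightarrow> Q (Weierstrass 0 (of_int (a t)) 0 (of_int (b t)) (of_int (c t)) :: rat weierstrass)"
  shows "\<exists>S :: rat weierstrass set. infinite S \<and> (\<forall>E\<in>S. elliptic_curve E) \<and>
    (\<forall>E \<in> S. \<forall>E' \<in> S. E \<noteq> E' \<longrightarrow> \<not> isomorphic_curves (base_change E) (base_change E')) \<and> (\<forall>E\<in>S. Q E)"
proof -
  define W where "W t = (Weierstrass 0 (of_int (a t)) 0 (of_int (b t)) (of_int (c t)) :: rat weierstrass)" for t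
  define j where "j E = ((coeff_a2 E)^2 - 3 * coeff_a4 E)^3 / disc3 (coeff_a2 E) (coeff_a4 E) (coeff_a6 E)" for E :: "rat weierstrass"
  define c4 where "c4 t = (a t)^2 - 3 * b t" for t
  define D where "D t = disc3 (a t) (b t) (c t)" for t
  have D_of_int: "disc3 (of_int (a t)) (of_int (b t)) (of_int (c t)) = (of_int (D t) :: 'a::comm_ring_1)" for t
    unfolding D_def disc3_def by simp
  have jW: "j (W t) = of_int (c4 t ^ 3) / of_int (D t)" for t
    unfolding j_def W_def by (simp add: D_of_int c4_def)
  have pf': "polyfun c4" "polyfun D"
    unfolding c4_def D_def disc3_def by (intro polyfun_intros pf)+
  have fib: "finite {t' \<in> T. j (W t') = j (W t)}" if t: "t \<in> T" for t
  proof -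
    have sub: "{t' \<in> T. j (W t') = j (W t)} \<subseteq> {t'. c4 t' ^ 3 * D t - c4 t ^ 3 * D t' = 0}"
    proof clarify
      fix t' assume t': "t' \<in> T" "j (W t') = j (W t)"
      have "D t \<noteq> 0" "D t' \<noteq> 0" using T(2) t t' unfolding D_def by auto
      then have "of_int (c4 t' ^ 3 * D t) = (of_int (c4 t ^ 3 * D t') :: rat)"
        using t'(2) unfolding jW by (simp add: field_simps)
      then show "c4 t' ^ 3 * D t - c4 t ^ 3 * D t' = 0" by (simp only: of_int_eq_iff)
    qed
    have pol: "polyfun (\<lambda>t'. c4 t' ^ 3 * D t - c4 t ^ 3 * D t')" by (intro polyfun_intros pf')
    \<comment> \<open>At \<open>\<tau>\<close> the second product vanishes and the first does not,
      so the polynomial in \<open>t'\<close> that annihilates all parameters with the same j is not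
      zero.\<close>
    have nz: "c4 \<tau> ^ 3 * D t - c4 t ^ 3 * D \<tau> \<noteq> 0"
      using cusp T(2)[OF t] unfolding c4_def D_def by simp
    show ?thesis by (rule finite_subset[OF sub polyfun_finite_zeros[OF pol nz]])
  qed
  have "infinite ((\<lambda>t. j (W t)) ` T)"
  proof
    assume "finite ((\<lambda>t. j (W t)) ` T)"
    then obtain t where "t \<in> T" "infinite {t' \<in> T. j (W t') = j (W t)}"
      using pigeonhole_infinite[OF T(1)] by auto
    then show False using fib by blast
  qed
  moreover define J where "J = (\<lambda>t. j (W t)) ` T"
  \<comment> \<open>Distinct parameters may give isomorphic curves, so one parameter is selected for
    each value of the invariant.\<close>
  moreover define \<sigma> where "\<sigma> = inv_into T (\<lambda>t. j (W t))"
  ultimately have J: "infinite J" "\<And>v. v \<in> J \<Longrightarrow> \<sigma> v \<in> T" "\<And>v. v \<in> J \<Longrightarrow> j (W (\<sigma> v)) = v"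
    using f_inv_into_f[of _ "\<lambda>t. j (W t)" T] by (auto simp: inv_into_into)
  let ?S = "(\<lambda>v. W (\<sigma> v)) ` J"
  have "infinite ?S"
  proof -
    have "inj_on (\<lambda>v. W (\<sigma> v)) J" by (rule inj_on_inverseI[where g = j]) (rule J(3))
    then show ?thesis using J(1) finite_imageD by blast
  qed
  moreover have "\<forall>E\<in>?S. elliptic_curve E"
    using J(2) T(2) by (auto simp: elliptic_curve_def W_def discriminant_disc3 D_of_int D_def)
  moreover have "\<forall>E\<in>?S. Q E" using J(2) Q unfolding W_def by auto
  moreover have "\<forall>E \<in> ?S. \<forall>E' \<in> ?S. E \<noteq> E' \<longrightarrow> \<not> isomorphic_curves (base_change E) (base_change E')"
  proof clarify
    fix v v' assume v: "v \<in> J" "v' \<in> J" and ne: "W (\<sigma> v) \<noteq> W (\<sigma> v')"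
      and iso: "isomorphic_curves (base_change (W (\<sigma> v))) (base_change (W (\<sigma> v')))"
    have "of_int (c4 (\<sigma> v))^3 * of_int (D (\<sigma> v')) = (of_int (c4 (\<sigma> v'))^3 * of_int (D (\<sigma> v)) :: rat alg_closure)"
      using isomorphic_curves_invariants[of "of_int (a (\<sigma> v))" "of_int (b (\<sigma> v))" "of_int (c (\<sigma> v))" "of_int (a (\<sigma> v'))" "of_int (b (\<sigma> v'))" "of_int (c (\<sigma> v'))"] iso
      unfolding W_def base_change_def D_of_int by (simp add: c4_def)
    then have "of_int (c4 (\<sigma> v)^3 * D (\<sigma> v')) = (of_int (c4 (\<sigma> v')^3 * D (\<sigma> v)) :: rat alg_closure)" by simp
    then have *: "c4 (\<sigma> v)^3 * D (\<sigma> v') = c4 (\<sigma> v')^3 * D (\<sigma> v)" by (simp only: of_int_eq_iff)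
    have "D (\<sigma> v) \<noteq> 0" "D (\<sigma> v') \<noteq> 0" using T(2) J(2) v unfolding D_def by auto
    then have "j (W (\<sigma> v)) = j (W (\<sigma> v'))" unfolding jW
      using arg_cong[OF *, of "of_int :: int \<Rightarrow> rat"] by (simp add: field_simps)
    then have "v = v'" using J(3) v by metis
    then show False using ne by simp
  qed
  ultimately show ?thesis by blast
qed

section \<open>Roots in \<open>Qp\<close> and the torsion bound\<close>

lemma power_mod_cong: "a mod c = b mod c \<Longrightarrow> a ^ n mod c = b ^ n mod (c :: int)"
  by (metis power_mod)

lemmas int_mod_cong = mod_add_cong mod_diff_cong mod_mult_cong power_mod_cong mod_minus_cong

text \<open>Hensel's lemma at a simple root \<open>r\<close> modulo \<open>p\<close>:
  \<open>?h q\<close> is the difference quotient of the cubic between \<open>q\<close> and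
  \<open>\<alpha>\<close>, congruent to the derivative at \<open>r\<close>.\<close>

lemma (in p_valuation) Qp_cubic_root:
  fixes \<alpha> :: 'a and c2 c1 c0 r :: int
  assumes root: "\<alpha>^3 + of_int c2 * \<alpha>^2 + of_int c1 * \<alpha> + of_int c0 = 0"
    and r: "\<alpha> - of_int r \<in> M" "\<not> int p dvd 3*r^2 + 2*c2*r + c1"
  shows "\<alpha> \<in> Qp"
proof (rule hensel_Qp)
  let ?F = "\<lambda>q. q^3 + of_int c2 * q^2 + of_int c1 * q + of_int c0"
  let ?h = "\<lambda>q. q^2 + q*\<alpha> + \<alpha>^2 + of_int c2*(q + \<alpha>) + of_int c1"
  show "of_int (3*r^2 + 2*c2*r + c1) \<notin> M" using r of_int_M_iff by blast
  show "?F q = (q - \<alpha>) * ?h q" for q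
  proof -
    have "?F q - ?F \<alpha> = (q - \<alpha>) * ?h q" by (simp add: ring_expand)
    then show ?thesis using root by simp
  qed
  fix q assume q: "q \<in> V" "q - \<alpha> \<in> M"
  have \<alpha>V: "\<alpha> \<in> V" using add_V[OF M_V[OF r(1)], of "of_int r"] by simp
  have qr: "q - of_int r \<in> M" using add_M[OF q(2) r(1)] by simp
  have "?h q - of_int (3*r^2 + 2*c2*r + c1) = (q - of_int r) * (q + of_int r + \<alpha> + of_int c2)
       + (\<alpha> - of_int r) * (of_int r + \<alpha> + of_int r + of_int c2)"
    by (simp add: algebra_simps power2_eq_square)
  also have "\<dots> \<in> M" by (rule add_M[OF mult_M[OF qr] mult_M[OF r(1)]]) (use q \<alpha>V in \<open>auto intro!: V_intros\<close>)
  finally show "?h q - of_int (3*r^2 + 2*c2*r + c1) \<in> M" .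
qed (use r in \<open>auto simp del: of_int_add of_int_mult\<close>)

lemma (in p_valuation) Qp_square_root:
  fixes \<beta> :: 'a and d s :: int
  assumes "\<beta>^2 = of_int d" "\<beta> - of_int s \<in> M" "\<not> int p dvd 2*s"
  shows "\<beta> \<in> Qp"
proof (rule hensel_Qp)
  show "of_int (2*s) \<notin> M" using assms of_int_M_iff by blast
  show "q^2 - of_int d = (q - \<beta>) * (q + \<beta>)" for q
    unfolding assms(1)[symmetric] by (simp add: algebra_simps power2_eq_square)
  fix q assume q: "q \<in> V" "q - \<beta> \<in> M"
  have "q + \<beta> - of_int (2*s) = (q - \<beta>) + (\<beta> - of_int s) + (\<beta> - of_int s)" by simp
  also have "\<dots> \<in> M" using q assms by (intro add_M)
  finally show "q + \<beta> - of_int (2*s) \<in> M" .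
qed (use assms in \<open>auto simp del: of_int_mult\<close>)

text \<open>All three roots are needed because the root used later must lie in a prescribed residue
  class; an arbitrary one could reduce to an element outside the prime field.\<close>

lemma alg_closed_cubic_splits:
  fixes a b c :: "'a::alg_closed_field"
  obtains x1 x2 x3 where "\<And>x. x^3 + a*x^2 + b*x + c = (x - x1)*(x - x2)*(x - x3)"
proof -
  obtain x1 where "poly [:c, b, a, 1:] x1 = 0" using alg_closed_imp_poly_has_root[of "[:c, b, a, 1:]"] by auto
  then have x1: "c = - (x1^3 + a*x1^2 + b*x1)" by (simp add: ring_expand add_eq_0_iff)
  define e where "e = a + x1"
  define g where "g = b + e*x1"
  obtain x2 where "poly [:g, e, 1:] x2 = 0" using alg_closed_imp_poly_has_root[of "[:g, e, 1:]"] by auto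
  then have x2: "g = - (x2^2 + e*x2)" by (simp add: algebra_simps power2_eq_square add_eq_0_iff)
  have "x^3 + a*x^2 + b*x + c = (x - x1)*(x - x2)*(x - (- e - x2))" for x
  proof -
    have "x^3 + a*x^2 + b*x + c = (x - x1) * (x^2 + e*x + g)"
      unfolding x1 g_def e_def by (simp add: ring_expand)
    also have "x^2 + e*x + g = (x - x2)*(x - (- e - x2))"
      unfolding x2 by (simp add: algebra_simps power2_eq_square)
    finally show ?thesis by (simp add: mult.assoc)
  qed
  then show ?thesis using that by blast
qed

lemma disc3_mod_cong:
  assumes "a mod p = a' mod p" "b mod p = b' mod p" "c mod p = c' mod (p::int)"
  shows "disc3 a b c mod p = disc3 a' b' c' mod p"
  unfolding disc3_def by (intro int_mod_cong refl assms)

lemma dvd_mod_cong: "a mod p = b mod p \<Longrightarrow> p dvd a \<longleftrightarrow> p dvd (b::int)"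
  by (metis dvd_eq_mod_eq_0)

abbreviation torsion_points :: "int \<Rightarrow> int \<Rightarrow> int \<Rightarrow> 'a::field_char_0 set \<Rightarrow> 'a point set" where
  "torsion_points a b c K \<equiv>
     carrier (torsion_subgroup (point_group (Weierstrass 0 (of_int a) 0 (of_int b) (of_int c)) K))"

text \<open>The capital letters are reductions of the data modulo \<open>p\<close>, modulo \<open>q\<close> (for the
  irreducibility of the cubic) and modulo \<open>q'\<close> (for the quadratic subfield).\<close>

theorem sextic_field_torsion_bound:
  fixes a2 a4 a6 c2 c1 c0 d A2 A4 A6 C2 C1 C0 D C2' C1' C0' D' P :: int and p :: nat
  assumes p: "prime p" "p \<noteq> 2" "P = int p"
    and red: "a2 mod P = A2 mod P" "a4 mod P = A4 mod P" "a6 mod P = A6 mod P"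
      "c2 mod P = C2 mod P" "c1 mod P = C1 mod P" "c0 mod P = C0 mod P" "d mod P = D mod P"
    and disc: "\<not> P dvd 9 * disc3 A2 A4 A6"
    and r: "P dvd r^3 + C2*r^2 + C1*r + C0" "\<not> P dvd 3*r^2 + 2*C2*r + C1"
    and s: "P dvd s^2 - D" "\<not> P dvd 2*s"
    and q: "q > 0" "c2 mod q = C2' mod q" "c1 mod q = C1' mod q" "c0 mod q = C0' mod q"
      "\<forall>x\<in>set [0..q - 1]. \<not> q dvd x^3 + C2'*x^2 + C1'*x + C0'"
    and q': "q' > 0" "d mod q' = D' mod q'" "\<forall>x\<in>set [0..q' - 1]. \<not> q' dvd x^2 - D'"
    and card: "card {(a, b). a \<in> {0..<P} \<and> b \<in> {0..<P} \<and> P dvd b^2 - (a^3 + A2*a^2 + A4*a + A6)} < N"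
  obtains \<alpha> \<beta> where "sextic_field c2 c1 c0 d \<alpha> \<beta>" "wcurve (of_int a2) (of_int a4) (of_int a6 :: rat alg_closure)"
    "finite (torsion_points a2 a4 a6 (sextic_field.K \<alpha> \<beta>))"
    "card (torsion_points a2 a4 a6 (sextic_field.K \<alpha> \<beta>)) \<le> N"
    "disc3 a2 a4 a6 \<noteq> 0"
proof -
  note P = p(3)
  note red = red[unfolded P] and disc = disc[unfolded P] and r = r[unfolded P] and s = s[unfolded P]
    and card = card[unfolded P]
  obtain V :: "rat alg_closure set" where "p_valuation V p"
    using p_valuation_exists[OF p(1) algebraic_rat_alg_closure] by blast
  then interpret p_valuation V p .
  have "int p dvd 9 * disc3 a2 a4 a6 \<longleftrightarrow> int p dvd 9 * disc3 A2 A4 A6"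
    by (intro dvd_mod_cong int_mod_cong refl disc3_mod_cong red)
  then have disc': "\<not> int p dvd 9 * disc3 a2 a4 a6" using disc by blast
  then have nz: "disc3 a2 a4 a6 \<noteq> 0" by auto
  interpret good_reduction V p a2 a4 a6
    using disc' p by unfold_locales (auto simp: disc3_def)
  have r': "int p dvd r^3 + c2*r^2 + c1*r + c0 \<longleftrightarrow> int p dvd r^3 + C2*r^2 + C1*r + C0"
    "int p dvd 3*r^2 + 2*c2*r + c1 \<longleftrightarrow> int p dvd 3*r^2 + 2*C2*r + C1"
    by (intro dvd_mod_cong int_mod_cong refl red)+
  have s': "int p dvd s^2 - d \<longleftrightarrow> int p dvd s^2 - D" by (intro dvd_mod_cong int_mod_cong refl red)
  obtain x1 x2 x3 where x: "\<And>x :: rat alg_closure. x^3 + of_int c2*x^2 + of_int c1*x + of_int c0 = (x - x1)*(x - x2)*(x - x3)"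
    using alg_closed_cubic_splits by blast
  have unitI: "inverse y \<in> V" if "y \<notin> M" for y using that unit[of y] total_V[of y] by blast
  \<comment> \<open>The value of the cubic at \<open>r\<close> lies in M and is the product of these
    differences; if all were outside M, their inverses and hence that of the product would lie in
    V.\<close>
  have "of_int r - x1 \<in> M \<or> of_int r - x2 \<in> M \<or> of_int r - x3 \<in> M"
  proof (rule ccontr)
    assume n: "\<not> ?thesis"
    have F: "of_int (r^3 + c2*r^2 + c1*r + c0) = (of_int r - x1) * (of_int r - x2) * (of_int r - x3)"
      using x[of "of_int r"] by simp
    have M: "of_int (r^3 + c2*r^2 + c1*r + c0) \<in> M" using r(1) r'(1) of_int_M_iff by blast
    have "(of_int r - x1) * (of_int r - x2) * (of_int r - x3) \<noteq> 0" using n by auto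
    moreover have "inverse ((of_int r - x1) * (of_int r - x2) * (of_int r - x3)) \<in> V"
      using n unitI by (auto intro!: mult_V)
    ultimately show False using inverse_notin_V[OF M] unfolding F by blast
  qed
  then obtain \<alpha> where \<alpha>: "\<alpha> - of_int r \<in> M" "\<alpha> \<in> {x1, x2, x3}" using diff_M_commute by blast
  then have \<alpha>root: "\<alpha>^3 + of_int c2 * \<alpha>^2 + of_int c1 * \<alpha> + of_int c0 = 0" using x[of \<alpha>] by auto
  obtain b where "poly [:- of_int d, 0, 1:] b = (0 :: rat alg_closure)"
    using alg_closed_imp_poly_has_root[of "[:- of_int d, 0, 1:] :: rat alg_closure poly"] by auto
  then have b: "b^2 = of_int d" by (simp add: power2_eq_square)
  have "(of_int s - b) * (of_int s + b) = of_int (s^2 - d)"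
    using b by (simp add: algebra_simps power2_eq_square)
  moreover have "of_int (s^2 - d) \<in> M" using s s' of_int_M_iff by blast
  moreover have "b \<in> V" using b power2_V_iff[of b] by simp
  moreover then have "of_int s - b \<in> V" "of_int s + b \<in> V" by (auto intro!: diff_V add_V)
  ultimately have "of_int s - b \<in> M \<or> of_int s + b \<in> M"
    using prime_M[of "of_int s - b" "of_int s + b"] by metis
  then obtain \<beta> where \<beta>: "\<beta> - of_int s \<in> M" "\<beta>^2 = of_int d"
    using b diff_M_commute[of "of_int s" b] diff_M_commute[of "of_int s" "- b"] by fastforce
  have Qp: "\<alpha> \<in> Qp" "\<beta> \<in> Qp"
    using Qp_cubic_root[OF \<alpha>root \<alpha>(1)] Qp_square_root[OF \<beta>(2,1)] r r' s by auto
  have no_root: "x^3 + of_int c2 * x^2 + of_int c1 * x + of_int c0 \<noteq> 0" if x: "x \<in> \<rat>" for x :: "rat alg_closure"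
  proof
    assume "x^3 + of_int c2 * x^2 + of_int c1 * x + of_int c0 = 0"
    then obtain y where y: "y \<in> {0..<q}" "q dvd y^3 + c2*y^2 + c1*y + c0"
      using Rats_monic_cubic_root_mod[OF x _ q(1)] by blast
    have "q dvd y^3 + c2*y^2 + c1*y + c0 \<longleftrightarrow> q dvd y^3 + C2'*y^2 + C1'*y + C0'"
      by (intro dvd_mod_cong int_mod_cong refl q)
    then show False using q(5) y by auto
  qed
  have no_sqrt: "x^2 \<noteq> of_int d" if x: "x \<in> \<rat>" for x :: "rat alg_closure"
  proof
    assume "x^2 = of_int d"
    then obtain y where y: "y \<in> {0..<q'}" "q' dvd y^2 - d"
      using Rats_square_root_mod[OF x _ q'(1)] by blast
    have "q' dvd y^2 - d \<longleftrightarrow> q' dvd y^2 - D'"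
      by (intro dvd_mod_cong int_mod_cong refl q')
    then show False using q'(3) y by auto
  qed
  interpret S: sextic_field c2 c1 c0 d \<alpha> \<beta>
    using \<alpha>root \<beta>(2) no_root no_sqrt by unfold_locales auto
  have KQ: "S.K \<subseteq> Qp" by (rule S.K_subset[OF field_closed_Qp _ Qp]) (use Rats_Qp in auto)
  have "{(a, b). a \<in> {0..<int p} \<and> b \<in> {0..<int p} \<and> int p dvd b^2 - (a^3 + a2*a^2 + a4*a + a6)}
      = {(a, b). a \<in> {0..<int p} \<and> b \<in> {0..<int p} \<and> int p dvd b^2 - (a^3 + A2*a^2 + A4*a + A6)}"
  proof -
    have "int p dvd b^2 - (a^3 + a2*a^2 + a4*a + a6) \<longleftrightarrow> int p dvd b^2 - (a^3 + A2*a^2 + A4*a + A6)" for a b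
      by (intro dvd_mod_cong int_mod_cong refl red)
    then show ?thesis by simp
  qed
  then show ?thesis
    using that[OF S.sextic_field_axioms wcurve_axioms] card_torsion_le[OF S.field_closed_K KQ] card nz by simp
qed

definition sextic_torsion :: "int \<Rightarrow> int \<Rightarrow> int \<Rightarrow> (int \<times> int) monoid \<Rightarrow> bool" where
  "sextic_torsion a b c H \<longleftrightarrow> disc3 a b c \<noteq> 0 \<and> (\<exists>K. number_field_of_degree 6 K \<and>
     torsion_subgroup (point_group (base_change (Weierstrass 0 (of_int a) 0 (of_int b) (of_int c))) K) \<cong> H)"

lemma sextic_torsionI:
  assumes "disc3 a b c \<noteq> 0" "number_field_of_degree 6 K"
    "torsion_subgroup (point_group (Weierstrass 0 (of_int a) 0 (of_int b) (of_int c)) K) \<cong> H"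
  shows "sextic_torsion a b c H"
  using assms unfolding sextic_torsion_def by (auto simp: base_change_def)

lemma infinite_residue_class: "n > 0 \<Longrightarrow> infinite {t :: int. t mod n = r mod n}"
proof
  assume n: "n > 0" and fin: "finite {t :: int. t mod n = r mod n}"
  have "inj (\<lambda>k :: nat. r + n * int k)" using n by (auto intro!: injI)
  moreover have "range (\<lambda>k :: nat. r + n * int k) \<subseteq> {t. t mod n = r mod n}" by auto
  ultimately show False using fin finite_subset finite_imageD infinite_UNIV_nat by blast
qed

lemma infinite_sextic_family:
  assumes "polyfun a" "polyfun b" "polyfun c"
    and "disc3 (a \<tau>) (b \<tau>) (c \<tau>) = 0" "a \<tau> ^ 2 - 3 * b \<tau> \<noteq> 0"
    and "n > 0" "\<And>t. t mod n = r mod n \<Longrightarrow> sextic_torsion (a t) (b t) (c t) H"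
  shows "\<exists>S :: rat weierstrass set. infinite S \<and> (\<forall>E\<in>S. elliptic_curve E) \<and>
    (\<forall>E \<in> S. \<forall>E' \<in> S. E \<noteq> E' \<longrightarrow> \<not> isomorphic_curves (base_change E) (base_change E')) \<and>
    (\<forall>E\<in>S. \<exists>K. number_field_of_degree 6 K \<and> torsion_subgroup (point_group (base_change E) K) \<cong> H)"
  by (rule infinite_nonisomorphic_family[OF assms(1-5) infinite_residue_class[OF assms(6)]])
    (use assms(7) in \<open>auto simp: sextic_torsion_def\<close>)

subsection \<open>Generators of the torsion subgroup\<close>

context comm_group
begin

text \<open>In other words, \<open>a\<close> and \<open>b\<close> generate an internal direct
  product of cyclic groups of orders \<open>m\<close> and \<open>n\<close>. Divisibility of
  arbitrary exponents, rather than vanishing of reduced ones, is the form that survives taking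
  powers of a relation.\<close>

definition indep_pair :: "nat \<Rightarrow> nat \<Rightarrow> 'a \<Rightarrow> 'a \<Rightarrow> bool" where
  "indep_pair m n a b \<longleftrightarrow> a \<in> carrier G \<and> b \<in> carrier G \<and> a [^] m = \<one> \<and> b [^] n = \<one> \<and>
     (\<forall>i j::nat. a [^] i \<otimes> b [^] j = \<one> \<longrightarrow> m dvd i \<and> n dvd j)"

lemma indep_pair_iso:
  assumes "indep_pair m n a b" "m > 0" "n > 0" "finite (carrier G)" "card (carrier G) \<le> m * n"
  shows "G \<cong> integer_mod_group m \<times>\<times> integer_mod_group n"
proof (rule iso_integer_mod_group_prod[of a b])
  fix i j :: nat assume "i < m" "j < n" "a [^] i \<otimes> b [^] j = \<one>"
  then show "i = 0 \<and> j = 0" using assms(1) unfolding indep_pair_def by (metis dvd_imp_le not_le gr0I)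
qed (use assms in \<open>auto simp: indep_pair_def\<close>)

text \<open>The power \<open>n'\<close> of a relation kills the primed pair, since \<open>m'\<close>
  divides \<open>n'\<close>, and \<open>n'\<close> is invertible modulo \<open>m\<close> and
  \<open>n\<close>; likewise with the roles exchanged. This joins the 2-part of the torsion to the
  3-part.\<close>

lemma indep_pair_mult:
  assumes 1: "indep_pair m n a b" and 2: "indep_pair m' n' a' b'"
    and cop: "coprime n n'" and dvd: "m dvd n" "m' dvd n'"
  shows "indep_pair (m * m') (n * n') (a \<otimes> a') (b \<otimes> b')"
  unfolding indep_pair_def
proof (intro conjI allI impI)
  have car: "a \<in> carrier G" "b \<in> carrier G" "a' \<in> carrier G" "b' \<in> carrier G"
    and id: "a [^] m = \<one>" "b [^] n = \<one>" "a' [^] m' = \<one>" "b' [^] n' = \<one>"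
    using 1 2 unfolding indep_pair_def by auto
  have pow1: "x [^] (k * l) = \<one>" "x [^] (l * k) = \<one>" if "x \<in> carrier G" "x [^] k = \<one>" for x and k l :: nat
    using that nat_pow_pow[of x k l] by (simp_all add: mult.commute)
  show "a \<otimes> a' \<in> carrier G" "b \<otimes> b' \<in> carrier G" using car by auto
  show "(a \<otimes> a') [^] (m * m') = \<one>" "(b \<otimes> b') [^] (n * n') = \<one>"
    using car id pow1 by (auto simp: nat_pow_distrib)
  have id': "a [^] n = \<one>" "a' [^] n' = \<one>" using dvd car id pow1 by (auto elim!: dvdE)
  fix i j :: nat assume eq: "(a \<otimes> a') [^] i \<otimes> (b \<otimes> b') [^] j = \<one>"
  have pow: "a [^] (i * k) \<otimes> b [^] (j * k) \<otimes> (a' [^] (i * k) \<otimes> b' [^] (j * k)) = \<one>" for k :: nat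
  proof -
    have "\<one> = ((a \<otimes> a') [^] i \<otimes> (b \<otimes> b') [^] j) [^] k" unfolding eq by simp
    also have "\<dots> = a [^] (i * k) \<otimes> b [^] (j * k) \<otimes> (a' [^] (i * k) \<otimes> b' [^] (j * k))"
      using car by (simp add: nat_pow_distrib nat_pow_pow m_ac)
    finally show ?thesis by (rule sym)
  qed
  have "a' [^] (i * n') \<otimes> b' [^] (j * n') = \<one>" using car id id' pow1 by simp
  then have "a [^] (i * n') \<otimes> b [^] (j * n') = \<one>" using pow[of n'] car by simp
  then have "m dvd i * n'" "n dvd j * n'" using 1 unfolding indep_pair_def by auto
  moreover have "coprime m n'" using cop dvd(1) by (metis coprime_divisors dvd_refl)
  ultimately have mn: "m dvd i" "n dvd j" using cop by (auto simp: coprime_dvd_mult_left_iff)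
  have "a [^] (i * n) \<otimes> b [^] (j * n) = \<one>" using car id id' pow1 by simp
  then have "a' [^] (i * n) \<otimes> b' [^] (j * n) = \<one>" using pow[of n] car by simp
  then have "m' dvd i * n" "n' dvd j * n" using 2 unfolding indep_pair_def by auto
  moreover have cop': "coprime m' n" "coprime n' n" using cop dvd(2) by (metis coprime_divisors dvd_refl coprime_commute)+
  ultimately have mn': "m' dvd i" "n' dvd j" by (auto simp: coprime_dvd_mult_left_iff)
  have "coprime m m'" using \<open>coprime m n'\<close> dvd(2) by (metis coprime_divisors dvd_refl)
  then show "m * m' dvd i" "n * n' dvd j" using mn mn' cop by (auto intro: divides_mult)
qed

text \<open>For prime order independence means only that \<open>b\<close> is not a multiple of
  \<open>a\<close>, because an exponent \<open>j\<close> prime to \<open>p\<close> can be inverted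
  in a relation. A few inequalities between points remain.\<close>

lemma indep_pair_prime:
  assumes "prime p" "a \<in> carrier G" "b \<in> carrier G" "a [^] p = \<one>" "b [^] p = \<one>" "a \<noteq> \<one>"
    and b: "\<And>k::nat. k < p \<Longrightarrow> b \<noteq> a [^] k"
  shows "indep_pair p p a b"
  unfolding indep_pair_def
proof (intro conjI allI impI)
  fix i j :: nat assume eq: "a [^] i \<otimes> b [^] j = \<one>"
  have mod: "x [^] k = x [^] (k mod p)" if "x \<in> carrier G" "x [^] p = \<one>" for x and k :: nat
  proof -
    have "x [^] k = x [^] (p * (k div p) + k mod p)" by simp
    also have "\<dots> = (x [^] p) [^] (k div p) \<otimes> x [^] (k mod p)"
      using that by (simp only: nat_pow_mult[symmetric] nat_pow_pow[symmetric])
    finally show ?thesis using that by simp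
  qed
  show pj: "p dvd j"
  proof (rule ccontr)
    assume "\<not> p dvd j"
    then have "j \<noteq> 0" "gcd j p = 1"
      using prime_imp_coprime[OF assms(1)] by (auto simp: coprime_commute coprime_iff_gcd_eq_1[symmetric] intro!: Nat.gr0I)
    then obtain u y where "j * u = p * y + 1" using bezout_nat[of j p] by auto
    then have u: "(j * u) mod p = 1 mod p" by (metis mod_mult_self4)
    have "b [^] (j * u) = b" using mod[of b "j * u"] u assms mod[of b 1] by simp
    moreover have "(a [^] i \<otimes> b [^] j) [^] u = a [^] (i * u) \<otimes> b [^] (j * u)"
      using assms by (simp add: nat_pow_distrib nat_pow_pow)
    ultimately have 1: "a [^] (i * u) \<otimes> b = \<one>" using eq by simp
    have "a [^] ((p - 1) * (i * u)) \<otimes> a [^] (i * u) = a [^] (p * (i * u))"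
      using assms(1,2) prime_gt_0_nat[of p] by (simp add: nat_pow_mult algebra_simps diff_mult_distrib)
    also have "\<dots> = \<one>" using assms nat_pow_pow[of a p "i * u"] by simp
    finally have "b = a [^] ((p - 1) * (i * u))"
      using 1 assms by (metis m_assoc nat_pow_closed l_one r_one)
    also have "\<dots> = a [^] ((p - 1) * (i * u) mod p)" by (rule mod[OF assms(2,4)])
    finally show False using b[of "(p - 1) * (i * u) mod p"] prime_gt_0_nat[OF assms(1)] by simp
  qed
  have "b [^] j = b [^] (j mod p)" by (rule mod[OF assms(3,5)])
  then have "b [^] j = \<one>" using pj by simp
  then have "a [^] i = \<one>" using eq assms by simp
  show "p dvd i"
  proof (rule ccontr)
    assume "\<not> p dvd i"
    then have "i \<noteq> 0" "gcd i p = 1"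
      using prime_imp_coprime[OF assms(1)] by (auto simp: coprime_commute coprime_iff_gcd_eq_1[symmetric] intro!: Nat.gr0I)
    then obtain u y where "i * u = p * y + 1" using bezout_nat[of i p] by auto
    then have u: "(i * u) mod p = 1 mod p" by (metis mod_mult_self4)
    have "a = a [^] (i * u)" using mod[OF assms(2,4), of "i * u"] u mod[OF assms(2,4), of 1] assms(2) by simp
    also have "\<dots> = (a [^] i) [^] u" using assms by (simp add: nat_pow_pow)
    finally show False using \<open>a [^] i = \<one>\<close> assms by simp
  qed
qed (use assms in auto)

text \<open>The \<open>p\<close>-th power of a relation removes \<open>a\<close> and shows that
  \<open>n\<close> divides \<open>j\<close>; what remains is a relation between \<open>a\<close> and
  \<open>b^n\<close>. This serves Z/3 x Z/9, where there are no coprime parts to join.\<close>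

lemma indep_pair_extend:
  assumes 1: "indep_pair p p a (b [^] n)" and b: "b \<in> carrier G" and n: "indep_pair 1 n \<one> (b [^] p)" "n > 0" "p > 0"
  shows "indep_pair p (p * n) a b"
  unfolding indep_pair_def
proof (intro conjI allI impI)
  have a: "a \<in> carrier G" "a [^] p = \<one>" using 1 unfolding indep_pair_def by auto
  show "b [^] (p * n) = \<one>" using n(1) b nat_pow_pow[of b p n] unfolding indep_pair_def by simp
  fix i j :: nat assume eq: "a [^] i \<otimes> b [^] j = \<one>"
  have "(a [^] i \<otimes> b [^] j) [^] p = (a [^] p) [^] i \<otimes> (b [^] p) [^] j"
    using a(1) b by (simp only: nat_pow_distrib nat_pow_closed nat_pow_pow mult.commute[of _ p])
  then have "\<one> [^] (0::nat) \<otimes> (b [^] p) [^] j = \<one>" using eq a b by simp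
  then have "n dvd j" using n(1) unfolding indep_pair_def by blast
  then obtain k where k: "j = n * k" by blast
  then have "a [^] i \<otimes> (b [^] n) [^] k = \<one>" using eq b by (simp add: nat_pow_pow)
  then have "p dvd i" "p dvd k" using 1 unfolding indep_pair_def by blast+
  then show "p dvd i" "p * n dvd j" unfolding k by (auto simp: mult.commute mult_dvd_mono)
qed (use 1 b in \<open>auto simp: indep_pair_def\<close>)

lemma indep_pair_one:
  assumes "prime p" "b \<in> carrier G" "b [^] p = \<one>" "b \<noteq> \<one>"
  shows "indep_pair 1 p \<one> b"
  unfolding indep_pair_def
proof (intro conjI allI impI)
  fix i j :: nat assume "\<one> [^] i \<otimes> b [^] j = \<one>"
  then have "b [^] j = \<one>" using assms(2) by simp
  then have "ord b dvd j" "ord b dvd p" using assms pow_eq_id by auto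
  moreover have "ord b \<noteq> 1" using assms(2,4) pow_ord_eq_1[OF assms(2)] by (metis nat_pow_eone)
  ultimately show "p dvd j" using assms(1) by (metis prime_nat_iff)
qed (use assms in auto)

lemma indep_pair_one_square:
  assumes "prime p" "b \<in> carrier G" "b [^] (p * p) = \<one>" "b [^] p \<noteq> \<one>"
  shows "indep_pair 1 (p * p) \<one> b"
  unfolding indep_pair_def
proof (intro conjI allI impI)
  fix i j :: nat assume "\<one> [^] i \<otimes> b [^] j = \<one>"
  then have j: "b [^] j = \<one>" using assms(2) by simp
  have 1: "indep_pair 1 p \<one> (b [^] p)"
    using assms by (intro indep_pair_one) (auto simp: nat_pow_pow)
  have "\<one> [^] i \<otimes> (b [^] p) [^] j = (b [^] j) [^] p" using assms(2) by (simp add: nat_pow_pow mult.commute)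
  then have "\<one> [^] i \<otimes> (b [^] p) [^] j = \<one>" using j by simp
  then have "p dvd j" using 1 unfolding indep_pair_def by blast
  then obtain k where k: "j = p * k" by blast
  have "\<one> [^] i \<otimes> (b [^] p) [^] k = \<one>" using j assms(2) unfolding k by (simp add: nat_pow_pow)
  then have "p dvd k" using 1 unfolding indep_pair_def by blast
  then show "p * p dvd j" unfolding k by (simp add: mult_dvd_mono)
qed (use assms in auto)

end

section \<open>Torsion points described by lines\<close>

locale wcurve_over = wcurve A B C for A B C :: "'a::field_char_0" +
  fixes K :: "'a set"
  assumes field_K: "field_closed K" and coeff_K: "A \<in> K" "B \<in> K"
begin

abbreviation G :: "'a point monoid" where "G \<equiv> point_group E K"
abbreviation T :: "'a point monoid" where "T \<equiv> torsion_subgroup G"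

sublocale G: comm_group G by (rule comm_group_point_group[OF field_K coeff_K])
sublocale T: comm_group T by (rule G.comm_group_torsion_subgroup)

lemma T_simps: "\<one>\<^bsub>T\<^esub> = Infinity" "P \<otimes>\<^bsub>T\<^esub> Q = add P Q"
  by (simp_all add: torsion_subgroup_def point_group_def)

lemma T_pow: "P [^]\<^bsub>T\<^esub> (0::nat) = Infinity" "P [^]\<^bsub>T\<^esub> Suc n = add (P [^]\<^bsub>T\<^esub> n) P"
  by (simp_all add: nat_pow_def torsion_subgroup_def point_group_def)

lemma in_T:
  assumes "Affine x y \<in> points_over E K" "Affine x y [^]\<^bsub>T\<^esub> (n::nat) = Infinity" "n > 0"
  shows "Affine x y \<in> carrier T"
  using assms unfolding carrier_torsion_subgroup pow_torsion_subgroup by (auto simp: point_group_def)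

lemma affine_in_points_over:
  "on_curve (Affine x y) \<Longrightarrow> x \<in> K \<Longrightarrow> y \<in> K \<Longrightarrow> Affine x y \<in> points_over E K"
  unfolding points_over_iff by auto

lemma two_torsion:
  assumes "on_curve (Affine e 0)" "e \<in> K"
  shows "Affine e 0 \<in> carrier T" "Affine e 0 [^]\<^bsub>T\<^esub> (2::nat) = Infinity"
proof -
  show 2: "Affine e 0 [^]\<^bsub>T\<^esub> (2::nat) = Infinity" unfolding numeral_2_eq_2 T_pow by simp
  show "Affine e 0 \<in> carrier T"
    by (rule in_T[OF affine_in_points_over[OF assms field_closedD(2)[OF field_K]] 2]) simp
qed

lemma indep_two_torsion:
  assumes "on_curve (Affine e 0)" "e \<in> K" "on_curve (Affine e' 0)" "e' \<in> K" "e \<noteq> e'"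
  shows "T.indep_pair 2 2 (Affine e 0) (Affine e' 0)"
proof (rule T.indep_pair_prime)
  fix k :: nat assume "k < 2"
  then consider "k = 0" | "k = 1" by linarith
  then show "Affine e' 0 \<noteq> Affine e 0 [^]\<^bsub>T\<^esub> k"
    by cases (use assms(5) in \<open>simp_all add: T_pow T_simps numeral_eq_Suc del: nat_pow_Suc\<close>)
qed (use two_torsion assms in \<open>auto simp: T_simps\<close>)

text \<open>Points of order 3 are flexes: triple contact of the tangent at P says 2P = -P.\<close>

lemma flex_add:
  assumes "meets l n x x x" "y = l*x + n"
  shows "add (Affine x y) (Affine x y) = neg (Affine x y)"
  using add_meets[OF assms(1)] assms(2) by simp

lemma three_torsion:
  assumes "meets l n x x x" "y = l*x + n" "x \<in> K" "y \<in> K"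
  shows "Affine x y \<in> carrier T" "Affine x y [^]\<^bsub>T\<^esub> (3::nat) = Infinity" 
    "Affine x y [^]\<^bsub>T\<^esub> (2::nat) = neg (Affine x y)"
proof -
  show 2: "Affine x y [^]\<^bsub>T\<^esub> (2::nat) = neg (Affine x y)"
    unfolding numeral_2_eq_2 T_pow using flex_add[OF assms(1,2)] by simp
  show 3: "Affine x y [^]\<^bsub>T\<^esub> (3::nat) = Infinity"
    using add_neg'[of "Affine x y"] unfolding numeral_3_eq_3 T_pow(2)[of _ "Suc (Suc 0)"]
    unfolding 2[unfolded numeral_2_eq_2] .
  show "Affine x y \<in> carrier T"
    by (rule in_T[OF affine_in_points_over 3]) (use meets_on_curve[OF assms(1)] assms(2-4) in auto)
qed

lemma indep_three_torsion:
  assumes 1: "meets l n x x x" "y = l*x + n" "x \<in> K" "y \<in> K"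
    and 2: "meets l' n' x' x' x'" "y' = l'*x' + n'" "x' \<in> K" "y' \<in> K" and ne: "x \<noteq> x'"
  shows "T.indep_pair 3 3 (Affine x y) (Affine x' y')"
proof (rule T.indep_pair_prime)
  fix k :: nat assume "k < 3"
  then consider "k = 0" | "k = 1" | "k = 2" by linarith
  then show "Affine x' y' \<noteq> Affine x y [^]\<^bsub>T\<^esub> k"
  proof cases
    case 3
    then show ?thesis using three_torsion(3)[OF 1] ne by simp
  qed (use ne in \<open>simp_all add: T_simps three_torsion[OF 1]\<close>)
qed (use three_torsion[OF 1] three_torsion[OF 2] in \<open>auto simp: T_simps\<close>)

text \<open>The three lines are the tangent at P, giving 2P, the chord through P and 2P, giving 3P,
  and the inflectional tangent at 3P. As 3P is affine and of order 3, P has order 9.\<close>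

lemma nine_torsion:
  assumes on: "on_curve (Affine x y)" "x \<in> K" "y \<in> K"
    and 2: "meets l n x x x2" "y = l*x + n"
    and 3: "meets k h x x2 x3" "y = k*x + h" "- (l*x2 + n) = k*x2 + h"
    and flex: "meets l' n' x3 x3 x3" "y3 = l'*x3 + n'" "x3 \<in> K" "y3 \<in> K" "y3 = - (k*x3 + h)"
  shows "Affine x y \<in> carrier T" "Affine x y [^]\<^bsub>T\<^esub> (3::nat) = Affine x3 y3"
    "T.indep_pair 1 9 Infinity (Affine x y)"
proof -
  have P2: "add (Affine x y) (Affine x y) = Affine x2 (k*x2 + h)"
    using add_meets[OF 2(1)] 2(2) 3(3) by simp
  have P3: "add (Affine x2 (k*x2 + h)) (Affine x y) = Affine x3 y3"
    using add_meets[OF meets_perm(1)[OF 3(1)]] 3(2) flex(5) by simp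
  show c3: "Affine x y [^]\<^bsub>T\<^esub> (3::nat) = Affine x3 y3"
    using P2 P3 unfolding numeral_3_eq_3 T_pow by simp
  have car: "Affine x y \<in> carrier G" using affine_in_points_over[OF on] by (simp add: point_group_def)
  have c9: "Affine x y [^]\<^bsub>T\<^esub> (3 * 3::nat) = Infinity"
    using G.nat_pow_pow[OF car, of 3 3] c3 three_torsion(2)[OF flex(1-4)] unfolding pow_torsion_subgroup by simp
  show cT: "Affine x y \<in> carrier T"
    by (rule in_T[OF affine_in_points_over[OF on] c9]) simp
  have "T.indep_pair 1 (3 * 3) \<one>\<^bsub>T\<^esub> (Affine x y)"
    by (rule T.indep_pair_one_square) (use cT c9 c3 in \<open>simp_all add: T_simps\<close>)
  then show "T.indep_pair 1 9 Infinity (Affine x y)" by (simp add: T_simps)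
qed

lemma torsion_2_18:
  assumes card: "finite (carrier T)" "card (carrier T) \<le> 36"
    and e: "on_curve (Affine e 0)" "e \<in> K" "on_curve (Affine e' 0)" "e' \<in> K" "e \<noteq> e'"
    and c: "T.indep_pair 1 9 Infinity (Affine x y)"
  shows "T \<cong> integer_mod_group 2 \<times>\<times> integer_mod_group 18"
proof -
  have "T.indep_pair (2 * 1) (2 * 9) (Affine e 0 \<otimes>\<^bsub>T\<^esub> Infinity) (Affine e' 0 \<otimes>\<^bsub>T\<^esub> Affine x y)"
    by (rule T.indep_pair_mult[OF indep_two_torsion[OF e] c]) (auto simp: coprime_iff_gcd_eq_1 gcd_nat.simps)
  then show ?thesis using T.indep_pair_iso[of "2 * 1" "2 * 9"] card by simp
qed

lemma torsion_3_9:
  assumes card: "finite (carrier T)" "card (carrier T) \<le> 27"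
    and P: "meets l n x x x" "y = l*x + n" "x \<in> K" "y \<in> K"
    and Q: "meets l' n' x' x' x'" "y' = l'*x' + n'" "x' \<in> K" "y' \<in> K" and ne: "x \<noteq> x'"
    and c: "T.indep_pair 1 9 Infinity c" "c [^]\<^bsub>T\<^esub> (3::nat) = Affine x' y'"
  shows "T \<cong> integer_mod_group 3 \<times>\<times> integer_mod_group 9"
proof -
  have "T.indep_pair 1 3 \<one>\<^bsub>T\<^esub> (c [^]\<^bsub>T\<^esub> (3::nat))" unfolding c
    by (rule T.indep_pair_one) (use three_torsion[OF Q] in \<open>auto simp: T_simps\<close>)
  moreover have "c \<in> carrier T" using c unfolding T.indep_pair_def by blast
  ultimately have "T.indep_pair 3 (3 * 3) (Affine x y) c"
    using T.indep_pair_extend[of 3 "Affine x y" c 3] indep_three_torsion[OF P Q ne] c(2) by simp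
  then show ?thesis using T.indep_pair_iso[of 3 "3 * 3"] card by simp
qed

text \<open>By \<open>R\<close> the tangent above \<open>s\<close> passes through the 2-torsion
  point \<open>(e, 0)\<close>, so the point of contact is half of it and has order 4.\<close>

lemma torsion_3_12:
  assumes card: "finite (carrier T)" "card (carrier T) \<le> 36"
    and P: "meets l n x x x" "y = l*x + n" "x \<in> K" "y \<in> K"
    and Q: "meets l' n' x' x' x'" "y' = l'*x' + n'" "x' \<in> K" "y' \<in> K" and ne: "x \<noteq> x'"
    and R: "meets k h s s e" "k*e + h = 0" "k*s + h \<in> K" "s \<in> K" "e \<in> K"
  shows "T \<cong> integer_mod_group 3 \<times>\<times> integer_mod_group 12"
proof -
  define c where "c = Affine s (k*s + h)"
  have c2: "c [^]\<^bsub>T\<^esub> (2::nat) = Affine e 0"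
    using add_meets[OF R(1)] R(2) unfolding numeral_2_eq_2 T_pow c_def by simp
  have e: "on_curve (Affine e 0)" using meets_on_curve[OF meets_perm(2)[OF R(1)]] R(2) by simp
  have on: "on_curve c" using meets_on_curve[OF R(1)] c_def by simp
  have car: "c \<in> points_over E K" using on R unfolding c_def by (auto intro: affine_in_points_over)
  then have c4: "c [^]\<^bsub>T\<^esub> (2 * 2::nat) = Infinity"
    using G.nat_pow_pow[of c 2 2] c2 two_torsion(2)[OF e R(5)] unfolding pow_torsion_subgroup by (simp add: point_group_def)
  have cT: "c \<in> carrier T" using car c4 unfolding c_def by (rule_tac in_T) auto
  have 1: "T.indep_pair 1 (2 * 2) \<one>\<^bsub>T\<^esub> c"
    by (rule T.indep_pair_one_square) (use cT c4 c2 in \<open>simp_all add: T_simps\<close>)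
  have "T.indep_pair (1 * 3) ((2 * 2) * 3) (\<one>\<^bsub>T\<^esub> \<otimes>\<^bsub>T\<^esub> Affine x y) (c \<otimes>\<^bsub>T\<^esub> Affine x' y')"
    by (rule T.indep_pair_mult[OF 1 indep_three_torsion[OF P Q ne]]) (auto simp: coprime_iff_gcd_eq_1 gcd_nat.simps)
  then show ?thesis using T.indep_pair_iso[of "1 * 3" "(2 * 2) * 3"] card by simp
qed

lemma torsion_6_6:
  assumes card: "finite (carrier T)" "card (carrier T) \<le> 36"
    and P: "meets l n x x x" "y = l*x + n" "x \<in> K" "y \<in> K"
    and Q: "meets l' n' x' x' x'" "y' = l'*x' + n'" "x' \<in> K" "y' \<in> K" and ne: "x \<noteq> x'"
    and e: "on_curve (Affine e 0)" "e \<in> K" "on_curve (Affine e' 0)" "e' \<in> K" "e \<noteq> e'"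
  shows "T \<cong> integer_mod_group 6 \<times>\<times> integer_mod_group 6"
proof -
  have "T.indep_pair (2 * 3) (2 * 3) (Affine e 0 \<otimes>\<^bsub>T\<^esub> Affine x y) (Affine e' 0 \<otimes>\<^bsub>T\<^esub> Affine x' y')"
    by (rule T.indep_pair_mult[OF indep_two_torsion[OF e] indep_three_torsion[OF P Q ne]])
      (auto simp: coprime_iff_gcd_eq_1 gcd_nat.simps)
  then show ?thesis using T.indep_pair_iso[of "2 * 3" "2 * 3"] card by simp
qed

end

text \<open>The eight points of order 3 on \<open>y\<^sup>2 = x\<^sup>3 + (l x + n)\<^sup>2\<close> are \<open>(0, \<plusminus> n)\<close> and six points with
  coordinates in \<open>\<rat>(l, \<delta>, \<surd>-3)\<close>, where \<open>\<delta>\<^sup>3 = l\<^sup>3 - 27 n / 4\<close>.\<close>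

lemma (in wcurve) flex_zero:
  assumes "A = l^2" "B = 2*l*n" "C = n^2"
  shows "meets l n 0 0 0"
  unfolding meets_def using assms by simp

lemma (in wcurve) flex_delta:
  assumes ABC: "A = l^2" "B = 2*l*n" "C = n^2" and n: "27 * n = 4 * (l^3 - \<delta>^3)" and \<beta>: "\<beta>^2 = -3"
  defines "x \<equiv> - 4*(l^2 + l*\<delta> + \<delta>^2)/9" and "y \<equiv> - 4*\<beta>*\<delta>*(l^2 + l*\<delta> + \<delta>^2)/27"
    and "k \<equiv> \<beta>*(l + 2*\<delta>)/3"
  shows "meets k (y - k*x) x x x"
proof -
  have n': "n = 4 * (l^3 - \<delta>^3) / 27" using n by (simp add: field_simps)
  \<comment> \<open>\<open>\<beta> / 3\<close> has square \<open>- 1/3\<close>; since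
    \<open>k\<close> and \<open>y\<close> are multiples of it, \<open>\<beta>\<close> disappears
    from all three conditions.\<close>
  have k: "k = (\<beta>/3) * (l + 2*\<delta>)" and y: "y = (\<beta>/3) * (\<delta> * x / 1)" unfolding k_def y_def x_def by (simp_all add: field_simps)
  have b: "(\<beta>/3)^2 = -1/3" using \<beta> by (simp add: power_divide)
  have kk: "k^2 = - ((l + 2*\<delta>)^2 / 3)" unfolding k power_mult_distrib b by simp
  have ky: "k * (y - k*x) = - ((l + 2*\<delta>) * (\<delta> * x - (l + 2*\<delta>) * x) / 3)"
  proof -
    have "k * (y - k*x) = (\<beta>/3)^2 * ((l + 2*\<delta>) * (\<delta> * x - (l + 2*\<delta>) * x))" unfolding y k by (simp add: algebra_simps power2_eq_square)
    then show ?thesis unfolding b by simp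
  qed
  have yy: "(y - k*x)^2 = - ((\<delta> * x - (l + 2*\<delta>) * x)^2 / 3)"
  proof -
    have "(y - k*x)^2 = (\<beta>/3)^2 * (\<delta> * x - (l + 2*\<delta>) * x)^2" unfolding y k by (simp add: algebra_simps power2_eq_square)
    then show ?thesis unfolding b by simp
  qed
  show ?thesis
    unfolding meets_def unfolding ABC
  proof (intro conjI)
    show "x + x + x = k^2 - l^2" unfolding kk x_def by (simp add: field_simps power2_eq_square)
    show "x*x + x*x + x*x = 2*l*n - 2*k*(y - k*x)"
      unfolding mult.assoc ky unfolding n' x_def by (simp add: field_simps power2_eq_square power3_eq_cube)
    show "x*x*x = (y - k*x)^2 - n^2"
      unfolding yy unfolding n' x_def by (simp add: field_simps power2_eq_square power3_eq_cube)
  qed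
qed

subsection \<open>The four families\<close>

text \<open>Instead of testing \<open>p^2\<close> pairs, each value of the cubic in the table
  \<open>vs\<close> is looked up in the table \<open>sq\<close> of squares, where its multiplicity
  is the number of its square roots.\<close>

lemma card_affine_points:
  fixes p A B C :: int
  assumes sq: "map (\<lambda>b. b*b mod p) [0..p - 1] = sq"
    and vs: "map (\<lambda>a. (((a + A)*a + B)*a + C) mod p) [0..p - 1] = vs"
  shows "card {(a, b). a \<in> {0..<p} \<and> b \<in> {0..<p} \<and> p dvd b^2 - (a^3 + A*a^2 + B*a + C)} = sum_list (map (count_list sq) vs)"
proof -
  let ?v = "\<lambda>a. (((a + A)*a + B)*a + C) mod p"
  have row: "card {b \<in> {0..<p}. b*b mod p = v} = count_list sq v" for v
  proof -
    have "count_list sq v = length (filter (\<lambda>b. b*b mod p = v) [0..p - 1])"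
      unfolding sq[symmetric] count_list_eq_length_filter by (simp add: filter_map comp_def eq_commute)
    also have "\<dots> = card (set (filter (\<lambda>b. b*b mod p = v) [0..p - 1]))"
      by (rule distinct_card[symmetric]) simp
    also have "set (filter (\<lambda>b. b*b mod p = v) [0..p - 1]) = {b \<in> {0..<p}. b*b mod p = v}" by auto
    finally show ?thesis by simp
  qed
  have "{(a, b). a \<in> {0..<p} \<and> b \<in> {0..<p} \<and> p dvd b^2 - (a^3 + A*a^2 + B*a + C)}
     = Sigma {0..<p} (\<lambda>a. {b \<in> {0..<p}. b*b mod p = ?v a})"
    by (auto simp: mod_eq_dvd_iff ring_expand)
  moreover have fin: "\<forall>a\<in>{0..<p}. finite {b \<in> {0..<p}. b*b mod p = ?v a}"
    by (intro ballI finite_subset[of "{b \<in> {0..<p}. b*b mod p = _}" "{0..<p}"]) auto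
  ultimately have "card {(a, b). a \<in> {0..<p} \<and> b \<in> {0..<p} \<and> p dvd b^2 - (a^3 + A*a^2 + B*a + C)}
     = (\<Sum>a\<in>{0..<p}. count_list sq (?v a))"
    by (simp only: row card_SigmaI[OF finite_atLeastLessThan_int fin])
  also have "\<dots> = (\<Sum>a\<in>set [0..p - 1]. count_list sq (?v a))" by (rule sum.cong) auto
  also have "\<dots> = sum_list (map (\<lambda>a. count_list sq (?v a)) [0..p - 1])"
    by (rule sum_list_distinct_conv_sum_set[symmetric]) simp
  also have "map (\<lambda>a. count_list sq (?v a)) [0..p - 1] = map (count_list sq) vs"
    unfolding vs[symmetric] by simp
  finally show ?thesis .
qed

text \<open>In this and the next three counts the point at infinity brings the totals to 36, 27, 36
  and 36, the orders of the four groups.\<close>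

lemma card_points_2_18:
  "card {(a, b). a \<in> {0..<29} \<and> b \<in> {0..<29} \<and> 29 dvd b^2 - (a^3 + 19*a^2 + 27*a + 13 :: int)} = 35"
  by (subst card_affine_points[where
      sq = "[0, 1, 4, 9, 16, 25, 7, 20, 6, 23, 13, 5, 28, 24, 22, 22, 24, 28, 5, 13, 23, 6, 20, 7, 25,
        16, 9, 4, 1]"
      and vs = "[13, 2, 6, 2, 25, 23, 2, 26, 14, 1, 22, 25, 16, 1, 15, 6, 9, 1, 17, 5, 0, 8, 6, 0, 25, 0,
        18, 27, 4]"])
    (simp_all add: upto.simps)

lemma card_points_3_9:
  "card {(a, b). a \<in> {0..<31} \<and> b \<in> {0..<31} \<and> 31 dvd b^2 - (a^3 + 5*a^2 + 15*a + 19 :: int)} = 26"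
  by (subst card_affine_points[where
      sq = "[0, 1, 4, 9, 16, 25, 5, 18, 2, 19, 7, 28, 20, 14, 10, 8, 8, 10, 14, 20, 28, 7, 19, 2, 18,
        5, 25, 16, 9, 4, 1]"
      and vs = "[19, 9, 15, 12, 6, 3, 9, 30, 10, 17, 26, 12, 12, 1, 16, 1, 24, 29, 22, 9, 27, 20, 25, 17,
        2, 17, 6, 6, 23, 1, 8]"])
    (simp_all add: upto.simps)

lemma card_points_3_12:
  "card {(a, b). a \<in> {0..<31} \<and> b \<in> {0..<31} \<and> 31 dvd b^2 - (a^3 + 4*a^2 + 14*a + 20 :: int)} = 35"
  by (subst card_affine_points[where
      sq = "[0, 1, 4, 9, 16, 25, 5, 18, 2, 19, 7, 28, 20, 14, 10, 8, 8, 10, 14, 20, 28, 7, 19, 2, 18,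
        5, 25, 16, 9, 4, 1]"
      and vs = "[20, 8, 10, 1, 18, 5, 30, 6, 1, 21, 10, 5, 12, 6, 24, 10, 1, 3, 22, 2, 11, 24, 16, 24, 23,
        19, 18, 26, 18, 0, 9]"])
    (simp_all add: upto.simps)

lemma card_points_6_6:
  "card {(a, b). a \<in> {0..<37} \<and> b \<in> {0..<37} \<and> 37 dvd b^2 - (a^3 + 12*a^2 + 23*a + 1 :: int)} = 35"
  by (subst card_affine_points[where
      sq = "[0, 1, 4, 9, 16, 25, 36, 12, 27, 7, 26, 10, 33, 21, 11, 3, 34, 30, 28, 28, 30, 34, 3, 11,
        21, 33, 10, 26, 7, 27, 12, 36, 25, 16, 9, 4, 1]"
      and vs = "[1, 0, 29, 20, 16, 23, 10, 20, 22, 22, 26, 3, 33, 11, 17, 20, 26, 4, 34, 11, 15, 15, 17,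
        27, 14, 21, 17, 8, 0, 36, 11, 5, 24, 0, 13, 32, 26]"])
    (simp_all add: upto.simps)

lemma mod_eq_reduce: "t mod n = t0 mod n \<Longrightarrow> m dvd n \<Longrightarrow> t mod m = t0 mod (m :: int)"
  by (metis mod_mod_cancel)

text \<open>\<open>l^2 + l \<delta> + \<delta>^2\<close> divides \<open>27 n\<close>, and
  \<open>n = 0\<close> would make the origin singular. So the flex from \<open>flex_delta\<close>
  does not lie above 0, which makes it independent of \<open>(0, n)\<close>.\<close>

lemma (in wcurve) flex_delta_nonzero:
  assumes ABC: "A = l^2" "B = 2*l*n" "C = n^2" and n: "27 * n = 4 * (l^3 - \<delta>^3)"
  shows "0 \<noteq> - 4*(l^2 + l*\<delta> + \<delta>^2)/9"
proof
  assume z: "0 = - 4*(l^2 + l*\<delta> + \<delta>^2)/9"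
  have "l^2 + l*\<delta> + \<delta>^2 = - (9/4) * (- 4*(l^2 + l*\<delta> + \<delta>^2)/9)" by (simp add: field_simps)
  also have "\<dots> = 0" unfolding z[symmetric] by simp
  finally have 0: "l^2 + l*\<delta> + \<delta>^2 = 0" .
  have "27 * n = 4 * (l - \<delta>) * (l^2 + l*\<delta> + \<delta>^2)" unfolding n by (simp add: ring_expand)
  then have "n = 0" using 0 by simp
  then show False using smooth[of 0] ABC by simp
qed

lemma on_curve_of_int_root:
  assumes "wcurve (of_int a) (of_int b) (of_int c :: 'a::field_char_0)" "x^3 + a*x^2 + b*x + c = 0"
  shows "wcurve.on_curve (of_int a) (of_int b) (of_int c) (Affine (of_int x) (0 :: 'a))"
  using arg_cong[OF assms(2), of "of_int :: int \<Rightarrow> 'a"]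
  unfolding wcurve.on_curve.simps[OF assms(1)] by simp

text \<open>If \<open>s\<^sup>3 - l s\<^sup>2 + n = 0\<close> then \<open>- s\<^sup>2\<close> is a root of \<open>x\<^sup>3 + (l x + n)\<^sup>2\<close>; here \<open>l\<close>, \<open>n\<close> are chosen so
  that \<open>s\<close> runs through \<open>1 + t\<close>, \<open>t (1 + t)\<close>, \<open>- t\<close>.  As \<open>8 l\<^sup>3 - 54 n = 2 g\<^sup>2\<close>, full 3-torsion is
  obtained from the cube root of \<open>2 g\<^sup>2\<close>.\<close>

lemma member_6_6:
  fixes t :: int
  assumes t: "t mod 259 = 2 mod 259"
  defines "l \<equiv> t^2 + t + 1" and "n \<equiv> t^2 * (t + 1)^2"
  shows "sextic_torsion (l^2) (2*l*n) (n^2) (integer_mod_group 6 \<times>\<times> integer_mod_group 6)"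
proof -
  define g where "g = (t - 1) * (t + 2) * (2*t + 1)"
  have t37: "t mod 37 = 2 mod 37" and t7: "t mod 7 = 2 mod 7"
    by (rule mod_eq_reduce[OF t], simp)+
  have r1: "l mod 37 = (2^2 + 2 + 1) mod 37" "n mod 37 = (2^2 * (2 + 1)^2) mod 37"
    "g mod 37 = ((2 - 1) * (2 + 2) * (2*2 + 1)) mod 37" "g mod 7 = ((2 - 1) * (2 + 2) * (2*2 + 1)) mod 7"
    unfolding l_def n_def g_def by (intro int_mod_cong refl t37 t7)+
  have l: "l mod 37 = 7 mod 37" and n: "n mod 37 = 36 mod 37" and g: "g mod 37 = 20 mod 37" "g mod 7 = 6 mod 7"
    unfolding r1 by simp_all
  have r2: "l^2 mod 37 = 7^2 mod 37" "(2*l*n) mod 37 = (2*7*36) mod 37" "n^2 mod 37 = 36^2 mod 37"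
    "(- 2*g^2) mod 37 = (- 2*20^2) mod 37" "(- 2*g^2) mod 7 = (- 2*6^2) mod 7"
    by (intro int_mod_cong refl l n g)+
  have red: "l^2 mod 37 = 12 mod 37" "(2*l*n) mod 37 = 23 mod 37" "n^2 mod 37 = 1 mod 37"
    "(- 2*g^2) mod 37 = 14 mod 37" "(- 2*g^2) mod 7 = 5 mod 7" unfolding r2 by simp_all
  obtain \<alpha> \<beta> where S: "sextic_field 0 0 (- 2*g^2) (-3) \<alpha> \<beta>"
    "wcurve (of_int (l^2)) (of_int (2*l*n)) (of_int (n^2) :: rat alg_closure)"
    "finite (torsion_points (l^2) (2*l*n) (n^2) (sextic_field.K \<alpha> \<beta>))"
    "card (torsion_points (l^2) (2*l*n) (n^2) (sextic_field.K \<alpha> \<beta>)) \<le> 36"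
    "disc3 (l^2) (2*l*n) (n^2) \<noteq> 0"
  \<comment> \<open>Modulo 37 the residues of \<open>\<alpha>\<close> and of a square root of -3 are
    18 and 16. Modulo 7 the cubic becomes \<open>X^3 + 5\<close>, without a root because the cubes
    are 0, 1 and 6; modulo 5, -3 is no square.\<close>
  proof (rule sextic_field_torsion_bound[of 37 37 "l^2" 12 "2*l*n" 23 "n^2" 1 0 0 0 0 "- 2*g^2" 14 "-3" "-3" 18 16 7 0 0 5 5 "-3" 36])
    show "card {(a, b). a \<in> {0..<37} \<and> b \<in> {0..<37} \<and> 37 dvd b\<^sup>2 - (a ^ 3 + 12 * a\<^sup>2 + 23 * a + 1 :: int)} < 36"
      unfolding card_points_6_6 by simp
  qed ((rule red that refl | assumption | simp add: disc3_def upto.simps)+)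
  interpret S: sextic_field 0 0 "- 2*g^2" "-3" \<alpha> \<beta> by (rule S(1))
  \<comment> \<open>The cubic generator has \<open>\<alpha>^3 = 2 g^2\<close>, while
    \<open>flex_delta\<close> wants a cube root of \<open>l^3 - 27 n / 4 = g^2 / 4\<close>; this is
    \<open>\<alpha> / 2\<close>.\<close>
  define l' n' \<delta> where "l' = (of_int l :: rat alg_closure)" "n' = (of_int n :: rat alg_closure)" "\<delta> = \<alpha> / 2"
  have co: "of_int (l^2) = l'^2" "of_int (2*l*n) = 2*l'*n'" "of_int (n^2) = n'^2" by (simp_all add: l'_n'_\<delta>_def)
  have inK: "of_int i \<in> S.K" for i by (rule field_closedD(11)[OF S.field_closed_K])
  interpret wcurve_over "of_int (l^2)" "of_int (2*l*n)" "of_int (n^2)" S.K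
    by (intro wcurve_over.intro S(2) wcurve_over_axioms.intro S.field_closed_K inK)
  have gl: "8 * l^3 - 54 * n = 2 * g^2" unfolding l_def n_def g_def
    by (simp add: ring_expand)
  have "\<alpha>^3 = of_int (2 * g^2)" using S.\<alpha> by simp
  also have "\<dots> = 8 * l'^3 - 54 * n'" unfolding gl[symmetric] by (simp add: l'_n'_\<delta>_def)
  finally have \<delta>3: "\<delta>^3 = (8 * l'^3 - 54 * n') / 8" by (simp add: l'_n'_\<delta>_def(3) power_divide)
  have \<delta>: "27 * n' = 4 * (l'^3 - \<delta>^3)" unfolding \<delta>3 by (simp add: field_simps)
  have \<beta>: "\<beta>^2 = -3" using S.\<beta> by simp
  have K: "l' \<in> S.K" "n' \<in> S.K" "\<delta> \<in> S.K" "\<beta> \<in> S.K"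
    using inK S.\<alpha>_K S.\<beta>_K field_closedD(8,12)[OF S.field_closed_K] by (auto simp: l'_n'_\<delta>_def)
  have e: "on_curve (Affine (of_int (- ((1 + t)^2))) 0)" "on_curve (Affine (of_int (- (t^2))) 0)"
  proof -
    have "(- ((1 + t)^2))^3 + l^2 * (- ((1 + t)^2))^2 + 2*l*n * (- ((1 + t)^2)) + n^2 = 0"
      "(- (t^2))^3 + l^2 * (- (t^2))^2 + 2*l*n * (- (t^2)) + n^2 = 0"
      unfolding l_def n_def by (simp_all add: ring_expand)
    from this[THEN on_curve_of_int_root[OF S(2)]]
    show "on_curve (Affine (of_int (- ((1 + t)^2))) 0)" "on_curve (Affine (of_int (- (t^2))) 0)" .
  qed
  have "(1 + t)^2 \<noteq> t^2"
  proof
    assume "(1 + t)^2 = t^2"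
    then have "2 * t = - 1" by (simp add: power2_eq_square algebra_simps)
    then show False by presburger
  qed
  then have ne: "of_int (- ((1 + t)^2)) \<noteq> (of_int (- (t^2)) :: rat alg_closure)" unfolding of_int_eq_iff by simp
  have "T \<cong> integer_mod_group 6 \<times>\<times> integer_mod_group 6"
    by (rule torsion_6_6[OF S(3,4) flex_zero[OF co] refl _ _ flex_delta[OF co \<delta> \<beta>] refl _ _ flex_delta_nonzero[OF co \<delta>] e(1) inK e(2) inK ne])
      (use K in \<open>auto intro!: field_closedD[OF S.field_closed_K]\<close>)
  then show ?thesis by (rule sextic_torsionI[OF S(5) S.number_field_K])
qed

text \<open>A point of order 9 on the curve \<open>y\<^sup>2 = x\<^sup>3 - 27 (l x + b)\<^sup>2\<close> with \<open>m = t (t - 1) = \<eta>\<^sup>3\<close>,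
  \<open>l = t\<^sup>3 - 3 t\<^sup>2 + 1\<close> and \<open>b = 4 (27 m\<^sup>3 - l\<^sup>3)\<close>, the quotient of the universal curve over \<open>X\<^sub>1(9)\<close> by its
  rational subgroup of order 3.  Everything is written in normal form \<open>u + v t\<close> with \<open>u, v \<in> \<int>[\<eta>]\<close>; the
  lines with slopes \<open>\<lambda>\<close>, \<open>\<mu>\<close> are the tangent at the point and the chord through it and its double.\<close>

locale nine_torsion_data =
  fixes t \<eta> :: "'a::field_char_0"
  assumes t: "t*t = t + \<eta>^3"
begin

definition l where "l = (1 - 2*\<eta>^3) + (\<eta>^3 - 2)*t"
definition b where "b = (- 4 + 8*\<eta>^3 + 48*\<eta>^6 + 56*\<eta>^9 + 20*\<eta>^12) + (8 + 20*\<eta>^3 +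
      12*\<eta>^6 - 4*\<eta>^9 - 4*\<eta>^12)*t"
definition cA where "cA = (- 27 - 27*\<eta>^9) + (- 162*\<eta>^3 + 81*\<eta>^6)*t"
definition cB where "cB = (216 + 2376*\<eta>^9 + 3888*\<eta>^12 + 1944*\<eta>^15 + 216*\<eta>^18) + (2592*\<eta>^3 +
      6480*\<eta>^6 + 3888*\<eta>^9 - 1296*\<eta>^12 - 1296*\<eta>^15)*t"
definition cC where "cC = (- 432 - 24624*\<eta>^9 - 93312*\<eta>^12 - 151632*\<eta>^15 - 129600*\<eta>^18 -
      58320*\<eta>^21 - 11664*\<eta>^24 - 432*\<eta>^27) + (- 7776*\<eta>^3 - 42768*\<eta>^6 -
      93312*\<eta>^9 - 97200*\<eta>^12 - 38880*\<eta>^15 + 11664*\<eta>^18 + 15552*\<eta>^21 +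
      3888*\<eta>^24)*t"
definition x where "x = (12 + 36*\<eta>^4 + 72*\<eta>^5 + 36*\<eta>^7 + 72*\<eta>^8 + 12*\<eta>^9) + (36*\<eta>^2 +
      72*\<eta>^3 + 36*\<eta>^4 + 36*\<eta>^5 + 72*\<eta>^6 + 36*\<eta>^7)*t"
definition x2 where "x2 = (12 + 36*\<eta> + 72*\<eta>^2 + 108*\<eta>^3 + 108*\<eta>^4 + 108*\<eta>^5 + 108*\<eta>^6 +
      72*\<eta>^7 + 36*\<eta>^8 + 12*\<eta>^9) + (- 36*\<eta> - 72*\<eta>^2 - 36*\<eta>^3 -
      36*\<eta>^4 - 72*\<eta>^5 - 36*\<eta>^6)*t"
definition x3 where "x3 = 12*(1 + \<eta>^3)^3"
definition y3 where "y3 = 108*\<eta>^3*(1 + \<eta>^3)^3"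
definition sl where "sl = (3 + 6*\<eta> + 6*\<eta>^2 + 6*\<eta>^3 + 12*\<eta>^4) + (- 6*\<eta> + 6*\<eta>^2 +
      3*\<eta>^3)*t"
definition n where "n = (- 36 - 72*\<eta> - 72*\<eta>^2 - 72*\<eta>^3 - 144*\<eta>^4 - 432*\<eta>^5 - 432*\<eta>^6 -
      216*\<eta>^7 - 648*\<eta>^8 - 792*\<eta>^9 - 288*\<eta>^10 - 288*\<eta>^11 - 396*\<eta>^12 -
      144*\<eta>^13) + (72*\<eta> - 72*\<eta>^2 - 252*\<eta>^3 - 216*\<eta>^4 - 432*\<eta>^5 -
      540*\<eta>^6 - 648*\<eta>^7 - 648*\<eta>^8 - 324*\<eta>^9 - 360*\<eta>^10 - 288*\<eta>^11 -
      36*\<eta>^12)*t"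
definition sm where "sm = (- 3 - 6*\<eta> - 6*\<eta>^2 - 6*\<eta>^3 + 6*\<eta>^4) + (6 + 6*\<eta> + 12*\<eta>^2 +
      3*\<eta>^3)*t"
definition h where "h = (36 + 72*\<eta> + 72*\<eta>^2 + 72*\<eta>^3 + 144*\<eta>^4 + 216*\<eta>^5 + 216*\<eta>^8 -
      72*\<eta>^9 - 144*\<eta>^10 + 72*\<eta>^11 - 36*\<eta>^12 - 72*\<eta>^13) + (- 72 -
      72*\<eta> - 144*\<eta>^2 - 252*\<eta>^3 - 216*\<eta>^4 - 432*\<eta>^5 - 324*\<eta>^6 -
      216*\<eta>^7 - 432*\<eta>^8 - 180*\<eta>^9 - 72*\<eta>^10 - 144*\<eta>^11 - 36*\<eta>^12)*t"

text \<open>Multiplication in the basis \<open>1, t\<close>. Once both sides are in normal form, an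
  identity splits into two polynomial identities in \<open>\<eta>\<close> alone.\<close>

lemma mult_normal: "(p + q*t)*(r + s*t) = (p*r + q*s*\<eta>^3) + (p*s + q*r + q*s)*t"
proof -
  have "(p + q*t)*(r + s*t) = p*r + (p*s + q*r)*t + q*s*(t*t)" by (simp add: algebra_simps)
  then show ?thesis unfolding t by (simp add: algebra_simps)
qed

lemma normal_simps:
  "(p + q*t) - (r + s*t) = (p - r) + (q - s)*t" "(p + q*t) + (r + s*t) = (p + r) + (q + s)*t"
  "2*(p + q*t) = 2*p + (2*q)*t" "k*(1 + \<eta>^3)^3*(p + q*t) = k*(1 + \<eta>^3)^3*p + (k*(1 + \<eta>^3)^3*q)*t"
  "(p + q*t)*(k*(1 + \<eta>^3)^3) = k*(1 + \<eta>^3)^3*p + (k*(1 + \<eta>^3)^3*q)*t"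
  "k*(1 + \<eta>^3)^3 + (p + q*t) = (k*(1 + \<eta>^3)^3 + p) + q*t"
  "(p + q*t) + k*(1 + \<eta>^3)^3 = (p + k*(1 + \<eta>^3)^3) + q*t"
  by (simp_all add: algebra_simps)

lemma normal_eqI: "p = r \<Longrightarrow> q = s \<Longrightarrow> p + q*t = r + s*t" by simp
lemma normal_eqI': "p = r \<Longrightarrow> q = 0 \<Longrightarrow> p + q*t = r" by simp

lemma coeff_normal: "- 27*l^2 = cA" "- 54*l*b = cB" "- 27*b^2 = cC"
proof -
  have s: "- 27*(p + q*t) = (- 27*p) + (- 27*q)*t" "- 54*(p + q*t) = (- 54*p) + (- 54*q)*t" for p q
    by (simp_all add: algebra_simps)
  show "- 27*l^2 = cA"
    unfolding power2_eq_square l_def cA_def mult_normal s by (rule normal_eqI; Groebner_Basis.algebra)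
  show "- 54*l*b = cB"
    unfolding mult.assoc unfolding l_def b_def cB_def mult_normal s by (rule normal_eqI; Groebner_Basis.algebra)
  show "- 27*b^2 = cC"
    unfolding power2_eq_square b_def cC_def mult_normal s by (rule normal_eqI; Groebner_Basis.algebra)
qed

lemma b_eq: "b = 4*(27*(\<eta>^3)^3 - l^3)"
proof -
  have s: "4*(k - (p + q*t)) = (4*k - 4*p) + (- 4*q)*t" for k p q by (simp add: algebra_simps)
  show ?thesis
    unfolding power3_eq_cube[of l] unfolding l_def b_def mult_normal s by (rule normal_eqI; Groebner_Basis.algebra)
qed

text \<open>With \<open>m = \<eta>^3\<close> the left side is the cofactor of \<open>3 m - l\<close>
  in \<open>27 m^3 - l^3 = b / 4\<close>. That it is the cube of \<open>1 + m = t^2 - t + 1\<close>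
  gives \<open>x3\<close> and \<open>y3\<close> their short form.\<close>

lemma norm_eq: "9*(\<eta>^3)^2 + 3*\<eta>^3*l + l^2 = (1 + \<eta>^3)^3"
proof -
  have s: "3*\<eta>^3*(p + q*t) = 3*\<eta>^3*p + (3*\<eta>^3*q)*t" "k + (p + q*t) + (r + u*t) = (k + p + r) + (q + u)*t" for k p q r u
    by (simp_all add: algebra_simps)
  show ?thesis
    unfolding power2_eq_square[of l] unfolding l_def mult_normal s
    by (rule normal_eqI'; Groebner_Basis.algebra)
qed

lemma b_factor: "b = 4*(3*\<eta>^3 - l)*(1 + \<eta>^3)^3"
  unfolding b_eq norm_eq[symmetric] by (simp add: ring_expand)

lemma flex:
  defines "k \<equiv> 3*(6*\<eta>^3 + l)"
  shows "x3 + x3 + x3 = k^2 - cA" "x3*x3 + x3*x3 + x3*x3 = cB - 2*k*(y3 - k*x3)" "x3*x3*x3 = (y3 - k*x3)^2 - cC"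
proof -
  \<comment> \<open>Written in \<open>l\<close> and \<open>m\<close>, the flex conditions are
    identities that no longer involve the relation between \<open>t\<close> and
    \<open>\<eta>\<close>.\<close>
  define m where "m = \<eta>^3"
  have x: "x3 = 12*(9*m^2 + 3*m*l + l^2)" "y3 = 108*m*(9*m^2 + 3*m*l + l^2)" "b = 4*(27*m^3 - l^3)"
    unfolding x3_def y3_def b_eq norm_eq[symmetric] m_def by simp_all
  show "x3 + x3 + x3 = k^2 - cA" "x3*x3 + x3*x3 + x3*x3 = cB - 2*k*(y3 - k*x3)" "x3*x3*x3 = (y3 - k*x3)^2 - cC"
    unfolding coeff_normal[symmetric] x k_def m_def[symmetric] by Groebner_Basis.algebra+
qed

lemma tangent: "x + x + x2 = sl^2 - cA" "x*x + x*x2 + x*x2 = cB - 2*sl*n" "x*x*x2 = n^2 - cC"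
  unfolding power2_eq_square mult.assoc[of 2 sl n]
  unfolding cA_def cB_def cC_def x_def x2_def sl_def n_def mult_normal normal_simps(1-3)
  by (rule normal_eqI; Groebner_Basis.algebra)+

lemma chord: "x + x2 + x3 = sm^2 - cA" "x*x2 + x*x3 + x2*x3 = cB - 2*sm*h" "x*x2*x3 = h^2 - cC"
  unfolding power2_eq_square mult.assoc[of 2 sm h]
  unfolding cA_def cB_def cC_def x_def x2_def x3_def sm_def h_def mult_normal normal_simps
  by (rule normal_eqI; Groebner_Basis.algebra)+

lemma chord_ends:
  "sl*x + n = sm*x + h" "- (sl*x2 + n) = sm*x2 + h" "y3 = - (sm*x3 + h)"
proof -
  show "sl*x + n = sm*x + h"
    unfolding sl_def sm_def x_def n_def h_def mult_normal normal_simps(1,2) by (rule normal_eqI; Groebner_Basis.algebra)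
  have "(sl*x2 + n) + (sm*x2 + h) = 0"
    unfolding sl_def sm_def x2_def n_def h_def mult_normal normal_simps(1,2) by (rule normal_eqI'; Groebner_Basis.algebra)
  then show "- (sl*x2 + n) = sm*x2 + h" by (metis add_eq_0_iff)
  have "(sm*x3 + h) = - y3"
    unfolding sm_def h_def x3_def y3_def normal_simps by (rule normal_eqI'; Groebner_Basis.algebra)
  then show "y3 = - (sm*x3 + h)" by simp
qed

end

lemma meets_of_int:
  assumes "wcurve (of_int a) (of_int b) (of_int c :: 'a::field_char_0)"
    "x1 + x2 + x3 = l^2 - a" "x1*x2 + x1*x3 + x2*x3 = b - 2*l*n" "x1*x2*x3 = n^2 - c"
  shows "wcurve.meets (of_int a) (of_int b) (of_int c) (of_int l) (of_int n) (of_int x1) (of_int x2) (of_int x3 :: 'a)"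
  using assms(2-4)[THEN arg_cong, of "of_int :: int \<Rightarrow> 'a"]
  unfolding wcurve.meets_def[OF assms(1)] by simp

text \<open>Besides the flex \<open>(0, n)\<close> the curve has the rational 2-torsion point \<open>(- D\<^sup>4, 0)\<close>, \<open>D = k\<^sup>2 - 1\<close>,
  which is twice the point with abscissa \<open>4 D\<^sup>3\<close>: this is a parametrization of \<open>X\<^sub>1(12)\<close>.\<close>

lemma member_3_12:
  fixes k :: int
  assumes k: "k mod 217 = 4 mod 217"
  defines "l \<equiv> 3 + 6*k^2 - k^4" and "n \<equiv> 4 * ((k^2 - 1)^4 * (k^2 + 1))"
  shows "sextic_torsion (l^2) (2*l*n) (n^2) (integer_mod_group 3 \<times>\<times> integer_mod_group 12)"
proof -
  \<comment> \<open>Taking out the factor 4 makes \<open>l^3 - 27 n / 4\<close> an integer, so that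
    its cube root is both the generator \<open>\<alpha>\<close> and the \<open>\<delta>\<close> of
    \<open>flex_delta\<close>.\<close>
  define n0 where "n0 = (k^2 - 1)^4 * (k^2 + 1)"
  have nn: "n = 4 * n0" unfolding n_def n0_def ..
  have k31: "k mod 31 = 4 mod 31" and k7: "k mod 7 = 4 mod 7"
    by (rule mod_eq_reduce[OF k], simp)+
  have r1: "l mod 31 = (3 + 6*4^2 - 4^4) mod 31" "n0 mod 31 = ((4^2 - 1)^4 * (4^2 + 1)) mod 31"
    "l mod 7 = (3 + 6*4^2 - 4^4) mod 7" "n0 mod 7 = ((4^2 - 1)^4 * (4^2 + 1)) mod 7"
    unfolding l_def n0_def by (intro int_mod_cong refl k31 k7)+
  have l: "l mod 31 = 29 mod 31" "l mod 7 = 4 mod 7" and n: "n0 mod 31 = 3 mod 31" "n0 mod 7 = 3 mod 7"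
    unfolding r1 by simp_all
  have r2: "l^2 mod 31 = 29^2 mod 31" "(2*l*n) mod 31 = (2*29*(4*3)) mod 31" "n^2 mod 31 = (4*3)^2 mod 31"
    "(27*n0 - l^3) mod 31 = (27*3 - 29^3) mod 31" "(27*n0 - l^3) mod 7 = (27*3 - 4^3) mod 7"
    unfolding nn by (intro int_mod_cong refl l n)+
  have red: "l^2 mod 31 = 4 mod 31" "(2*l*n) mod 31 = 14 mod 31" "n^2 mod 31 = 20 mod 31"
    "(27*n0 - l^3) mod 31 = 27 mod 31" "(27*n0 - l^3) mod 7 = 3 mod 7" unfolding r2 by simp_all
  obtain \<alpha> \<beta> where S: "sextic_field 0 0 (27*n0 - l^3) (-3) \<alpha> \<beta>"
    "wcurve (of_int (l^2)) (of_int (2*l*n)) (of_int (n^2) :: rat alg_closure)"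
    "finite (torsion_points (l^2) (2*l*n) (n^2) (sextic_field.K \<alpha> \<beta>))"
    "card (torsion_points (l^2) (2*l*n) (n^2) (sextic_field.K \<alpha> \<beta>)) \<le> 36"
    "disc3 (l^2) (2*l*n) (n^2) \<noteq> 0"
  \<comment> \<open>Modulo 31 the residues of \<open>\<alpha>\<close> and of a square root of -3 are
    16 and 11; modulo 7 the cubic \<open>X^3 + 3\<close> has no root.\<close>
  proof (rule sextic_field_torsion_bound[of 31 31 "l^2" 4 "2*l*n" 14 "n^2" 20 0 0 0 0 "27*n0 - l^3" 27 "-3" "-3" 16 11 7 0 0 3 5 "-3" 36])
    show "card {(a, b). a \<in> {0..<31} \<and> b \<in> {0..<31} \<and> 31 dvd b\<^sup>2 - (a ^ 3 + 4 * a\<^sup>2 + 14 * a + 20 :: int)} < 36"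
      unfolding card_points_3_12 by simp
  qed ((rule red that refl | assumption | simp add: disc3_def upto.simps)+)
  interpret S: sextic_field 0 0 "27*n0 - l^3" "-3" \<alpha> \<beta> by (rule S(1))
  define l' n' where "l' = (of_int l :: rat alg_closure)" "n' = (of_int n :: rat alg_closure)"
  have co: "of_int (l^2) = l'^2" "of_int (2*l*n) = 2*l'*n'" "of_int (n^2) = n'^2" by (simp_all add: l'_n'_def)
  have inK: "of_int i \<in> S.K" for i by (rule field_closedD(11)[OF S.field_closed_K])
  interpret wcurve_over "of_int (l^2)" "of_int (2*l*n)" "of_int (n^2)" S.K
    by (intro wcurve_over.intro S(2) wcurve_over_axioms.intro S.field_closed_K inK)
  have "\<alpha>^3 = of_int (l^3 - 27*n0)" using S.\<alpha> by (simp add: algebra_simps add_eq_0_iff)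
  then have \<delta>: "27 * n' = 4 * (l'^3 - \<alpha>^3)" by (simp add: l'_n'_def nn)
  have \<beta>: "\<beta>^2 = -3" using S.\<beta> by simp
  have K: "l' \<in> S.K" "n' \<in> S.K" "\<alpha> \<in> S.K" "\<beta> \<in> S.K"
    using inK S.\<alpha>_K S.\<beta>_K by (auto simp: l'_n'_def)
  \<comment> \<open>With \<open>l = 8 + 4 D - D^2\<close> and \<open>n = 4 D^4 (D + 2)\<close>, the
    linear form \<open>l x + n\<close> equals \<open>D^6\<close> at \<open>x = - D^4\<close>, so the
    cubic vanishes there. The line \<open>8 k (x + D^4)\<close> is a tangent through this
    point.\<close>
  define D where "D = k^2 - 1"
  have Dk: "k^2 = D + 1" "k^4 = (D + 1)^2" unfolding D_def by (simp_all flip: power_mult)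
  have four: "meets (of_int (8*k)) (of_int (8*k*D^4)) (of_int (4*D^3)) (of_int (4*D^3)) (of_int (- (D^4)))"
  proof (rule meets_of_int[OF S(2)])
    have l4: "l = 8 + 4*D - D^2" and n4: "n = 4 * (D^4 * (D + 2))"
      unfolding l_def n_def Dk by (simp_all add: algebra_simps power2_eq_square)
    have sq: "(8*k)^2 = 64*(D + 1)" "2*(8*k)*(8*k*D^4) = 128*(D + 1)*D^4" "(8*k*D^4)^2 = 64*(D + 1)*D^8"
      by (simp_all add: Dk(1)[symmetric] power2_eq_square flip: power_add)
    show "4*D^3 + 4*D^3 + - (D^4) = (8*k)^2 - l^2"
      unfolding sq l4 by (simp add: algebra_simps power_numeral_reduce)
    show "4*D^3*(4*D^3) + 4*D^3*(- (D^4)) + 4*D^3*(- (D^4)) = 2*l*n - 2*(8*k)*(8*k*D^4)"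
      unfolding sq l4 n4 by (simp add: algebra_simps power_numeral_reduce)
    show "4*D^3*(4*D^3)*(- (D^4)) = (8*k*D^4)^2 - n^2"
      unfolding sq n4 by (simp add: algebra_simps power_numeral_reduce)
  qed
  have "of_int (8*k) * of_int (- (D^4)) + of_int (8*k*D^4) = (0 :: rat alg_closure)" by simp
  moreover have "of_int (8*k) * of_int (4*D^3) + of_int (8*k*D^4) \<in> S.K"
    using inK by (intro field_closedD(5,6)[OF S.field_closed_K])
  ultimately have "T \<cong> integer_mod_group 3 \<times>\<times> integer_mod_group 12"
    by (intro torsion_3_12[OF S(3,4) flex_zero[OF co] refl _ _ flex_delta[OF co \<delta> \<beta>] refl _ _ flex_delta_nonzero[OF co \<delta>] four _ _ inK inK])
      (use K in \<open>auto intro!: field_closedD[OF S.field_closed_K]\<close>)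
  then show ?thesis by (rule sextic_torsionI[OF S(5) S.number_field_K])
qed

lemma member_3_9:
  fixes t :: int
  assumes t: "t mod 217 = 2 mod 217"
  defines "m \<equiv> t*(t - 1)" and "l \<equiv> t^3 - 3*t^2 + 1" and "b \<equiv> 4*(27*(t*(t - 1))^3 - (t^3 - 3*t^2 + 1)^3)"
  shows "sextic_torsion (- 27*l^2) (- 54*l*b) (- 27*b^2) (integer_mod_group 3 \<times>\<times> integer_mod_group 9)"
proof -
  have b: "b = 4*(27*m^3 - l^3)" unfolding b_def m_def l_def ..
  have t31: "t mod 31 = 2 mod 31" and t7: "t mod 7 = 2 mod 7"
    by (rule mod_eq_reduce[OF t], simp)+
  have r1: "l mod 31 = (2^3 - 3*2^2 + 1) mod 31" "m mod 31 = (2*(2 - 1)) mod 31" "(- m) mod 7 = (- (2*(2 - 1))) mod 7"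
    "b mod 31 = (4*(27*(2*(2 - 1))^3 - (2^3 - 3*2^2 + 1)^3)) mod 31"
    unfolding l_def m_def b_def by (intro int_mod_cong refl t31 t7)+
  have l: "l mod 31 = 28 mod 31" and m: "m mod 31 = 2 mod 31" and b31: "b mod 31 = 11 mod 31"
    unfolding r1 by simp_all
  have r2: "(- 27*l^2) mod 31 = (- 27*28^2) mod 31" "(- 54*l*b) mod 31 = (- 54*28*11) mod 31"
    "(- 27*b^2) mod 31 = (- 27*11^2) mod 31" "(- m) mod 31 = (- 2) mod 31"
    by (intro int_mod_cong refl l m b31)+
  have red: "(- 27*l^2) mod 31 = 5 mod 31" "(- 54*l*b) mod 31 = 15 mod 31" "(- 27*b^2) mod 31 = 19 mod 31"
    "(- m) mod 31 = 29 mod 31" "(- m) mod 7 = 5 mod 7" unfolding r2 r1 by simp_all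
  obtain \<alpha> \<beta> where S: "sextic_field 0 0 (- m) (-3) \<alpha> \<beta>"
    "wcurve (of_int (- 27*l^2)) (of_int (- 54*l*b)) (of_int (- 27*b^2) :: rat alg_closure)"
    "finite (torsion_points (- 27*l^2) (- 54*l*b) (- 27*b^2) (sextic_field.K \<alpha> \<beta>))"
    "card (torsion_points (- 27*l^2) (- 54*l*b) (- 27*b^2) (sextic_field.K \<alpha> \<beta>)) \<le> 27"
    "disc3 (- 27*l^2) (- 54*l*b) (- 27*b^2) \<noteq> 0"
  \<comment> \<open>Here \<open>m\<close> is 2 modulo 31 and modulo 7: it is \<open>4^3\<close>
    modulo 31 but not a cube modulo 7. Again 11 is a square root of -3 modulo 31.\<close>
  proof (rule sextic_field_torsion_bound[of 31 31 "- 27*l^2" 5 "- 54*l*b" 15 "- 27*b^2" 19 0 0 0 0 "- m" 29 "-3" "-3" 4 11 7 0 0 5 5 "-3" 27])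
    show "card {(a, b). a \<in> {0..<31} \<and> b \<in> {0..<31} \<and> 31 dvd b\<^sup>2 - (a ^ 3 + 5 * a\<^sup>2 + 15 * a + 19 :: int)} < 27"
      unfolding card_points_3_9 by simp
  qed ((rule red that refl | assumption | simp add: disc3_def upto.simps)+)
  interpret S: sextic_field 0 0 "- m" "-3" \<alpha> \<beta> by (rule S(1))
  have inK: "of_int i \<in> S.K" for i by (rule field_closedD(11)[OF S.field_closed_K])
  interpret wcurve_over "of_int (- 27*l^2)" "of_int (- 54*l*b)" "of_int (- 27*b^2)" S.K
    by (intro wcurve_over.intro S(2) wcurve_over_axioms.intro S.field_closed_K inK)
  have m\<alpha>: "\<alpha>^3 = of_int m" using S.\<alpha> by simp
  have \<beta>: "\<beta>^2 = -3" using S.\<beta> by simp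
  define s where "s = (of_int t :: rat alg_closure)"
  interpret N: nine_torsion_data s \<alpha>
    by unfold_locales (simp add: m\<alpha> m_def s_def algebra_simps)
  have ss: "s^2 = s + \<alpha>^3" using N.t by (simp add: power2_eq_square)
  have Nl: "of_int l = N.l"
  proof -
    have "s^3 = s*(s*s)" by (simp add: power3_eq_cube)
    also have "\<dots> = s*(s + \<alpha>^3)" by (simp only: N.t)
    also have "\<dots> = s*s + s*\<alpha>^3" by (simp add: algebra_simps)
    also have "\<dots> = s + \<alpha>^3 + s*\<alpha>^3" by (simp only: N.t)
    finally have s3: "s^3 = s + \<alpha>^3 + s*\<alpha>^3" .
    have "of_int l = s^3 - 3*s^2 + 1" unfolding l_def s_def by simp
    also have "\<dots> = N.l" unfolding s3 ss N.l_def by (simp add: algebra_simps)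
    finally show ?thesis .
  qed
  have Nb: "of_int b = N.b" unfolding b N.b_eq by (simp add: m\<alpha> Nl)
  have co: "of_int (- 27*l^2) = N.cA" "of_int (- 54*l*b) = N.cB" "of_int (- 27*b^2) = N.cC"
    unfolding N.coeff_normal[symmetric] by (simp_all add: Nl Nb)
  have \<beta>\<beta>: "(3*\<beta>*u) * (3*\<beta>*v) = - 27*(u*v)" for u v
  proof -
    have "(3*\<beta>*u) * (3*\<beta>*v) = 9*\<beta>^2*(u*v)" by (simp add: algebra_simps power2_eq_square)
    then show ?thesis unfolding \<beta> by simp
  qed
  \<comment> \<open>Since \<open>- 27 = (3 \<beta>)^2\<close>, over K the curve has the shape
    required by \<open>flex_zero\<close>. Its flex above 0 involves \<open>\<beta>\<close> and is
    the 3-torsion point that complements the point of order 9.\<close>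
  have co3: "of_int (- 27*l^2) = (3*\<beta>*N.l)^2" "of_int (- 54*l*b) = 2*(3*\<beta>*N.l)*(3*\<beta>*N.b)" "of_int (- 27*b^2) = (3*\<beta>*N.b)^2"
    unfolding power2_eq_square[of "3*\<beta>*_"] mult.assoc[of 2] \<beta>\<beta> by (simp_all add: Nl Nb power2_eq_square)
  have K: "s \<in> S.K" "\<alpha> \<in> S.K" "\<beta> \<in> S.K" "N.l \<in> S.K" "N.b \<in> S.K"
    using inK[of t] inK[of l] inK[of b] S.\<alpha>_K S.\<beta>_K unfolding Nl Nb s_def[symmetric] by auto
  note fc = field_closedD[OF S.field_closed_K]
  have xK: "N.x \<in> S.K" "N.sl \<in> S.K" "N.n \<in> S.K" "N.x3 \<in> S.K" "N.y3 \<in> S.K"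
    unfolding N.x_def N.sl_def N.n_def N.x3_def N.y3_def using K by (auto intro!: fc)
  have tangent: "meets N.sl N.n N.x N.x N.x2" and chord: "meets N.sm N.h N.x N.x2 N.x3"
    unfolding meets_def unfolding co using N.tangent N.chord by auto
  have flex: "meets (3*(6*\<alpha>^3 + N.l)) (N.y3 - 3*(6*\<alpha>^3 + N.l)*N.x3) N.x3 N.x3 N.x3"
    unfolding meets_def unfolding co using N.flex by auto
  have x3: "0 \<noteq> N.x3"
  proof
    assume "0 = N.x3"
    then have "N.b = 0" unfolding N.x3_def N.b_factor by simp
    then show False using smooth[of 0] Nb by simp
  qed
  have on: "on_curve (Affine N.x (N.sl*N.x + N.n))" by (rule meets_on_curve[OF tangent])
  have "N.sl*N.x + N.n \<in> S.K" using xK by (auto intro!: fc)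
  have y3: "N.y3 = 3*(6*\<alpha>^3 + N.l)*N.x3 + (N.y3 - 3*(6*\<alpha>^3 + N.l)*N.x3)" by simp
  note nine = nine_torsion[OF on xK(1) \<open>N.sl*N.x + N.n \<in> S.K\<close> tangent refl chord N.chord_ends(1,2) flex y3 xK(4,5) N.chord_ends(3)]
  have "T \<cong> integer_mod_group 3 \<times>\<times> integer_mod_group 9"
    by (rule torsion_3_9[OF S(3,4) flex_zero[OF co3] refl _ _ flex y3 xK(4,5) x3 nine(3,2)])
      (use K in \<open>auto intro!: fc\<close>)
  then show ?thesis by (rule sextic_torsionI[OF S(5) S.number_field_K])
qed

text \<open>Tate's curve \<open>y\<^sup>2 + (1 - c) x y - b y = x\<^sup>3 - b x\<^sup>2\<close> with Kubert's \<open>b\<close>, \<open>c\<close> for \<open>X\<^sub>1(9)\<close>, after completing the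
  square and scaling \<open>x\<close> by 4; \<open>(0, - 4 b)\<close> has order 9.  The sextic field is the splitting field of the
  2-division polynomial, whose roots other than \<open>\<alpha>\<close> are \<open>(- a\<^sub>2 - \<alpha> \<plusminus> \<beta> / f'(\<alpha>)) / 2\<close>.\<close>

lemma member_2_18:
  fixes t :: int
  assumes t: "t mod 2639 = 2 mod 2639"
  defines "c \<equiv> t^2*(t - 1)" and "b \<equiv> t^2*(t - 1)*(t^2 - t + 1)"
  shows "sextic_torsion ((1 - c)^2 - 4*b) (- 8*b*(1 - c)) (16*b^2) (integer_mod_group 2 \<times>\<times> integer_mod_group 18)"
proof -
  define a2 a4 a6 where "a2 = (1 - c)^2 - 4*b" "a4 = - 8*b*(1 - c)" "a6 = 16*b^2"
  note a_def = this
  have red: "a2 mod p = (- 39) mod p" "a4 mod p = 288 mod p" "a6 mod p = 2304 mod p"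
    if "p dvd 2639" for p
  proof -
    note tp = mod_eq_reduce[OF t that]
    have "a2 mod p = ((1 - 2^2*(2 - 1))^2 - 4*(2^2*(2 - 1)*(2^2 - 2 + 1))) mod p"
      "a4 mod p = (- 8*(2^2*(2 - 1)*(2^2 - 2 + 1))*(1 - 2^2*(2 - 1))) mod p"
      "a6 mod p = (16*(2^2*(2 - 1)*(2^2 - 2 + 1))^2) mod p"
      unfolding a_def b_def c_def by (intro int_mod_cong refl tp)+
    then show "a2 mod p = (- 39) mod p" "a4 mod p = 288 mod p" "a6 mod p = 2304 mod p" by simp_all
  qed
  note r29 = red[of 29, simplified] and r7 = red[of 7, simplified] and r13 = red[of 13, simplified]
  have red29: "a2 mod 29 = 19 mod 29" "a4 mod 29 = 27 mod 29" "a6 mod 29 = 13 mod 29"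
    using r29 by simp_all
  have red7: "a2 mod 7 = 3 mod 7" "a4 mod 7 = 1 mod 7" "a6 mod 7 = 1 mod 7"
    using r7 by simp_all
  have d29: "disc3 a2 a4 a6 mod 29 = 1 mod 29"
    unfolding disc3_mod_cong[OF red29] by (simp add: disc3_def)
  have d13: "disc3 a2 a4 a6 mod 13 = 11 mod 13"
  proof -
    have "a2 mod 13 = 0 mod 13" "a4 mod 13 = 2 mod 13" "a6 mod 13 = 3 mod 13" using r13 by simp_all
    from disc3_mod_cong[OF this] show ?thesis by (simp add: disc3_def)
  qed
  obtain \<alpha> \<beta> where S: "sextic_field a2 a4 a6 (disc3 a2 a4 a6) \<alpha> \<beta>"
    "wcurve (of_int a2) (of_int a4) (of_int a6 :: rat alg_closure)"
    "finite (torsion_points a2 a4 a6 (sextic_field.K \<alpha> \<beta>))"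
    "card (torsion_points a2 a4 a6 (sextic_field.K \<alpha> \<beta>)) \<le> 36"
    "disc3 a2 a4 a6 \<noteq> 0"
  \<comment> \<open>Modulo 29 the cubic has the root 20 and discriminant 1, the square of 1. It has
    no root modulo 7, and its discriminant 11 is no square modulo 13.\<close>
  proof (rule sextic_field_torsion_bound[of 29 29 a2 19 a4 27 a6 13 a2 19 a4 27 a6 13 "disc3 a2 a4 a6" 1 20 1 7 3 1 1 13 11 36])
    show "card {(a, b). a \<in> {0..<29} \<and> b \<in> {0..<29} \<and> 29 dvd b\<^sup>2 - (a ^ 3 + 19 * a\<^sup>2 + 27 * a + 13 :: int)} < 36"
      unfolding card_points_2_18 by simp
  qed ((rule red29 red7 d29 d13 that refl | assumption | simp add: disc3_def upto.simps)+)
  interpret S: sextic_field a2 a4 a6 "disc3 a2 a4 a6" \<alpha> \<beta> by (rule S(1))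
  have inK: "of_int i \<in> S.K" for i by (rule field_closedD(11)[OF S.field_closed_K])
  interpret wcurve_over "of_int a2" "of_int a4" "of_int a6" S.K
    by (intro wcurve_over.intro S(2) wcurve_over_axioms.intro S.field_closed_K inK)
  note fc = field_closedD[OF S.field_closed_K]
  let ?A = "of_int a2 :: rat alg_closure" and ?B = "of_int a4 :: rat alg_closure" and ?C = "of_int a6 :: rat alg_closure"
  define f' where "f' = 3*\<alpha>^2 + 2*?A*\<alpha> + ?B"
  define w where "w = \<beta> / f'"
  define e where "e = (w - ?A - \<alpha>) / 2"
  have f': "f' \<noteq> 0" unfolding f'_def by (rule smooth[OF S.\<alpha>])
  \<comment> \<open>The discriminant of the cubic is \<open>f'^2\<close> times that of its quotient
    by \<open>x - \<alpha>\<close>, so \<open>w\<close> is a square root of the latter and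
    \<open>e\<close> comes from the quadratic formula.\<close>
  have "w^2 = (?A + \<alpha>)^2 - 4*(?B + \<alpha>*(?A + \<alpha>))"
  proof -
    have C: "?C = - (\<alpha>^3 + ?A*\<alpha>^2 + ?B*\<alpha>)" using S.\<alpha> by (simp add: add_eq_0_iff2 add.commute add.left_commute)
    have "\<beta>^2 = ?A^2*?B^2 - 4*?B^3 - 4*?A^3*?C - 27*?C^2 + 18*?A*?B*?C"
      unfolding S.\<beta> disc3_def by simp
    also have "\<dots> = f'^2 * ((?A + \<alpha>)^2 - 4*(?B + \<alpha>*(?A + \<alpha>)))"
      unfolding f'_def C by (simp add: ring_expand)
    finally show ?thesis unfolding w_def power_divide using f' by simp
  qed
  then have quad: "e^2 + (?A + \<alpha>)*e + (?B + \<alpha>*(?A + \<alpha>)) = 0"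
  proof -
    have "4*(e^2 + (?A + \<alpha>)*e + (?B + \<alpha>*(?A + \<alpha>))) = w^2 - ((?A + \<alpha>)^2 - 4*(?B + \<alpha>*(?A + \<alpha>)))"
      unfolding e_def by (simp add: field_simps power2_eq_square)
    also have "\<dots> = 0" unfolding \<open>w^2 = _\<close> by simp
    finally show ?thesis by (metis mult_eq_0_iff zero_neq_numeral)
  qed
  have \<alpha>: "on_curve (Affine \<alpha> 0)" using S.\<alpha> by simp
  have "e^3 + ?A*e^2 + ?B*e + ?C = (e - \<alpha>) * (e^2 + (?A + \<alpha>)*e + (?B + \<alpha>*(?A + \<alpha>)))
      + (\<alpha>^3 + ?A*\<alpha>^2 + ?B*\<alpha> + ?C)"
    by (simp add: ring_expand)
  then have e: "on_curve (Affine e 0)" using quad S.\<alpha> by simp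
  have ne: "\<alpha> \<noteq> e"
  proof
    assume "\<alpha> = e"
    then have "f' = 0" using quad unfolding f'_def by (simp add: algebra_simps power2_eq_square)
    then show False using f' by simp
  qed
  have eK: "e \<in> S.K" unfolding e_def w_def f'_def
    using S.\<alpha>_K S.\<beta>_K inK by (intro fc)
  \<comment> \<open>The slope of the inflectional tangent at three times the point, whose
    coordinates are \<open>4 c\<close> and \<open>4 b - 4 c - 4 c^2\<close>.\<close>
  define k where "k = 3*t^2 - t^3 - 1"
  have tangent: "meets (of_int (1 - c)) (of_int (- 4*b)) (of_int 0) (of_int 0) (of_int (4*b))"
    and chord: "meets (of_int (c + 1)) (of_int (- 4*b)) (of_int 0) (of_int (4*b)) (of_int (4*c))"
    by (rule meets_of_int[OF S(2)]; simp add: a_def algebra_simps power2_eq_square)+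
  have flex: "meets (of_int k) (of_int (4*b - 4*c - 4*c^2 - k*(4*c))) (of_int (4*c)) (of_int (4*c)) (of_int (4*c))"
    by (rule meets_of_int[OF S(2)]; simp add: a_def k_def b_def c_def ring_expand)
  have on: "on_curve (Affine (of_int 0) (of_int (- 4*b)))" using meets_on_curve[OF tangent] by simp
  have "T.indep_pair 1 9 Infinity (Affine (of_int 0) (of_int (- 4*b)))"
    by (rule nine_torsion(3)[OF on inK inK tangent _ chord _ _ flex _ inK inK[of "4*b - 4*c - 4*c^2"]]) (simp_all add: algebra_simps power2_eq_square)
  then have "T \<cong> integer_mod_group 2 \<times>\<times> integer_mod_group 18"
    by (rule torsion_2_18[OF S(3,4) \<alpha> S.\<alpha>_K e eK ne])
  then show ?thesis unfolding a_def[symmetric] by (rule sextic_torsionI[OF S(5) S.number_field_K])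
qed

theorem theorem3p6:
  shows "\<forall>H \<in> {integer_mod_group 2 \<times>\<times> integer_mod_group 18,
                integer_mod_group 3 \<times>\<times> integer_mod_group 9,
                integer_mod_group 3 \<times>\<times> integer_mod_group 12,
                integer_mod_group 6 \<times>\<times> integer_mod_group 6}.
         \<exists>S :: rat weierstrass set.
           infinite S \<and>
           (\<forall>E \<in> S. elliptic_curve E) \<and>
           (\<forall>E \<in> S. \<forall>E' \<in> S. E \<noteq> E' \<longrightarrow>
              \<not> isomorphic_curves (base_change E) (base_change E')) \<and>
           (\<forall>E \<in> S. \<exists>K. number_field_of_degree 6 K \<and>
              torsion_subgroup (point_group (base_change E) K) \<cong> H)"
proof (intro ballI; elim insertE emptyE; hypsubst)
  show "\<exists>S. infinite S \<and> (\<forall>E\<in>S. elliptic_curve E) \<and>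
      (\<forall>E\<in>S. \<forall>E'\<in>S. E \<noteq> E' \<longrightarrow> \<not> isomorphic_curves (base_change E) (base_change E')) \<and>
      (\<forall>E\<in>S. \<exists>K. number_field_of_degree 6 K \<and> torsion_subgroup (point_group (base_change E) K)
         \<cong> integer_mod_group 2 \<times>\<times> integer_mod_group 18)"
    \<comment> \<open>At \<open>\<tau> = 0\<close> both \<open>b\<close> and \<open>c\<close>
      vanish, which leaves the node of \<open>x^3 + x^2\<close>.\<close>
    by (rule infinite_sextic_family[where \<tau> = 0 and n = 2639 and r = 2, OF _ _ _ _ _ _ member_2_18, rotated -1], assumption)
      (intro polyfun_intros | simp add: disc3_def)+
  show "\<exists>S. infinite S \<and> (\<forall>E\<in>S. elliptic_curve E) \<and>
      (\<forall>E\<in>S. \<forall>E'\<in>S. E \<noteq> E' \<longrightarrow> \<not> isomorphic_curves (base_change E) (base_change E')) \<and>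
      (\<forall>E\<in>S. \<exists>K. number_field_of_degree 6 K \<and> torsion_subgroup (point_group (base_change E) K)
         \<cong> integer_mod_group 3 \<times>\<times> integer_mod_group 9)"
    \<comment> \<open>At \<open>\<tau> = 0\<close> the cubic is \<open>x^3 - 27 (x - 4)^2\<close>,
      with the double root 12.\<close>
    by (rule infinite_sextic_family[where \<tau> = 0 and n = 217 and r = 2, OF _ _ _ _ _ _ member_3_9, rotated -1], assumption)
      (intro polyfun_intros | simp add: disc3_def)+
  show "\<exists>S. infinite S \<and> (\<forall>E\<in>S. elliptic_curve E) \<and>
      (\<forall>E\<in>S. \<forall>E'\<in>S. E \<noteq> E' \<longrightarrow> \<not> isomorphic_curves (base_change E) (base_change E')) \<and>
      (\<forall>E\<in>S. \<exists>K. number_field_of_degree 6 K \<and> torsion_subgroup (point_group (base_change E) K)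
         \<cong> integer_mod_group 3 \<times>\<times> integer_mod_group 12)"
    \<comment> \<open>At \<open>\<tau> = 1\<close> one has \<open>n = 0\<close> and
      \<open>l = 8\<close>, hence a node at 0.\<close>
    by (rule infinite_sextic_family[where \<tau> = 1 and n = 217 and r = 4, OF _ _ _ _ _ _ member_3_12, rotated -1], assumption)
      (intro polyfun_intros | simp add: disc3_def)+
  show "\<exists>S. infinite S \<and> (\<forall>E\<in>S. elliptic_curve E) \<and>
      (\<forall>E\<in>S. \<forall>E'\<in>S. E \<noteq> E' \<longrightarrow> \<not> isomorphic_curves (base_change E) (base_change E')) \<and>
      (\<forall>E\<in>S. \<exists>K. number_field_of_degree 6 K \<and> torsion_subgroup (point_group (base_change E) K)
         \<cong> integer_mod_group 6 \<times>\<times> integer_mod_group 6)"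
    \<comment> \<open>At \<open>\<tau> = 0\<close> one has \<open>n = 0\<close> and
      \<open>l = 1\<close>, again a node at 0.\<close>
    by (rule infinite_sextic_family[where \<tau> = 0 and n = 259 and r = 2, OF _ _ _ _ _ _ member_6_6, rotated -1], assumption)
      (intro polyfun_intros | simp add: disc3_def)+
qed

end
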